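(* Let $a_0,a_1,a_2$ be pairwise coprime positive integers, let $C=C_f\subset\mathbb{P}(a_0,a_1,a_2)$ (over $\mathbb{C}$) be a non-singular plane curve, and let $\overline{C}\subset\mathbb{P}^2$ be its straight cover, assumed non-singular. Then the map $\pi\colon\overline{C}\to C$, $$\pi\colon[y_0:y_1:y_2]\mapsto|y_0^{a_0}:y_1^{a_1}:y_2^{a_2}|,$$ is a surjective map of compact Riemann surfaces. Further, $\pi$ is holomorphic of degree $a_0a_1a_2$, and $\operatorname{mult}_y(\pi)=|G_y|$ for every $y\in\overline{C}$.
   Context: $\mathbb{P}(a_0,a_1,a_2)=(\mathbb{C}^3\setminus\{0\})/\mathbb{C}^\times$ with $\lambda\cdot(x_0,x_1,x_2)=(\lambda^{a_0}x_0,\lambda^{a_1}x_1,\lambda^{a_2}x_2)$; classes are written $|x_0:x_1:x_2|$. A polynomial $f\in\mathbb{C}[x_0,x_1,x_2]$ is weighted-homogeneous of degree $d$ if each of its monomials $x_0^{c_0}x_1^{c_1}x_2^{c_2}$ has $\sum a_ic_i=d$. A plane curve is $C_f=\{f=0\}\subset\mathbb{P}(a_0,a_1,a_2)$ with $f$ weighted-homogeneous without repeated factors; it is non-singular if there is no $p\in\mathbb{C}^3\setminus\{0\}$ with $f(p)=0$ at which all three partial derivatives of $f$ vanish. The straight cover of $C_f$ is $\overline{C}=\{\overline{f}=0\}\subset\mathbb{P}^2$ with $\overline{f}(y_0,y_1,y_2)=f(y_0^{a_0},y_1^{a_1},y_2^{a_2})$, which is homogeneous; it is non-singular if $\overline{f}$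 and its partial derivatives have no common zero in $\mathbb{C}^3\setminus\{0\}$, in which case $\overline{C}$ is a compact Riemann surface. $G=\mu^{a_0}\times\mu^{a_1}\times\mu^{a_2}$ (roots of unity) acts on $\overline{C}$ by $(\sigma_0,\sigma_1,\sigma_2)\cdot[y_0:y_1:y_2]=[\sigma_0y_0:\sigma_1y_1:\sigma_2y_2]$, and $G_y$ is the stabiliser of $y$. The Riemann surface structure on $C$ is the one obtained by identifying $C$ with the orbit space $\overline{C}/G$ (with its quotient Riemann surface structure) via $G\cdot[y_0:y_1:y_2]\mapsto|y_0^{a_0}:y_1^{a_1}:y_2^{a_2}|$. $\operatorname{mult}_y(\pi)$ is the ramification index (local multiplicity) of $\pi$ at $y$. *)

theory Defs
  imports
    "HOL-Complex_Analysis.Complex_Analysis"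
    "HOL-Algebra.Group_Action"
    "HOL-Library.Poly_Mapping"
    "HOL-Computational_Algebra.Squarefree"
begin

section \<open>Polynomials in three variables\<close>

text \<open>
  The variables are indexed by the three-element type \<open>3\<close>, whose elements are \<open>0\<close>, \<open>1\<close>, \<open>2\<close>.
  Multiplication of \<open>poly3\<close> is the convolution product of finitely supported functions, that is,
  multiplication of polynomials.
\<close>

type_synonym poly3 = "(3 \<Rightarrow>\<^sub>0 nat) \<Rightarrow>\<^sub>0 complex"

definition const3 :: "complex \<Rightarrow> poly3" where
  "const3 c = Poly_Mapping.single 0 c"

definition var3 :: "3 \<Rightarrow> poly3" where
  "var3 i = Poly_Mapping.single (Poly_Mapping.single i 1) 1"

definition eval3 :: "poly3 \<Rightarrow> complex ^ 3 \<Rightarrow> complex" where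
  "eval3 f x = (\<Sum>c \<in> Poly_Mapping.keys f.
     Poly_Mapping.lookup f c * (\<Prod>i\<in>UNIV. (x $ i) ^ Poly_Mapping.lookup c i))"

definition subst3 :: "poly3 \<Rightarrow> (3 \<Rightarrow> poly3) \<Rightarrow> poly3" where
  "subst3 f g = (\<Sum>c \<in> Poly_Mapping.keys f.
     const3 (Poly_Mapping.lookup f c) * (\<Prod>i\<in>UNIV. g i ^ Poly_Mapping.lookup c i))"

definition partial3 :: "3 \<Rightarrow> poly3 \<Rightarrow> complex ^ 3 \<Rightarrow> complex" where
  "partial3 i f x = deriv (\<lambda>t. eval3 f (\<chi> j. if j = i then t else x $ j)) (x $ i)"

definition weighted_homogeneous :: "(3 \<Rightarrow> nat) \<Rightarrow> nat \<Rightarrow> poly3 \<Rightarrow> bool" where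
  "weighted_homogeneous a d f \<longleftrightarrow>
     (\<forall>c \<in> Poly_Mapping.keys f. (\<Sum>i\<in>UNIV. a i * Poly_Mapping.lookup c i) = d)"

definition nonsingular :: "poly3 \<Rightarrow> bool" where
  "nonsingular f \<longleftrightarrow> \<not> (\<exists>p. p \<noteq> 0 \<and> eval3 f p = 0 \<and> (\<forall>i. partial3 i f p = 0))"

definition straight_cover_poly :: "(3 \<Rightarrow> nat) \<Rightarrow> poly3 \<Rightarrow> poly3" where
  "straight_cover_poly a f = subst3 f (\<lambda>i. var3 i ^ a i)"

lemma eval3_superset:
  assumes "finite K" "Poly_Mapping.keys f \<subseteq> K"
  shows "eval3 f x = (\<Sum>c\<in>K. Poly_Mapping.lookup f c * (\<Prod>i\<in>UNIV. (x $ i) ^ Poly_Mapping.lookup c i))"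
  unfolding eval3_def using assms
  by (intro sum.mono_neutral_left) (auto simp: in_keys_iff)

lemma eval3_add: "eval3 (f + g) x = eval3 f x + eval3 g x"
proof -
  let ?K = "Poly_Mapping.keys f \<union> Poly_Mapping.keys g"
  have "eval3 (f + g) x = (\<Sum>c\<in>?K. Poly_Mapping.lookup (f + g) c * (\<Prod>i\<in>UNIV. (x $ i) ^ Poly_Mapping.lookup c i))"
    by (rule eval3_superset) (auto simp: Poly_Mapping.keys_add)
  also have "\<dots> = eval3 f x + eval3 g x"
    by (simp add: eval3_superset[of ?K f] eval3_superset[of ?K g] lookup_add
        distrib_right sum.distrib)
  finally show ?thesis .
qed

lemma eval3_single: "eval3 (Poly_Mapping.single c b) x = b * (\<Prod>i\<in>UNIV. (x $ i) ^ Poly_Mapping.lookup c i)"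
  by (simp add: eval3_superset[of "{c}"])

lemma eval3_0: "eval3 0 x = 0" by (simp add: eval3_def)

lemma eval3_sum: "eval3 (sum g K) x = (\<Sum>k\<in>K. eval3 (g k) x)"
  by (induction K rule: infinite_finite_induct) (auto simp: eval3_0 eval3_add)

lemma poly3_eq_sum: "f = (\<Sum>c\<in>Poly_Mapping.keys f. Poly_Mapping.single c (Poly_Mapping.lookup f c))" for f :: poly3
  by (rule poly_mapping_eqI) (auto simp: lookup_sum lookup_single when_def in_keys_iff)

lemma eval3_mult: "eval3 (f * g) x = eval3 f x * eval3 g x"
proof -
  have "f * g = (\<Sum>c\<in>Poly_Mapping.keys f. \<Sum>e\<in>Poly_Mapping.keys g.
      Poly_Mapping.single (c + e) (Poly_Mapping.lookup f c * Poly_Mapping.lookup g e))"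
    by (subst (1) poly3_eq_sum[of f], subst (1) poly3_eq_sum[of g])
      (simp add: sum_product mult_single)
  then show ?thesis
    by (simp add: eval3_sum eval3_single lookup_add power_add prod.distrib eval3_def[of f] eval3_def[of g]
        sum_product mult_ac)
qed

lemma eval3_1: "eval3 1 x = 1"
  using eval3_single[of 0 1 x] by simp

lemma eval3_power: "eval3 (f ^ n) x = eval3 f x ^ n"
  by (induction n) (auto simp: eval3_1 eval3_mult)

lemma eval3_prod: "eval3 (prod g K) x = (\<Prod>k\<in>K. eval3 (g k) x)"
  by (induction K rule: infinite_finite_induct) (auto simp: eval3_1 eval3_mult)

lemma eval3_var3: "eval3 (var3 j) x = x $ j"
proof -
  have "(\<Prod>i\<in>UNIV. (x $ i) ^ Poly_Mapping.lookup (Poly_Mapping.single j 1) i) =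
     (\<Prod>i\<in>UNIV. if i = j then x $ i else 1)"
    by (intro prod.cong) (auto simp: lookup_single when_def)
  then show ?thesis by (simp add: var3_def eval3_single)
qed

lemma eval3_straight_cover_poly:
  "eval3 (straight_cover_poly a f) y = eval3 f (\<chi> i. (y $ i) ^ a i)"
  by (simp add: straight_cover_poly_def subst3_def const3_def eval3_sum eval3_mult eval3_single
      eval3_prod eval3_power eval3_var3 eval3_def[of f])


section \<open>Weighted projective planes and their curves\<close>

definition wclass :: "(3 \<Rightarrow> nat) \<Rightarrow> complex ^ 3 \<Rightarrow> (complex ^ 3) set" where
  "wclass a x = {\<chi> i. l ^ a i * x $ i | l. l \<noteq> 0}"

abbreviation pclass :: "complex ^ 3 \<Rightarrow> (complex ^ 3) set" where
  "pclass \<equiv> wclass (\<lambda>_. 1)"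

definition wcurve :: "(3 \<Rightarrow> nat) \<Rightarrow> poly3 \<Rightarrow> (complex ^ 3) set set" where
  "wcurve a f = {wclass a x | x. x \<noteq> 0 \<and> eval3 f x = 0}"

abbreviation pcurve :: "poly3 \<Rightarrow> (complex ^ 3) set set" where
  "pcurve \<equiv> wcurve (\<lambda>_. 1)"

text \<open>
  The final topology on a set \<open>S\<close> with respect to \<open>f\<close>.  If \<open>f\<close> maps \<open>X\<close> onto \<open>S\<close> this is the
  quotient topology; if moreover \<open>f\<close> is injective, it is the topology of \<open>X\<close> transported to \<open>S\<close>.
\<close>

definition final_topology :: "'a topology \<Rightarrow> ('a \<Rightarrow> 'b) \<Rightarrow> 'b set \<Rightarrow> 'b topology" where
  "final_topology X f S = topology (\<lambda>V. V \<subseteq> S \<and> openin X {x \<in> topspace X. f x \<in> V})"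

lemma openin_final_topology:
  "openin (final_topology X f S) V \<longleftrightarrow> V \<subseteq> S \<and> openin X {x \<in> topspace X. f x \<in> V}"
proof -
  have "istopology (\<lambda>V. V \<subseteq> S \<and> openin X {x \<in> topspace X. f x \<in> V})"
    unfolding istopology_def
  proof (intro conjI allI impI)
    fix V W
    assume V: "V \<subseteq> S \<and> openin X {x \<in> topspace X. f x \<in> V}"
      and W: "W \<subseteq> S \<and> openin X {x \<in> topspace X. f x \<in> W}"
    show "V \<inter> W \<subseteq> S" using V by blast
    have "{x \<in> topspace X. f x \<in> V \<inter> W} = {x \<in> topspace X. f x \<in> V} \<inter> {x \<in> topspace X. f x \<in> W}"
      by blast
    then show "openin X {x \<in> topspace X. f x \<in> V \<inter> W}" using V W by auto
  next
    fix K
    assume K: "\<forall>V\<in>K. V \<subseteq> S \<and> openin X {x \<in> topspace X. f x \<in> V}"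
    show "\<Union>K \<subseteq> S" using K by blast
    have "{x \<in> topspace X. f x \<in> \<Union>K} = (\<Union>V\<in>K. {x \<in> topspace X. f x \<in> V})" by blast
    then show "openin X {x \<in> topspace X. f x \<in> \<Union>K}" using K by auto
  qed
  then show ?thesis
    by (simp add: final_topology_def topology_inverse')
qed

lemma topspace_final_topology:
  assumes "f ` topspace X \<subseteq> S"
  shows "topspace (final_topology X f S) = S"
proof -
  have "{x \<in> topspace X. f x \<in> S} = topspace X" using assms by blast
  then have "openin (final_topology X f S) S" by (simp add: openin_final_topology)
  then show ?thesis
    by (metis openin_final_topology openin_subset openin_topspace subset_antisym)
qed

definition proj_plane_topology :: "(complex ^ 3) set topology" where
  "proj_plane_topology = final_topology (top_of_set (- {0})) pclass (pclass ` (- {0}))"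


section \<open>Riemann surfaces\<close>

text \<open>
  A chart is a pair of its domain and a function, of which only the values on the domain matter.
\<close>

type_synonym 'a chart = "'a set \<times> ('a \<Rightarrow> complex)"

definition complex_chart :: "'a topology \<Rightarrow> 'a set \<Rightarrow> ('a \<Rightarrow> complex) \<Rightarrow> bool" where
  "complex_chart X U \<phi> \<longleftrightarrow> openin X U \<and> open (\<phi> ` U) \<and>
     homeomorphic_map (subtopology X U) (top_of_set (\<phi> ` U)) \<phi>"

definition compatible_charts :: "'a chart \<Rightarrow> 'a chart \<Rightarrow> bool" where
  "compatible_charts = (\<lambda>(U, \<phi>) (V, \<psi>).
     (\<psi> \<circ> inv_into U \<phi>) holomorphic_on (\<phi> ` (U \<inter> V)) \<and>
     (\<phi> \<circ> inv_into V \<psi>) holomorphic_on (\<psi> ` (U \<inter> V)))"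

definition complex_atlas :: "'a topology \<Rightarrow> 'a chart set \<Rightarrow> bool" where
  "complex_atlas X A \<longleftrightarrow>
     (\<forall>(U, \<phi>) \<in> A. complex_chart X U \<phi>) \<and>
     (\<Union>(U, \<phi>) \<in> A. U) = topspace X \<and>
     (\<forall>c \<in> A. \<forall>c' \<in> A. compatible_charts c c')"

definition riemann_surface :: "'a topology \<Rightarrow> 'a chart set \<Rightarrow> bool" where
  "riemann_surface X A \<longleftrightarrow>
     connected_space X \<and> Hausdorff_space X \<and> second_countable X \<and> complex_atlas X A"

definition compact_riemann_surface :: "'a topology \<Rightarrow> 'a chart set \<Rightarrow> bool" where
  "compact_riemann_surface X A \<longleftrightarrow> riemann_surface X A \<and> compact_space X"

definition maximal_atlas :: "'a topology \<Rightarrow> 'a chart set \<Rightarrow> 'a chart set" where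
  "maximal_atlas X A = {(U, \<phi>). complex_chart X U \<phi> \<and> (\<forall>c \<in> A. compatible_charts (U, \<phi>) c)}"

definition holomorphic_map ::
    "'a topology \<Rightarrow> 'a chart set \<Rightarrow> 'b topology \<Rightarrow> 'b chart set \<Rightarrow> ('a \<Rightarrow> 'b) \<Rightarrow> bool" where
  "holomorphic_map X A Y B F \<longleftrightarrow> continuous_map X Y F \<and>
     (\<forall>(U, \<phi>) \<in> A. \<forall>(V, \<psi>) \<in> B. (\<psi> \<circ> F \<circ> inv_into U \<phi>) holomorphic_on (\<phi> ` (U \<inter> F -` V)))"

text \<open>
  The ramification index at \<open>p\<close> is the order of vanishing at \<open>p\<close> of \<open>F - F p\<close> in local coordinates;
  for a non-constant holomorphic map it is independent of the charts.
\<close>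

definition ramification_index :: "'a chart set \<Rightarrow> 'b chart set \<Rightarrow> ('a \<Rightarrow> 'b) \<Rightarrow> 'a \<Rightarrow> nat" where
  "ramification_index A B F p = (THE n. \<forall>(U, \<phi>) \<in> A. \<forall>(V, \<psi>) \<in> B. p \<in> U \<longrightarrow> F p \<in> V \<longrightarrow>
     zorder (\<lambda>z. \<psi> (F (inv_into U \<phi> z)) - \<psi> (F p)) (\<phi> p) = int n)"

definition has_degree ::
    "'a topology \<Rightarrow> 'a chart set \<Rightarrow> 'b topology \<Rightarrow> 'b chart set \<Rightarrow> ('a \<Rightarrow> 'b) \<Rightarrow> nat \<Rightarrow> bool" where
  "has_degree X A Y B F d \<longleftrightarrow> (\<forall>q \<in> topspace Y.
     finite {p \<in> topspace X. F p = q} \<and>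
     (\<Sum>p \<in> {p \<in> topspace X. F p = q}. ramification_index A B F p) = d)"


section \<open>Quotients by finite groups and transport of structure\<close>

definition orbit_space_topology ::
    "'a topology \<Rightarrow> 'g monoid \<Rightarrow> ('g \<Rightarrow> 'a \<Rightarrow> 'a) \<Rightarrow> 'a set topology" where
  "orbit_space_topology X G act =
     final_topology X (orbit G act) (orbits G (topspace X) act)"

text \<open>
  The usual charts of the quotient of a Riemann surface by a finite group: take a chart \<open>\<phi>\<close> around
  \<open>p\<close> on a domain \<open>U\<close> which is stable under the stabiliser of \<open>p\<close> and disjoint from its other
  translates; then the product of the translates of the centred coordinate \<open>\<phi> - \<phi> p\<close> under the
  stabiliser descends to the image of \<open>U\<close>, where it is a chart if \<open>U\<close> is small enough.
\<close>

definition orbit_space_atlas ::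
    "'a topology \<Rightarrow> 'a chart set \<Rightarrow> 'g monoid \<Rightarrow> ('g \<Rightarrow> 'a \<Rightarrow> 'a) \<Rightarrow> 'a set chart set" where
  "orbit_space_atlas X A G act = {(W, \<psi>). complex_chart (orbit_space_topology X G act) W \<psi> \<and>
     (\<exists>p U \<phi>. (U, \<phi>) \<in> maximal_atlas X A \<and> p \<in> U \<and>
        (\<forall>g \<in> stabilizer G act p. act g ` U = U) \<and>
        (\<forall>g \<in> carrier G - stabilizer G act p. act g ` U \<inter> U = {}) \<and>
        W = orbit G act ` U \<and>
        (\<forall>x \<in> U. \<psi> (orbit G act x) = (\<Prod>g \<in> stabilizer G act p. \<phi> (act g x) - \<phi> p)))}"

text \<open>
  The charts of \<open>X\<close> carried over to \<open>S\<close> along a bijection \<open>F\<close> from \<open>X\<close> to \<open>S\<close>.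
\<close>

definition transported_atlas ::
    "'a topology \<Rightarrow> 'a chart set \<Rightarrow> ('a \<Rightarrow> 'b) \<Rightarrow> 'b set \<Rightarrow> 'b chart set" where
  "transported_atlas X A F S = {(V, \<psi>). V \<subseteq> S \<and> ({x \<in> topspace X. F x \<in> V}, \<psi> \<circ> F) \<in> A}"


section \<open>The straight cover\<close>

definition cover_topology :: "(3 \<Rightarrow> nat) \<Rightarrow> poly3 \<Rightarrow> (complex ^ 3) set topology" where
  "cover_topology a f = subtopology proj_plane_topology (pcurve (straight_cover_poly a f))"

text \<open>
  The standard complex structure of a non-singular projective plane curve \<open>h = 0\<close>: where
  \<open>y\<^sub>i \<noteq> 0\<close> and \<open>\<partial>h/\<partial>y\<^sub>k \<noteq> 0\<close>, the affine coordinate \<open>y\<^sub>j/y\<^sub>i\<close> is a local coordinate by the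
  implicit function theorem (\<open>i\<close>, \<open>j\<close>, \<open>k\<close> being distinct).
\<close>

definition plane_curve_atlas ::
    "(complex ^ 3) set topology \<Rightarrow> poly3 \<Rightarrow> (complex ^ 3) set chart set" where
  "plane_curve_atlas X h = {(U, \<phi>). complex_chart X U \<phi> \<and>
     (\<exists>i j k. {i, j, k} = (UNIV :: 3 set) \<and>
       (\<forall>y. y \<noteq> 0 \<and> pclass y \<in> U \<longrightarrow>
          y $ i \<noteq> 0 \<and> partial3 k h y \<noteq> 0 \<and> \<phi> (pclass y) = y $ j / y $ i))}"

definition cover_atlas :: "(3 \<Rightarrow> nat) \<Rightarrow> poly3 \<Rightarrow> (complex ^ 3) set chart set" where
  "cover_atlas a f = plane_curve_atlas (cover_topology a f) (straight_cover_poly a f)"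

definition mu_group :: "(3 \<Rightarrow> nat) \<Rightarrow> (complex ^ 3) monoid" where
  "mu_group a = \<lparr>carrier = {s. \<forall>i. (s $ i) ^ a i = 1}, mult = (*), one = 1\<rparr>"

text \<open>
  Multiplication on \<^typ>\<open>complex ^ 3\<close> is componentwise, so that \<open>mu_act E s\<close> maps the class of \<open>y\<close>
  to the class of \<open>(s\<^sub>0 y\<^sub>0, s\<^sub>1 y\<^sub>1, s\<^sub>2 y\<^sub>2)\<close>.
\<close>

definition mu_act ::
    "(complex ^ 3) set set \<Rightarrow> complex ^ 3 \<Rightarrow> (complex ^ 3) set \<Rightarrow> (complex ^ 3) set" where
  "mu_act E s = (\<lambda>P\<in>E. (*) s ` P)"

text \<open>
  The class of \<open>(y\<^sub>0, y\<^sub>1, y\<^sub>2)\<close> is mapped to the class of \<open>(y\<^sub>0\<^bsup>a\<^sub>0\<^esup>, y\<^sub>1\<^bsup>a\<^sub>1\<^esup>, y\<^sub>2\<^bsup>a\<^sub>2\<^esup>)\<close>, which does not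
  depend on the representative (the image below is a singleton); likewise for orbits.
\<close>

definition cover_map :: "(3 \<Rightarrow> nat) \<Rightarrow> (complex ^ 3) set \<Rightarrow> (complex ^ 3) set" where
  "cover_map a P = the_elem ((\<lambda>y. wclass a (\<chi> i. (y $ i) ^ a i)) ` P)"

definition orbit_map :: "(3 \<Rightarrow> nat) \<Rightarrow> (complex ^ 3) set set \<Rightarrow> (complex ^ 3) set" where
  "orbit_map a Q = the_elem (cover_map a ` Q)"

abbreviation cover_act ::
    "(3 \<Rightarrow> nat) \<Rightarrow> poly3 \<Rightarrow> complex ^ 3 \<Rightarrow> (complex ^ 3) set \<Rightarrow> (complex ^ 3) set" where
  "cover_act a f \<equiv> mu_act (pcurve (straight_cover_poly a f))"

text \<open>
  The structure on the curve in the weighted projective plane is that of the orbit space of the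
  straight cover, transported along \<open>orbit_map\<close>.
\<close>

definition curve_topology :: "(3 \<Rightarrow> nat) \<Rightarrow> poly3 \<Rightarrow> (complex ^ 3) set topology" where
  "curve_topology a f = final_topology
     (orbit_space_topology (cover_topology a f) (mu_group a) (cover_act a f))
     (orbit_map a) (wcurve a f)"

definition curve_atlas :: "(3 \<Rightarrow> nat) \<Rightarrow> poly3 \<Rightarrow> (complex ^ 3) set chart set" where
  "curve_atlas a f = transported_atlas
     (orbit_space_topology (cover_topology a f) (mu_group a) (cover_act a f))
     (orbit_space_atlas (cover_topology a f) (cover_atlas a f) (mu_group a) (cover_act a f))
     (orbit_map a) (wcurve a f)"

end

theory Submission
  imports Defs "HOL-Computational_Algebra.Fundamental_Theorem_Algebra"
begin

text \<open>
  By the implicit function theorem a non-singular plane curve \<open>h = 0\<close> has local parametrisations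
  \<open>[1 : t : g t]\<close> with \<open>g\<close> holomorphic.  It is connected: if it were the disjoint union of closed sets
  \<open>A\<close> and \<open>B\<close>, project from a point off the curve; the product of the differences \<open>\<alpha> - \<beta>\<close> of the points
  of \<open>A\<close> and of \<open>B\<close> over \<open>t\<close> is holomorphic where the fibre has no multiple point, locally constant
  in its number of factors, and by compactness and homogeneity each factor is bounded below by
  \<open>\<delta> max 1 |t|\<close>.  Its reciprocal is thus a nonzero constant which tends to \<open>0\<close> at infinity.

  The stabiliser of a point \<open>P\<close> of the straight cover acts on the local coordinate
  \<open>y\<^sub>j/y\<^sub>i\<close> by the character \<open>s\<^sub>j/s\<^sub>i\<close>, which is injective because the weights are pairwise coprime.
  Hence either the stabiliser is trivial or its image consists of all \<open>n\<close>-th roots of unity, where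
  \<open>n\<close> is its order, and the orbit map is \<open>z \<mapsto> z\<^sup>n\<close> up to a constant in suitable coordinates.  Transition
  functions of the orbit space are continuous, and holomorphic off the isolated branch values,
  hence holomorphic.  The degree is then the order of the group by the orbit-stabiliser theorem.
\<close>

text \<open>
  Otherwise the simplifier changes \<open>pclass\<close>, which abbreviates \<open>wclass (\<lambda>_. 1)\<close>, into
  \<open>wclass (\<lambda>_. Suc 0)\<close>, to which no lemma applies.
\<close>

declare One_nat_def [simp del]

section \<open>The holomorphic implicit function theorem\<close>

text \<open>Connectedness would usually come from irreducibility; the analytic substitute has to
  control fibres near infinity and near multiple points. A centre \<open>q\<close> with
  \<open>eval3 h q \<noteq> 0\<close> makes the restriction to every line through \<open>q\<close> a
  polynomial of degree exactly \<open>d\<close> with the same leading coefficient, so no root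
  escapes while \<open>t\<close> stays bounded. At a multiple root, non-singularity forces the other
  partial derivative to be nonzero, which isolates the multiple roots. On the orbit space the
  obstacle is that \<open>curve_atlas\<close> contains charts built from arbitrary members of the
  maximal atlas, in whose coordinates the stabiliser need not act linearly. Compatibility and
  holomorphy are therefore proved for all such charts by soft means, from continuity and finiteness
  of fibres. The explicit power map serves only to produce one chart at each point and, through an
  injective holomorphic change of chart, to find the order of vanishing.\<close>

lemma holomorphic_implicit_function:
  fixes F D1 D2 :: "complex \<times> complex \<Rightarrow> complex"
  assumes der: "\<And>x. (F has_derivative (\<lambda>v. D1 x * fst v + D2 x * snd v)) (at x)"
    and cont: "continuous_on UNIV D2"
    and zero: "F (t0, z0) = 0" and nz: "D2 (t0, z0) \<noteq> 0" and "e > 0"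
  obtains g r s where "r > 0" "s > 0" "r < e" "s < e" "g holomorphic_on ball t0 r"
    "\<And>t. t \<in> ball t0 r \<Longrightarrow> g t \<in> ball z0 s"
    "\<And>t z. t \<in> ball t0 r \<Longrightarrow> z \<in> ball z0 s \<Longrightarrow> F (t, z) = 0 \<longleftrightarrow> z = g t"
proof -
  define c where "c = D2 (t0, z0)"
  have c0: "norm c > 0" using nz by (simp add: c_def)
  have contF: "continuous_on UNIV F"
    by (meson der continuous_at_imp_continuous_on has_derivative_continuous)
  have "\<exists>\<delta>>0. \<forall>x. dist x (t0,z0) < \<delta> \<longrightarrow> dist (D2 x) c < norm c / 2"
    using cont c0 unfolding continuous_on_iff c_def by (metis UNIV_I half_gt_zero)
  then obtain \<delta> where d: "\<delta> > 0" "\<And>x. dist x (t0,z0) < \<delta> \<Longrightarrow> dist (D2 x) c < norm c / 2"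
    by blast
  \<comment> \<open>\<open>s\<close> is fixed before \<open>\<eta>\<close>, because the value of
    \<open>F\<close> at the centre must be small against \<open>s\<close>: it may use up only half
    of the radius that the iteration has to preserve.\<close>
  define s where "s = min (\<delta>/4) (e/2)"
  have s: "s > 0" "s < e" "s < \<delta>/2" using d \<open>e > 0\<close> by (auto simp: s_def)
  have "\<exists>\<eta>>0. \<forall>x. dist x (t0,z0) < \<eta> \<longrightarrow> dist (F x) 0 < norm c * s / 2"
    using contF c0 s zero unfolding continuous_on_iff
    by (metis UNIV_I half_gt_zero mult_pos_pos)
  then obtain \<eta> where eta: "\<eta> > 0" "\<And>x. dist x (t0,z0) < \<eta> \<Longrightarrow> norm (F x) < norm c * s / 2"
    by auto
  define r where "r = min (min (\<eta>/2) (\<delta>/4)) (e/2)"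
  have r: "r > 0" "r < e" "r < \<delta>/2" "r < \<eta>" using d eta \<open>e > 0\<close> by (auto simp: r_def)
  have near: "norm (D2 (t, z) - c) \<le> norm c / 2" if "t \<in> ball t0 r" "z \<in> cball z0 s" for t z
  proof -
    have "dist (t, z) (t0, z0) \<le> dist t t0 + dist z z0"
      by (simp add: dist_Pair_Pair sqrt_sum_squares_le_sum)
    also have "\<dots> < \<delta>" using that r s by (auto simp: dist_commute)
    finally show ?thesis using d(2)[of "(t, z)"] by (simp add: dist_norm)
  qed
  have der2: "((\<lambda>z. F (t, z)) has_field_derivative D2 (t, z)) (at z within S)" for t z S
  proof -
    have "((\<lambda>z. (t, z)) has_derivative (\<lambda>v. (0, v))) (at z within S)"
      by (auto intro!: derivative_eq_intros)
    from has_derivative_compose[OF this der] show ?thesis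
      by (simp add: has_field_derivative_def)
  qed
  \<comment> \<open>On the bidisc \<open>F (t, z)\<close> is a small perturbation of multiplication
    by \<open>c\<close>. This one estimate yields both injectivity in \<open>z\<close> and the
    contraction that produces the root.\<close>
  have lip: "norm ((F (t, z) - c * z) - (F (t, w) - c * w)) \<le> norm c / 2 * norm (z - w)"
    if "t \<in> ball t0 r" "z \<in> cball z0 s" "w \<in> cball z0 s" for t z w
  proof (rule field_differentiable_bound[where S = "cball z0 s" and f' = "\<lambda>z. D2 (t, z) - c"])
    show "((\<lambda>z. F (t, z) - c * z) has_field_derivative D2 (t, z) - c) (at z within cball z0 s)" for z
      by (rule derivative_eq_intros der2 refl | simp)+
  qed (use that near in auto)
  have inj: "norm c / 2 * norm (z - w) \<le> norm (F (t, z) - F (t, w))"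
    if "t \<in> ball t0 r" "z \<in> cball z0 s" "w \<in> cball z0 s" for t z w
  proof -
    have "norm (c * (z - w)) \<le> norm (F (t, z) - F (t, w)) + norm ((F (t, z) - c * z) - (F (t, w) - c * w))"
      by (rule order_trans[OF _ norm_triangle_ineq4]) (simp add: algebra_simps)
    then show ?thesis using lip[OF that] by (simp add: norm_mult)
  qed
  have ex: "\<exists>z\<in>ball z0 s. F (t, z) = 0" if t: "t \<in> ball t0 r" for t
  proof -
    \<comment> \<open>Newton's iteration with the derivative frozen at \<open>c\<close>: its fixed
      points are the zeros of \<open>F (t, z)\<close> in \<open>z\<close>.\<close>
    define f where "f = (\<lambda>z. z - F (t, z) / c)"
    have eq: "f z - f w = - ((F (t, z) - c * z) - (F (t, w) - c * w)) / c" for z w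
      using c0 by (auto simp: f_def field_simps)
    have contr: "dist (f z) (f w) \<le> 1/2 * dist z w" if "z \<in> cball z0 s" "w \<in> cball z0 s" for z w
      unfolding dist_norm eq norm_divide norm_minus_cancel
      using lip[OF t that] c0 by (simp add: field_simps)
    have small: "norm (F (t, z0)) < norm c * s / 2"
      using eta(2)[of "(t,z0)"] t r by (auto simp: dist_Pair_Pair dist_commute)
    have into: "dist (f z) z0 < s" if "z \<in> cball z0 s" for z
    proof -
      have "dist (f z) z0 \<le> dist (f z) (f z0) + dist (f z0) z0" by (rule dist_triangle)
      also have "dist (f z) (f z0) \<le> 1/2 * dist z z0" by (rule contr) (use that s in auto)
      also have "\<dots> \<le> s/2" using that by (simp add: dist_commute)
      also have "dist (f z0) z0 < s/2"
        using small c0 by (simp add: f_def dist_norm norm_divide field_simps)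
      finally show ?thesis by simp
    qed
    have "\<exists>!z\<in>cball z0 s. f z = z"
      by (rule Banach_fix[where c = "1/2"])
        (use s contr into in \<open>auto simp: dist_commute less_imp_le complete_eq_closed\<close>)
    then obtain z where "z \<in> cball z0 s" "f z = z" by blast
    then show ?thesis using into[of z] c0 by (auto simp: f_def dist_commute)
  qed
  define g where "g = (\<lambda>t. SOME z. z \<in> ball z0 s \<and> F (t, z) = 0)"
  have g: "g t \<in> ball z0 s" "F (t, g t) = 0" if "t \<in> ball t0 r" for t
    using someI_ex[of "\<lambda>z. z \<in> ball z0 s \<and> F (t, z) = 0"] ex[OF that] unfolding g_def by blast+
  have uniq: "z = g t" if "t \<in> ball t0 r" "z \<in> ball z0 s" "F (t, z) = 0" for t z
  proof -
    have "norm c / 2 * norm (z - g t) \<le> 0"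
      using inj[of t z "g t"] that g[OF that(1)] by (auto simp: less_imp_le)
    then have "norm (z - g t) \<le> 0"
      using c0 by (simp add: mult_le_0_iff)
    then show ?thesis by simp
  qed
  have "(g has_field_derivative - D1 (t1, g t1) / D2 (t1, g t1)) (at t1)" if t1: "t1 \<in> ball t0 r" for t1
  proof -
    define x1 where "x1 = (t1, g t1)"
    have D2nz: "D2 x1 \<noteq> 0"
      using near[of t1 "g t1"] g[OF t1] t1 c0 by (auto simp: x1_def less_imp_le)
    have ev: "\<forall>\<^sub>F t in at t1. t \<in> ball t0 r"
      using t1 by (intro eventually_at_in_open') auto
    have der1: "((\<lambda>t. F (t, g t1)) has_field_derivative D1 x1) (at t1)"
    proof -
      have "((\<lambda>z. (z, g t1)) has_derivative (\<lambda>v. (v, 0))) (at t1)"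
        by (auto intro!: derivative_eq_intros)
      from has_derivative_compose[OF this der] show ?thesis
        by (simp add: has_field_derivative_def x1_def)
    qed
    have q: "((\<lambda>t. F (t, g t1) / (t - t1)) \<longlongrightarrow> D1 x1) (at t1)"
      using der1 g(2)[OF t1] by (simp add: has_field_derivative_iff)
    \<comment> \<open>As \<open>F (t, g t) = 0\<close>, the lower bound in \<open>inj\<close> turns
      the value of \<open>F\<close> at the old point \<open>(t, g t1)\<close> into a bound for the
      increment of \<open>g\<close>; this gives continuity first and a bounded difference quotient
      afterwards.\<close>
    have bd: "norm (g t - g t1) \<le> 2 / norm c * norm (F (t, g t1))" if "t \<in> ball t0 r" for t
      using inj[of t "g t" "g t1"] that g[OF that] g[OF t1] t1 c0
      by (simp add: field_simps less_imp_le norm_minus_commute)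
    have F0: "((\<lambda>t. F (t, g t1)) \<longlongrightarrow> 0) (at t1)"
      using DERIV_isCont[OF der1] g(2)[OF t1] by (simp add: isCont_def)
    have gcont: "(g \<longlongrightarrow> g t1) (at t1)"
    proof (rule LIM_zero_cancel, rule Lim_null_comparison)
      show "\<forall>\<^sub>F t in at t1. norm (g t - g t1) \<le> 2 / norm c * norm (F (t, g t1))"
        using ev by eventually_elim (rule bd)
      show "((\<lambda>t. 2 / norm c * norm (F (t, g t1))) \<longlongrightarrow> 0) (at t1)"
        by (intro tendsto_mult_right_zero tendsto_norm_zero F0)
    qed
    \<comment> \<open>\<open>E\<close> is the normalised remainder of \<open>F\<close> at
      \<open>x1\<close>. Along the graph both values of \<open>F\<close> vanish, so only the linear
      part is left; since the ratio \<open>m\<close> of the increments is bounded, \<open>m\<close>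
      times \<open>E\<close> tends to zero, and multiplying by the unimodular factor
      \<open>norm (t - t1) / (t - t1)\<close> turns this into a limit for the complex difference
      quotient.\<close>
    define E where "E = (\<lambda>x. (F x - F x1 - (D1 x1 * fst (x - x1) + D2 x1 * snd (x - x1))) /\<^sub>R norm (x - x1))"
    have E0: "(E \<longlongrightarrow> 0) (at x1)"
      using der[of x1] unfolding has_derivative_iff_norm E_def
      by (subst tendsto_norm_zero_iff[symmetric]) (simp add: divide_inverse mult.commute)
    have xt: "filterlim (\<lambda>t. (t, g t)) (at x1) (at t1)"
      unfolding filterlim_at x1_def
      by (intro conjI tendsto_Pair tendsto_ident_at gcont) (auto simp: eventually_at_filter)
    have Ex: "((\<lambda>t. E (t, g t)) \<longlongrightarrow> 0) (at t1)"
      by (rule filterlim_compose[OF E0 xt])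
    define m where "m = (\<lambda>t. norm ((t, g t) - x1) / norm (t - t1))"
    have mbd: "\<forall>\<^sub>F t in at t1. norm (m t) \<le> 1 + 2 / norm c * (norm (D1 x1) + 1)"
    proof -
      have "\<forall>\<^sub>F t in at t1. dist (F (t, g t1) / (t - t1)) (D1 x1) < 1"
        using q by (rule tendstoD) simp
      moreover have "\<forall>\<^sub>F t in at t1. t \<noteq> t1" by (simp add: eventually_at_filter)
      ultimately show ?thesis using ev
      proof eventually_elim
        case (elim t)
        have "norm (F (t, g t1) / (t - t1)) \<le> norm (D1 x1) + 1"
          using elim(1) norm_triangle_ineq2[of "F (t, g t1) / (t - t1)" "D1 x1"]
          by (simp add: dist_norm)
        then have "norm (F (t, g t1)) \<le> (norm (D1 x1) + 1) * norm (t - t1)"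
          using elim(2) by (simp add: norm_divide divide_simps)
        then have "2 / norm c * norm (F (t, g t1)) \<le> 2 / norm c * ((norm (D1 x1) + 1) * norm (t - t1))"
          using c0 by (intro mult_left_mono) auto
        then have "norm (g t - g t1) \<le> 2 / norm c * (norm (D1 x1) + 1) * norm (t - t1)"
          using bd[OF elim(3)] by (simp only: mult.assoc)
        moreover have "norm ((t, g t) - x1) \<le> norm (t - t1) + norm (g t - g t1)"
          by (simp add: x1_def norm_Pair sqrt_sum_squares_le_sum)
        ultimately have "norm ((t, g t) - x1) \<le> (1 + 2 / norm c * (norm (D1 x1) + 1)) * norm (t - t1)"
          by (simp add: algebra_simps)
        then show ?case using elim(2) by (simp add: m_def divide_simps)
      qed
    qed
    have "((\<lambda>t. of_real (m t) * E (t, g t)) \<longlongrightarrow> 0) (at t1)"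
    proof (rule Lim_null_comparison)
      show "\<forall>\<^sub>F t in at t1. norm (of_real (m t) * E (t, g t)) \<le> (1 + 2 / norm c * (norm (D1 x1) + 1)) * norm (E (t, g t))"
        using mbd by eventually_elim (auto simp: norm_mult intro!: mult_right_mono)
      show "((\<lambda>t. (1 + 2 / norm c * (norm (D1 x1) + 1)) * norm (E (t, g t))) \<longlongrightarrow> 0) (at t1)"
        by (intro tendsto_mult_right_zero tendsto_norm_zero Ex)
    qed
    then have "((\<lambda>t. of_real (m t) * E (t, g t) * (of_real (norm (t - t1)) / (t - t1))) \<longlongrightarrow> 0) (at t1)"
      by (rule Lim_null_comparison[rotated, OF tendsto_norm_zero])
        (auto simp: eventually_at_filter norm_mult norm_divide)
    moreover have "\<forall>\<^sub>F t in at t1. of_real (m t) * E (t, g t) * (of_real (norm (t - t1)) / (t - t1))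
        = - (D1 x1 + D2 x1 * ((g t - g t1) / (t - t1)))"
    proof -
      have "\<forall>\<^sub>F t in at t1. t \<noteq> t1" by (simp add: eventually_at_filter)
      then show ?thesis using ev
      proof eventually_elim
        case (elim t)
        have "(t, g t) - x1 \<noteq> 0" using elim by (auto simp: x1_def zero_prod_def)
        then show ?case using elim g(2)[OF elim(2)] g(2)[OF t1]
          by (simp add: m_def E_def x1_def scaleR_conv_of_real divide_simps)
      qed
    qed
    ultimately have "((\<lambda>t. - (D1 x1 + D2 x1 * ((g t - g t1) / (t - t1)))) \<longlongrightarrow> 0) (at t1)"
      by (rule Lim_transform_eventually)
    then have "((\<lambda>t. (- (- (D1 x1 + D2 x1 * ((g t - g t1) / (t - t1)))) - D1 x1) / D2 x1) \<longlongrightarrow> (- 0 - D1 x1) / D2 x1) (at t1)"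
      by (intro tendsto_intros D2nz)
    then show ?thesis using D2nz by (simp add: has_field_derivative_iff x1_def)
  qed
  then have "g holomorphic_on ball t0 r"
    unfolding holomorphic_on_def field_differentiable_def
    using has_field_derivative_at_within by blast
  with that[of r s g] r s g uniq show ?thesis by blast
qed

section \<open>Polynomial functions\<close>

text \<open>\<open>partial3\<close> is defined by \<open>deriv\<close>, which has a value whether or
  not a derivative exists. The total derivative is therefore built with explicit coefficients, and
  \<open>partial3\<close> is identified with them afterwards.\<close>

lemma eval3_C1:
  obtains D where
    "\<And>i. continuous_on UNIV (D i)"
    "\<And>y. (eval3 f has_derivative (\<lambda>v. \<Sum>i\<in>UNIV. D i y * v $ i)) (at y)"
proof
  define D where "D = (\<lambda>i y :: complex ^ 3. \<Sum>c\<in>Poly_Mapping.keys f. Poly_Mapping.lookup f c *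
    (of_nat (Poly_Mapping.lookup c i) * (y $ i) ^ (Poly_Mapping.lookup c i - 1) *
     (\<Prod>j\<in>UNIV - {i}. (y $ j) ^ Poly_Mapping.lookup c j)))"
  show "continuous_on UNIV (D i)" for i
    unfolding D_def by (intro continuous_intros)
  have comp: "((\<lambda>x. x $ i) has_derivative (\<lambda>v. v $ i)) (at y)" for i and y :: "complex ^ 3"
    by (rule bounded_linear_imp_has_derivative) (rule bounded_linear_vec_nth)
  show "(eval3 f has_derivative (\<lambda>v. \<Sum>i\<in>UNIV. D i y * v $ i)) (at y)" for y
  proof -
    have "(eval3 f has_derivative (\<lambda>v. \<Sum>c\<in>Poly_Mapping.keys f. Poly_Mapping.lookup f c *
       (\<Sum>i\<in>UNIV. (of_nat (Poly_Mapping.lookup c i) * v $ i * (y $ i) ^ (Poly_Mapping.lookup c i - 1)) *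
         (\<Prod>j\<in>UNIV - {i}. (y $ j) ^ Poly_Mapping.lookup c j)))) (at y)"
      unfolding eval3_def
      by (intro has_derivative_sum has_derivative_mult_right has_derivative_prod has_derivative_power comp)
    also have "(\<lambda>v. \<Sum>c\<in>Poly_Mapping.keys f. Poly_Mapping.lookup f c *
       (\<Sum>i\<in>UNIV. (of_nat (Poly_Mapping.lookup c i) * v $ i * (y $ i) ^ (Poly_Mapping.lookup c i - 1)) *
         (\<Prod>j\<in>UNIV - {i}. (y $ j) ^ Poly_Mapping.lookup c j)))
      = (\<lambda>v. \<Sum>i\<in>UNIV. D i y * v $ i)"
      unfolding D_def sum_distrib_right sum_distrib_left
      by (subst sum.swap) (simp add: mult_ac)
    finally show ?thesis .
  qed
qed

lemma partial3_unique:
  assumes "\<And>y. (eval3 f has_derivative (\<lambda>v. \<Sum>i\<in>UNIV. D i y * v $ i)) (at y)"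
  shows "partial3 i f = D i"
proof
  fix x :: "complex ^ 3"
  define l where "l = (\<lambda>t. x + (\<chi> j. if j = i then t - x $ i else 0))"
  have l: "(\<chi> j. if j = i then t else x $ j) = l t" for t
    by (simp add: l_def vec_eq_iff)
  have "bounded_linear (\<lambda>t :: complex. (\<chi> j. if j = i then t else 0) :: complex ^ 3)"
    by (intro linear_conv_bounded_linear[THEN iffD1] linearI) (auto simp: vec_eq_iff)
  then have lin: "((\<lambda>t :: complex. (\<chi> j. if j = i then t else 0) :: complex ^ 3) has_derivative
      (\<lambda>t. \<chi> j. if j = i then t else 0)) F" for F
    by (rule bounded_linear_imp_has_derivative)
  have "((\<lambda>t. t - x $ i) has_derivative (\<lambda>t. t)) (at (x $ i))"
    by (auto intro!: derivative_eq_intros)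
  from has_derivative_compose[OF this lin]
  have "(l has_derivative (\<lambda>t. \<chi> j. if j = i then t else 0)) (at (x $ i))"
    unfolding l_def by (auto intro!: derivative_eq_intros)
  from has_derivative_compose[OF this assms]
  have "((\<lambda>t. eval3 f (l t)) has_derivative (\<lambda>t. \<Sum>j\<in>UNIV. D j (l (x $ i)) * (if j = i then t else 0))) (at (x $ i))"
    by simp
  moreover have "l (x $ i) = x" by (simp add: l_def vec_eq_iff)
  ultimately have "((\<lambda>t. eval3 f (l t)) has_field_derivative D i x) (at (x $ i))"
    by (simp add: has_field_derivative_def if_distrib[of "\<lambda>x. _ * x"] cong: if_cong)
  then show "partial3 i f x = D i x"
    unfolding partial3_def l by (rule DERIV_imp_deriv)
qed

lemma continuous_on_partial3: "continuous_on UNIV (partial3 i f)"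
  and eval3_has_derivative:
    "(eval3 f has_derivative (\<lambda>v. \<Sum>i\<in>UNIV. partial3 i f y * v $ i)) (at y)"
proof -
  obtain D where D: "\<And>i. continuous_on UNIV (D i)"
    "\<And>y. (eval3 f has_derivative (\<lambda>v. \<Sum>i\<in>UNIV. D i y * v $ i)) (at y)"
    using eval3_C1 by blast
  have "partial3 i f = D i" for i using partial3_unique[OF D(2)] .
  then show "continuous_on UNIV (partial3 i f)"
    "(eval3 f has_derivative (\<lambda>v. \<Sum>i\<in>UNIV. partial3 i f y * v $ i)) (at y)"
    using D by auto
qed

lemma continuous_on_eval3: "continuous_on S (eval3 f)"
  by (meson eval3_has_derivative continuous_at_imp_continuous_on has_derivative_continuous)

text \<open>One chain rule for an affine plane in \<open>complex ^ 3\<close> serves both the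
  standard affine charts and the pencil of lines through a point.\<close>

lemma eval3_plane_has_derivative:
  "((\<lambda>x. eval3 f (p + fst x *s u + snd x *s v)) has_derivative
     (\<lambda>w. (\<Sum>i\<in>UNIV. partial3 i f (p + fst x *s u + snd x *s v) * u $ i) * fst w +
          (\<Sum>i\<in>UNIV. partial3 i f (p + fst x *s u + snd x *s v) * v $ i) * snd w)) (at x)"
proof -
  have bl: "bounded_linear (\<lambda>x :: complex \<times> complex. fst x *s u + snd x *s v)"
    by (intro linear_conv_bounded_linear[THEN iffD1] linearI) (auto simp: vec_eq_iff algebra_simps)
  have "((\<lambda>x. p + (fst x *s u + snd x *s v)) has_derivative (\<lambda>x. fst x *s u + snd x *s v)) (at x)"
    by (rule derivative_eq_intros bounded_linear_imp_has_derivative[OF bl] refl | simp)+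
  then have "((\<lambda>x. p + fst x *s u + snd x *s v) has_derivative (\<lambda>x. fst x *s u + snd x *s v)) (at x)"
    by (simp add: add.assoc)
  from has_derivative_compose[OF this eval3_has_derivative] show ?thesis
    by (simp add: sum_distrib_left sum_distrib_right sum.distrib algebra_simps)
qed

lemma continuous_on_plane:
  "continuous_on S (\<lambda>x :: complex \<times> complex. p + fst x *s u + snd x *s (v :: complex ^ 3))"
  unfolding vector_scalar_mult_def by (intro continuous_intros)

lemma continuous_on_eval3_plane_partial:
  "continuous_on UNIV (\<lambda>x. \<Sum>i\<in>UNIV. partial3 i f (p + fst x *s u + snd x *s v) * v $ i)"
  by (intro continuous_intros continuous_on_compose2[OF continuous_on_partial3] continuous_on_plane) auto


section \<open>The projective plane\<close>

lemma quotient_map_final_topology: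
  assumes "f ` topspace X = S"
  shows "quotient_map X (final_topology X f S) f"
  using assms topspace_final_topology[of f X S]
  by (auto simp: quotient_map_def openin_final_topology)

lemma homeomorphic_map_final_topology:
  assumes "F ` topspace X = S" "inj_on F (topspace X)"
  shows "homeomorphic_map X (final_topology X F S) F"
  unfolding homeomorphic_map_def using assms quotient_map_final_topology by blast

lemma pclass_eq_scale: "pclass y = {l *s y | l. l \<noteq> 0}"
  by (simp add: wclass_def vector_scalar_mult_def)

lemma pclass_self: "y \<in> pclass y"
  unfolding pclass_eq_scale by (metis (mono_tags, lifting) mem_Collect_eq vector_smult_lid zero_neq_one)

lemma pclass_scale: "l \<noteq> 0 \<Longrightarrow> pclass (l *s y) = pclass y"
proof -
  assume l: "l \<noteq> 0"
  have "\<exists>m. k *s y = m *s (l *s y) \<and> m \<noteq> 0" if "k \<noteq> 0" for k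
    using that l by (intro exI[of _ "k / l"]) (simp add: vector_smult_assoc)
  then show ?thesis
    using l unfolding pclass_eq_scale
    by (auto simp: vector_smult_assoc)
qed

lemma pclass_eq_iff: "pclass y = pclass w \<longleftrightarrow> (\<exists>l. l \<noteq> 0 \<and> w = l *s y)"
proof
  assume "pclass y = pclass w"
  then have "w \<in> pclass y" using pclass_self by blast
  then show "\<exists>l. l \<noteq> 0 \<and> w = l *s y" unfolding pclass_eq_scale by blast
qed (auto simp: pclass_scale)

lemma quotient_map_pclass:
  "quotient_map (top_of_set (- {0})) proj_plane_topology pclass"
  unfolding proj_plane_topology_def by (rule quotient_map_final_topology) simp

lemma topspace_proj_plane: "topspace proj_plane_topology = pclass ` (- {0})"
  using quotient_imp_surjective_map[OF quotient_map_pclass] by simp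

lemma compact_space_proj_plane: "compact_space proj_plane_topology"
proof -
  have "compactin (top_of_set (- {0 :: complex ^ 3})) (sphere 0 1)"
    by (auto simp: compactin_subtopology)
  then have "compactin proj_plane_topology (pclass ` sphere 0 1)"
    using image_compactin quotient_imp_continuous_map[OF quotient_map_pclass] by blast
  moreover have "pclass ` sphere 0 1 = pclass ` (- {0 :: complex ^ 3})"
  proof (rule equalityI)
    show "pclass ` sphere 0 1 \<subseteq> pclass ` (- {0 :: complex ^ 3})"
      by (rule image_mono) auto
    show "pclass ` (- {0 :: complex ^ 3}) \<subseteq> pclass ` sphere 0 1"
    proof
      fix P assume "P \<in> pclass ` (- {0 :: complex ^ 3})"
      then obtain y where y: "y \<noteq> 0" "P = pclass y" by blast
      define w where "w = (of_real (inverse (norm y)) :: complex) *s y"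
      have "w = inverse (norm y) *\<^sub>R y"
        unfolding w_def vec_eq_iff by (simp add: scaleR_conv_of_real[where 'a = complex])
      then have "norm w = 1" using y(1) by simp
      moreover have "pclass w = P" unfolding w_def y(2) by (rule pclass_scale) (use y in auto)
      ultimately show "P \<in> pclass ` sphere 0 1"
        by (intro image_eqI[of _ _ w]) simp_all
    qed
  qed
  ultimately show ?thesis by (simp add: compact_space_def topspace_proj_plane)
qed

lemma norm_scale_vec: "norm (l *s y) = norm l * norm (y :: complex ^ 'n)"
  by (simp add: norm_vec_def L2_set_def norm_mult power_mult_distrib sum_distrib_left[symmetric] real_sqrt_mult)

text \<open>
  The line spanned by \<open>y\<close> is sent to the matrix of the orthogonal projection onto it; this embeds
  the projective plane in a Euclidean space.
\<close>

definition line_projection :: "complex ^ 3 \<Rightarrow> complex ^ 3 ^ 3" where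
  "line_projection y = (\<chi> i j. y $ i * cnj (y $ j) / of_real (norm y ^ 2))"

lemma line_projection_scale:
  assumes "l \<noteq> 0"
  shows "line_projection (l *s y) = line_projection y"
proof -
  have "complex_of_real (norm l ^ 2) = l * cnj l" by (rule complex_norm_square)
  with assms show ?thesis
    by (simp add: line_projection_def vec_eq_iff norm_scale_vec power_mult_distrib)
qed

lemma line_projection_inj:
  assumes "line_projection y = line_projection w" "y \<noteq> 0" "w \<noteq> 0"
  shows "pclass y = pclass w"
proof -
  obtain j where j: "w $ j \<noteq> 0" using assms by (auto simp: vec_eq_iff)
  \<comment> \<open>Column \<open>j\<close> of each matrix is a multiple of its vector, nonzero for
    \<open>w\<close>; comparing the two columns gives the scalar.\<close>
  define l where "l = cnj (y $ j) / of_real (norm y ^ 2) * of_real (norm w ^ 2) / cnj (w $ j)"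
  have "w $ i = l * y $ i" for i
  proof -
    have "y $ i * cnj (y $ j) / of_real (norm y ^ 2) = w $ i * cnj (w $ j) / of_real (norm w ^ 2)"
      using assms(1) by (simp add: line_projection_def vec_eq_iff)
    then show ?thesis using j assms by (simp add: l_def field_simps)
  qed
  then have "w = l *s y" by (simp add: vec_eq_iff)
  moreover have "l \<noteq> 0" using calculation assms by auto
  ultimately show ?thesis by (auto simp: pclass_scale)
qed

text \<open>A continuous injection of a compact space into a Hausdorff space is closed, hence an
  embedding. Separation and countability of the quotient are thereby inherited from a Euclidean
  space.\<close>

lemma proj_plane_embedding:
  obtains e :: "(complex ^ 3) set \<Rightarrow> complex ^ 3 ^ 3" where "embedding_map proj_plane_topology euclidean e"
proof -
  define e where "e = (\<lambda>P :: (complex ^ 3) set. the_elem (line_projection ` P))"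
  have e: "e (pclass y) = line_projection y" for y
  proof -
    have "line_projection w = line_projection y" if "w \<in> pclass y" for w
      using that line_projection_scale by (subst (asm) pclass_eq_scale) auto
    then have "line_projection ` pclass y = {line_projection y}"
      using pclass_self[of y] by blast
    then show ?thesis by (simp add: e_def)
  qed
  have "continuous_on (- {0}) line_projection"
    unfolding line_projection_def
    by (intro continuous_on_vec_lambda continuous_on_divide continuous_on_mult continuous_on_component
        continuous_on_cnj continuous_on_of_real continuous_on_power continuous_on_norm continuous_on_id) auto
  then have "continuous_map (top_of_set (- {0})) euclidean (e \<circ> pclass)"
    by (simp add: o_def e continuous_map_iff_continuous)
  then have cont: "continuous_map proj_plane_topology euclidean e"
    by (rule continuous_compose_quotient_map[OF quotient_map_pclass])
  moreover have "inj_on e (topspace proj_plane_topology)"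
    unfolding topspace_proj_plane
  proof (rule inj_onI)
    fix P Q assume "P \<in> pclass ` (- {0})" "Q \<in> pclass ` (- {0})" and eq: "e P = e Q"
    then obtain y w where "P = pclass y" "y \<noteq> 0" "Q = pclass w" "w \<noteq> 0" by blast
    with eq show "P = Q" using line_projection_inj[of y w] by (simp add: e)
  qed
  moreover have "closed_map proj_plane_topology euclidean e"
    by (rule T1_Spaces.continuous_imp_closed_map[OF cont compact_space_proj_plane Hausdorff_space_euclidean])
  ultimately show ?thesis
    by (metis that injective_closed_imp_embedding_map)
qed

lemma Hausdorff_space_proj_plane: "Hausdorff_space proj_plane_topology"
  and second_countable_proj_plane: "second_countable proj_plane_topology"
proof -
  obtain e :: "(complex ^ 3) set \<Rightarrow> complex ^ 3 ^ 3" where "embedding_map proj_plane_topology euclidean e"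
    using proj_plane_embedding .
  from embedding_map_imp_homeomorphic_space[OF this]
  have h: "proj_plane_topology homeomorphic_space top_of_set (e ` topspace proj_plane_topology)" .
  show "Hausdorff_space proj_plane_topology"
    unfolding homeomorphic_Hausdorff_space[OF h] by (rule Hausdorff_space_subtopology) simp
  obtain B :: "(complex ^ 3 ^ 3) set set" where B: "countable B" "\<And>b. b \<in> B \<Longrightarrow> open b"
    "\<And>S. open S \<Longrightarrow> \<exists>U. U \<subseteq> B \<and> S = \<Union>U"
    by (rule univ_second_countable) (rule that)
  have "second_countable (euclidean :: (complex ^ 3 ^ 3) topology)"
    unfolding second_countable_def
  proof (intro exI[of _ B] conjI ballI allI impI)
    show "countable B" by (rule B(1))
    show "openin euclidean V" if "V \<in> B" for V using B(2)[OF that] by (simp only: open_openin)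
    fix U :: "(complex ^ 3 ^ 3) set" and x assume U: "openin euclidean U \<and> x \<in> U"
    then have "open U" by (simp only: open_openin)
    from B(3)[OF this] obtain \<U> where "\<U> \<subseteq> B" "U = \<Union>\<U>" by blast
    with U show "\<exists>V\<in>B. x \<in> V \<and> V \<subseteq> U" by blast
  qed
  then show "second_countable proj_plane_topology"
    unfolding homeomorphic_space_second_countability[OF h] by (rule second_countable_subtopology)
qed

section \<open>Charts\<close>

lemma complex_chartD:
  assumes "complex_chart X U \<phi>"
  shows "openin X U" "open (\<phi> ` U)" "inj_on \<phi> U" "U \<subseteq> topspace X"
    "continuous_map (subtopology X U) euclidean \<phi>"
    "continuous_map (top_of_set (\<phi> ` U)) (subtopology X U) (inv_into U \<phi>)"
    "homeomorphic_map (subtopology X U) (top_of_set (\<phi> ` U)) \<phi>"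
proof -
  show U: "openin X U" and "open (\<phi> ` U)"
    and h: "homeomorphic_map (subtopology X U) (top_of_set (\<phi> ` U)) \<phi>"
    using assms by (auto simp: complex_chart_def)
  show sub: "U \<subseteq> topspace X" using U by (rule openin_subset)
  show inj: "inj_on \<phi> U"
    using homeomorphic_imp_injective_map[OF h] sub by (simp add: Int_absorb1)
  show "continuous_map (subtopology X U) euclidean \<phi>"
    using homeomorphic_imp_continuous_map[OF h] continuous_map_in_subtopology by blast
  obtain g where g: "homeomorphic_maps (subtopology X U) (top_of_set (\<phi> ` U)) \<phi> g"
    using h homeomorphic_map_maps by blast
  have "inv_into U \<phi> t = g t" if "t \<in> \<phi> ` U" for t
    using that g inj sub unfolding homeomorphic_maps_def by auto
  then show "continuous_map (top_of_set (\<phi> ` U)) (subtopology X U) (inv_into U \<phi>)"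
    using g unfolding homeomorphic_maps_def by (auto intro: continuous_map_eq)
qed

lemma complex_chart_subset:
  assumes "complex_chart X U \<phi>" "openin X V" "V \<subseteq> U"
  shows "complex_chart X V \<phi>"
proof -
  note D = complex_chartD[OF assms(1)]
  have sub: "subtopology (subtopology X U) V = subtopology X V"
    using assms(3) by (simp add: subtopology_subtopology Int_absorb1)
  have "openin (subtopology X U) V"
    using assms(2,3) D(1) by (simp add: openin_open_subtopology)
  then have "openin (top_of_set (\<phi> ` U)) (\<phi> ` V)"
    using homeomorphic_map_openness_eq[OF D(7)] by blast
  then have "open (\<phi> ` V)" using D(2) openin_open_trans by blast
  moreover have "homeomorphic_map (subtopology (subtopology X U) V) (subtopology (top_of_set (\<phi> ` U)) (\<phi> ` V)) \<phi>"
    using D(4) assms(3) inj_on_image_mem_iff[OF D(3) _ assms(3)]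
    by (intro homeomorphic_map_subtopologies_alt[OF D(7)]) auto
  moreover have "subtopology (top_of_set (\<phi> ` U)) (\<phi> ` V) = top_of_set (\<phi> ` V)"
    using assms(3) by (simp add: subtopology_subtopology Int_absorb1 image_mono)
  ultimately show ?thesis
    using assms(2) sub by (simp add: complex_chart_def)
qed

lemma complex_chart_image_open:
  assumes "complex_chart X U \<phi>" "openin X V" "V \<subseteq> U"
  shows "open (\<phi> ` V)"
  by (rule complex_chartD(2)[OF complex_chart_subset[OF assms]])


section \<open>Smooth plane curves\<close>

text \<open>Where \<open>y $ i\<close> is zero the quotient has the default value 0 on the whole
  class, so the image is a singleton without a side condition.\<close>

definition ratio :: "3 \<Rightarrow> 3 \<Rightarrow> (complex ^ 3) set \<Rightarrow> complex" where
  "ratio j i P = the_elem ((\<lambda>y. y $ j / y $ i) ` P)"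

lemma ratio_pclass: "ratio j i (pclass y) = y $ j / y $ i"
proof -
  have "w $ j / w $ i = y $ j / y $ i" if "w \<in> pclass y" for w
    using that by (subst (asm) pclass_eq_scale) auto
  then have "(\<lambda>y. y $ j / y $ i) ` pclass y = {y $ j / y $ i}"
    using pclass_self[of y] by blast
  then show ?thesis by (simp add: ratio_def)
qed

text \<open>The point \<open>(t, z)\<close> of the affine chart in which coordinate \<open>i\<close>
  is 1. Writing it with axis vectors treats all orders of the indices alike and fits the chain rule
  for planes.\<close>

definition affine_point :: "3 \<Rightarrow> 3 \<Rightarrow> 3 \<Rightarrow> complex \<Rightarrow> complex \<Rightarrow> complex ^ 3" where
  "affine_point i j k t z = axis i 1 + t *s axis j 1 + z *s axis k 1"

lemma distinct_indices:
  assumes "{i, j, k} = (UNIV :: 3 set)"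
  shows "i \<noteq> j" "i \<noteq> k" "j \<noteq> k"
proof -
  have "card {i, j, k} = 3" using assms by simp
  then show "i \<noteq> j" "i \<noteq> k" "j \<noteq> k"
    by (auto simp: card_insert_if split: if_splits)
qed

lemma affine_point_nth:
  assumes "{i, j, k} = (UNIV :: 3 set)"
  shows "affine_point i j k t z $ i = 1" "affine_point i j k t z $ j = t" "affine_point i j k t z $ k = z"
  using distinct_indices[OF assms] by (auto simp: affine_point_def axis_def)

lemma affine_point_nonzero: "{i, j, k} = (UNIV :: 3 set) \<Longrightarrow> affine_point i j k t z \<noteq> 0"
  using affine_point_nth(1)[of i j k t z] by auto

lemma affine_point_scale:
  fixes y :: "complex ^ 3"
  assumes "{i, j, k} = (UNIV :: 3 set)" "y $ i \<noteq> 0"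
  shows "y = y $ i *s affine_point i j k (y $ j / y $ i) (y $ k / y $ i)"
proof -
  have "y $ l = (y $ i *s affine_point i j k (y $ j / y $ i) (y $ k / y $ i)) $ l" for l
  proof -
    have "l \<in> {i, j, k}" using assms(1) by simp
    then show ?thesis using assms(2) by (auto simp: affine_point_nth[OF assms(1)])
  qed
  then show ?thesis unfolding vec_eq_iff by blast
qed

lemma pclass_affine_point:
  fixes y :: "complex ^ 3"
  assumes "{i, j, k} = (UNIV :: 3 set)" "y $ i \<noteq> 0"
  shows "pclass y = pclass (affine_point i j k (y $ j / y $ i) (y $ k / y $ i))"
  using pclass_scale[OF assms(2), of "affine_point i j k (y $ j / y $ i) (y $ k / y $ i)"]
  by (simp only: affine_point_scale[OF assms, symmetric])

lemma holomorphic_affine_point: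
  assumes "{i, j, k} = (UNIV :: 3 set)" "g holomorphic_on S"
  shows "(\<lambda>t. affine_point i j k t (g t) $ l) holomorphic_on S"
proof -
  have "l \<in> {i, j, k}" using assms(1) by simp
  then show ?thesis using assms(2)
    by (auto simp: affine_point_nth[OF assms(1)])
qed

lemma continuous_on_affine_point:
  "continuous_on S (\<lambda>x. affine_point i j k (fst x) (snd x))"
  unfolding affine_point_def by (rule continuous_on_plane)

text \<open>The chain rule for a diagonal substitution. Constant \<open>s\<close> gives the
  homogeneity of the partial derivatives; an \<open>s\<close> in the group, with
  \<open>c = 1\<close>, gives their behaviour under the action.\<close>

lemma partial3_diagonal:
  assumes "\<And>y. eval3 h (s * y) = c * eval3 h y"
  shows "s $ k * partial3 k h (s * y) = c * partial3 k h y"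
proof -
  have "bounded_linear (\<lambda>y. s * y :: complex ^ 3)"
    by (intro linear_conv_bounded_linear[THEN iffD1] linearI) (auto simp: vec_eq_iff algebra_simps)
  then have "((\<lambda>y. s * y) has_derivative (\<lambda>v. s * v)) (at y)"
    by (rule bounded_linear_imp_has_derivative)
  from has_derivative_compose[OF this eval3_has_derivative]
  have "((\<lambda>y. eval3 h (s * y)) has_derivative (\<lambda>v. \<Sum>i\<in>UNIV. partial3 i h (s * y) * (s * v) $ i)) (at y)" .
  moreover have "((\<lambda>y. eval3 h (s * y)) has_derivative (\<lambda>v. c * (\<Sum>i\<in>UNIV. partial3 i h y * v $ i))) (at y)"
    unfolding assms by (intro has_derivative_mult_right eval3_has_derivative)
  ultimately have "(\<lambda>v. \<Sum>i\<in>UNIV. partial3 i h (s * y) * (s * v) $ i) = (\<lambda>v. c * (\<Sum>i\<in>UNIV. partial3 i h y * v $ i))"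
    by (rule has_derivative_unique)
  from fun_cong[OF this, of "axis k 1"] show ?thesis
    by (simp add: axis_def if_distrib[of "\<lambda>x. _ * x"] mult_ac cong: if_cong)
qed

section \<open>Projective plane curves: the affine cone, the topology and the atlas\<close>

locale plane_curve =
  fixes h :: poly3 and d :: nat
  assumes homogeneous: "eval3 h (l *s y) = l ^ d * eval3 h y"
    and nonsing: "nonsingular h"
begin

text \<open>The affine cone over the curve. Arguments about classes are moved here, where the
  coordinates are honest functions.\<close>

definition "zeros = {y. y \<noteq> 0 \<and> eval3 h y = 0}"
definition "surface = subtopology proj_plane_topology (pcurve h)"
definition "atlas = plane_curve_atlas surface h"

lemma pcurve_eq: "pcurve h = pclass ` zeros"
  by (auto simp: wcurve_def zeros_def)

lemma zeros_scale: "l \<noteq> 0 \<Longrightarrow> l *s y \<in> zeros \<longleftrightarrow> y \<in> zeros"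
  by (auto simp: zeros_def homogeneous)

lemma pclass_in_pcurve_iff: "pclass y \<in> pcurve h \<longleftrightarrow> y \<in> zeros"
proof
  assume "pclass y \<in> pcurve h"
  then obtain w where "w \<in> zeros" "pclass w = pclass y" unfolding pcurve_eq by (metis imageE)
  then show "y \<in> zeros" unfolding pclass_eq_iff using zeros_scale by auto
qed (auto simp: pcurve_eq)

lemma topspace_surface: "topspace surface = pcurve h"
proof -
  have "pcurve h \<subseteq> topspace proj_plane_topology"
    unfolding pcurve_eq topspace_proj_plane by (rule image_mono) (auto simp: zeros_def)
  then show ?thesis unfolding surface_def by auto
qed

lemma preimage_pcurve: "{y \<in> topspace (top_of_set (- {0})). pclass y \<in> pcurve h} = zeros"
  unfolding pclass_in_pcurve_iff by (auto simp: zeros_def)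

lemma closedin_pcurve: "closedin proj_plane_topology (pcurve h)"
proof -
  have "closed {y. eval3 h y = 0}"
    using continuous_closed_vimage[of "{0}" "eval3 h"] continuous_on_eval3
    by (auto simp: vimage_def intro: continuous_closed_vimage closed_Collect_eq)
  then have "closedin (top_of_set (- {0})) zeros"
    unfolding zeros_def closedin_closed by auto
  moreover have "pcurve h \<subseteq> topspace proj_plane_topology"
    using topspace_surface unfolding surface_def by auto
  moreover have "closedin (top_of_set (- {0})) {x \<in> topspace (top_of_set (- {0})). pclass x \<in> U} =
      closedin proj_plane_topology U" if "U \<subseteq> topspace proj_plane_topology" for U
    using quotient_map_pclass that unfolding quotient_map_closedin by blast
  ultimately show ?thesis
    unfolding preimage_pcurve[symmetric] by blast
qed

text \<open>The cone is the full preimage of a closed set, and a quotient map restricts to a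
  quotient map over a closed set. Openness and continuity on the curve can thus be tested on
  vectors.\<close>

lemma quotient_map_surface: "quotient_map (top_of_set zeros) surface pclass"
proof -
  have "top_of_set zeros = subtopology (top_of_set (- {0})) zeros"
    by (simp add: subtopology_subtopology zeros_def) (rule arg_cong[of _ _ top_of_set], blast)
  then show ?thesis
    using quotient_map_restriction[OF quotient_map_pclass preimage_pcurve] closedin_pcurve
    by (simp add: surface_def)
qed

lemma openin_surface_iff:
  "openin surface U \<longleftrightarrow> U \<subseteq> pcurve h \<and> openin (top_of_set zeros) {y \<in> zeros. pclass y \<in> U}"
  using quotient_map_surface openin_subset[of surface U] unfolding quotient_map_def topspace_surface
  by auto

lemma continuous_map_surfaceI:
  assumes "openin surface U" "continuous_map (top_of_set {y \<in> zeros. pclass y \<in> U}) Y (\<lambda>y. F (pclass y))"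
  shows "continuous_map (subtopology surface U) Y F"
proof (rule continuous_compose_quotient_map)
  have "quotient_map (subtopology (top_of_set zeros) {y \<in> zeros. pclass y \<in> U}) (subtopology surface U) pclass"
    by (rule quotient_map_restriction[OF quotient_map_surface]) (use assms in auto)
  moreover have "subtopology (top_of_set zeros) {y \<in> zeros. pclass y \<in> U} = top_of_set {y \<in> zeros. pclass y \<in> U}"
    by (simp add: subtopology_subtopology) (rule arg_cong[of _ _ top_of_set], blast)
  ultimately show "quotient_map (top_of_set {y \<in> zeros. pclass y \<in> U}) (subtopology surface U) pclass"
    by simp
qed (use assms in \<open>simp add: o_def\<close>)

lemma compact_space_surface: "compact_space surface"
  unfolding surface_def
  using closedin_compact_space[OF compact_space_proj_plane closedin_pcurve] compact_space_subtopology by blast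

lemma Hausdorff_space_surface: "Hausdorff_space surface"
  unfolding surface_def by (rule Hausdorff_space_subtopology) (rule Hausdorff_space_proj_plane)

lemma second_countable_surface: "second_countable surface"
  unfolding surface_def by (rule second_countable_subtopology) (rule second_countable_proj_plane)

text \<open>Euler's identity: both sides are the derivative of \<open>eval3 h (l *s y)\<close> in
  \<open>l\<close> at 1, once by the chain rule and once by homogeneity.\<close>

lemma euler: "(\<Sum>i\<in>UNIV. partial3 i h y * y $ i) = of_nat d * eval3 h y"
proof -
  have "((\<lambda>x :: complex \<times> complex. eval3 h (0 + fst x *s y + snd x *s 0)) has_derivative
      (\<lambda>w. (\<Sum>i\<in>UNIV. partial3 i h (0 + 1 *s y + 0 *s 0) * y $ i) * fst w + 0)) (at (1, 0))"
    using eval3_plane_has_derivative[of h 0 y 0 "(1, 0)"] by simp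
  then have *: "((\<lambda>x :: complex \<times> complex. eval3 h (fst x *s y)) has_derivative
      (\<lambda>w. (\<Sum>i\<in>UNIV. partial3 i h y * y $ i) * fst w)) (at (1, 0))"
    by simp
  have "((\<lambda>l :: complex. (l, 0 :: complex)) has_derivative (\<lambda>v. (v, 0))) (at 1)"
    by (auto intro!: derivative_eq_intros)
  from has_derivative_compose[OF this *]
  have "((\<lambda>l. eval3 h (l *s y)) has_field_derivative (\<Sum>i\<in>UNIV. partial3 i h y * y $ i)) (at 1)"
    by (simp add: has_field_derivative_def)
  moreover have "((\<lambda>l. eval3 h (l *s y)) has_field_derivative of_nat d * eval3 h y) (at 1)"
    unfolding homogeneous by (auto intro!: derivative_eq_intros)
  ultimately show ?thesis by (rule DERIV_unique)
qed

lemma partial3_scale_eq_0_iff: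
  assumes "l \<noteq> 0"
  shows "partial3 k h (l *s y) = 0 \<longleftrightarrow> partial3 k h y = 0"
proof -
  have v: "l *s w = (\<chi> i. l) * w" for w :: "complex ^ 3" by (simp add: vec_eq_iff)
  have "(\<chi> i. l) $ k * partial3 k h ((\<chi> i. l) * y) = l ^ d * partial3 k h y"
    by (rule partial3_diagonal) (simp only: homogeneous flip: v)
  then show ?thesis using assms unfolding v by auto
qed

text \<open>If \<open>y $ k\<close> were the only nonzero coordinate, Euler's identity would reduce
  to \<open>partial3 k h y * y $ k = 0\<close>, so a nonzero coordinate other than \<open>k\<close>
  exists.\<close>

lemma chart_indices:
  fixes y :: "complex ^ 3"
  assumes "y \<in> zeros"
  obtains i j k where "{i, j, k} = (UNIV :: 3 set)" "y $ i \<noteq> 0" "partial3 k h y \<noteq> 0"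
proof -
  obtain k where k: "partial3 k h y \<noteq> 0"
    using nonsing assms unfolding nonsingular_def zeros_def by auto
  have "\<exists>i. i \<noteq> k \<and> y $ i \<noteq> 0"
  proof (rule ccontr)
    assume "\<not> ?thesis"
    then have z: "y $ i = 0" if "i \<noteq> k" for i using that by blast
    have "(\<Sum>i\<in>UNIV. partial3 i h y * y $ i) = (\<Sum>i\<in>{k}. partial3 i h y * y $ i)"
      by (rule sum.mono_neutral_right) (auto simp: z)
    then have "partial3 k h y * y $ k = 0" using euler[of y] assms by (simp add: zeros_def)
    then have "y $ i = 0" for i using k z by (cases "i = k") auto
    then show False using assms by (auto simp: zeros_def vec_eq_iff)
  qed
  then obtain i where i: "i \<noteq> k" "y $ i \<noteq> 0" by blast
  have "\<exists>j. {i, j, k} = (UNIV :: 3 set)"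
  proof -
    have "card (UNIV - {i, k}) = Suc 0"
      using i by (simp add: card_Diff_subset)
    then obtain j where "UNIV - {i, k} = {j}" by (auto simp: card_Suc_eq)
    then show ?thesis by (intro exI[of _ j]) auto
  qed
  then show ?thesis using that i k by blast
qed

lemma implicit_function:
  assumes ijk: "{i, j, k} = (UNIV :: 3 set)"
    and "eval3 h (affine_point i j k t0 z0) = 0" "partial3 k h (affine_point i j k t0 z0) \<noteq> 0"
  obtains g r s where "r > 0" "s > 0" "g holomorphic_on ball t0 r"
    "\<And>t. t \<in> ball t0 r \<Longrightarrow> g t \<in> ball z0 s"
    "\<And>t z. t \<in> ball t0 r \<Longrightarrow> z \<in> ball z0 s \<Longrightarrow> eval3 h (affine_point i j k t z) = 0 \<longleftrightarrow> z = g t"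
    "\<And>t z. t \<in> ball t0 r \<Longrightarrow> z \<in> ball z0 s \<Longrightarrow> partial3 k h (affine_point i j k t z) \<noteq> 0"
proof -
  define F where "F = (\<lambda>x. eval3 h (affine_point i j k (fst x) (snd x)))"
  have sum_axis: "(\<Sum>l\<in>UNIV. c l * axis m 1 $ l) = c m" for c :: "3 \<Rightarrow> complex" and m
    by (simp add: axis_def if_distrib[of "\<lambda>x. _ * x"] cong: if_cong)
  have der: "(F has_derivative (\<lambda>w. partial3 j h (affine_point i j k (fst x) (snd x)) * fst w +
      partial3 k h (affine_point i j k (fst x) (snd x)) * snd w)) (at x)" for x
    using eval3_plane_has_derivative[of h "axis i 1" "axis j 1" "axis k 1" x]
    unfolding sum_axis F_def affine_point_def .
  have cont: "continuous_on UNIV (\<lambda>x. partial3 k h (affine_point i j k (fst x) (snd x)))"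
    by (rule continuous_on_compose2[OF continuous_on_partial3 continuous_on_affine_point]) auto
  have "open {x. partial3 k h (affine_point i j k (fst x) (snd x)) \<noteq> 0}"
    by (rule open_Collect_neq[OF cont]) simp
  then obtain e where e: "e > 0"
    "ball (t0, z0) e \<subseteq> {x. partial3 k h (affine_point i j k (fst x) (snd x)) \<noteq> 0}"
    using assms(3) unfolding open_contains_ball by force
  \<comment> \<open>Radii below \<open>e/2\<close> keep the whole bidisc inside the ball of radius
    \<open>e\<close> on which the partial derivative has no zero.\<close>
  obtain g r s where g: "r > 0" "s > 0" "r < e/2" "s < e/2" "g holomorphic_on ball t0 r"
    "\<And>t. t \<in> ball t0 r \<Longrightarrow> g t \<in> ball z0 s"
    "\<And>t z. t \<in> ball t0 r \<Longrightarrow> z \<in> ball z0 s \<Longrightarrow> F (t, z) = 0 \<longleftrightarrow> z = g t"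
    by (rule holomorphic_implicit_function[OF der cont, of t0 z0 "e/2"])
      (use assms e in \<open>auto simp: F_def\<close>)
  have "partial3 k h (affine_point i j k t z) \<noteq> 0" if "t \<in> ball t0 r" "z \<in> ball z0 s" for t z
  proof -
    have "dist (t0, z0) (t, z) \<le> dist t0 t + dist z0 z"
      by (simp add: dist_Pair_Pair sqrt_sum_squares_le_sum)
    also have "\<dots> < e" using that g by auto
    finally have "(t, z) \<in> ball (t0, z0) e" by simp
    then show ?thesis using e(2) by auto
  qed
  with that[of r s g] g show ?thesis by (auto simp: F_def)
qed

lemma affine_point_in_zeros:
  fixes y :: "complex ^ 3"
  assumes "{i, j, k} = (UNIV :: 3 set)" "y \<in> zeros" "y $ i \<noteq> 0"
  shows "affine_point i j k (y $ j / y $ i) (y $ k / y $ i) \<in> zeros"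
  using assms(2) affine_point_scale[OF assms(1,3)] zeros_scale[OF assms(3)] by metis

lemma partial3_affine_point_eq_0_iff:
  fixes y :: "complex ^ 3"
  assumes "{i, j, k} = (UNIV :: 3 set)" "y $ i \<noteq> 0"
  shows "partial3 l h (affine_point i j k (y $ j / y $ i) (y $ k / y $ i)) = 0 \<longleftrightarrow> partial3 l h y = 0"
  using partial3_scale_eq_0_iff[OF assms(2), of l "affine_point i j k (y $ j / y $ i) (y $ k / y $ i)"]
  by (simp only: affine_point_scale[OF assms, symmetric])

lemma atlas_iff:
  "(U, \<phi>) \<in> atlas \<longleftrightarrow> complex_chart surface U \<phi> \<and> (\<exists>i j k. {i, j, k} = (UNIV :: 3 set) \<and>
      (\<forall>y\<in>zeros. pclass y \<in> U \<longrightarrow> y $ i \<noteq> 0 \<and> partial3 k h y \<noteq> 0 \<and> \<phi> (pclass y) = y $ j / y $ i))"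
proof -
  have "y \<in> zeros" if "complex_chart surface U \<phi>" "pclass y \<in> U" for y
    using complex_chartD(4)[OF that(1)] that(2) pclass_in_pcurve_iff unfolding topspace_surface by blast
  moreover have "y \<noteq> 0" if "y \<in> zeros" for y using that by (simp add: zeros_def)
  ultimately show ?thesis unfolding atlas_def plane_curve_atlas_def by blast
qed

text \<open>The graph of the implicit function is the entire part of the curve lying over a bidisc.
  Hence its image \<open>U\<close> is open, and \<open>ratio j i\<close> on \<open>U\<close> is
  inverse to the parametrisation.\<close>

lemma chart_exists:
  fixes y0 :: "complex ^ 3"
  assumes ijk: "{i, j, k} = (UNIV :: 3 set)" and y0: "y0 \<in> zeros" "y0 $ i \<noteq> 0" "partial3 k h y0 \<noteq> 0"
  obtains U where "pclass y0 \<in> U" "(U, ratio j i) \<in> atlas"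
    "\<And>y. y \<in> zeros \<Longrightarrow> pclass y \<in> U \<Longrightarrow> y $ i \<noteq> 0 \<and> partial3 k h y \<noteq> 0"
proof -
  define t0 z0 where "t0 = y0 $ j / y0 $ i" and "z0 = y0 $ k / y0 $ i"
  have c0: "affine_point i j k t0 z0 \<in> zeros"
    unfolding t0_def z0_def by (rule affine_point_in_zeros[OF ijk y0(1,2)])
  then have h0: "eval3 h (affine_point i j k t0 z0) = 0" by (simp add: zeros_def)
  have nz: "partial3 k h (affine_point i j k t0 z0) \<noteq> 0"
    using y0(3) unfolding t0_def z0_def partial3_affine_point_eq_0_iff[OF ijk y0(2)] .
  obtain g r s where g: "r > 0" "s > 0" "g holomorphic_on ball t0 r"
    "\<And>t. t \<in> ball t0 r \<Longrightarrow> g t \<in> ball z0 s"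
    "\<And>t z. t \<in> ball t0 r \<Longrightarrow> z \<in> ball z0 s \<Longrightarrow> eval3 h (affine_point i j k t z) = 0 \<longleftrightarrow> z = g t"
    "\<And>t z. t \<in> ball t0 r \<Longrightarrow> z \<in> ball z0 s \<Longrightarrow> partial3 k h (affine_point i j k t z) \<noteq> 0"
    by (rule implicit_function[OF ijk h0 nz]) (rule that)
  define m where "m = (\<lambda>t. pclass (affine_point i j k t (g t)))"
  define U where "U = m ` ball t0 r"
  have gcone: "affine_point i j k t (g t) \<in> zeros" if "t \<in> ball t0 r" for t
    using g(4,5)[OF that] that affine_point_nonzero[OF ijk] unfolding zeros_def by simp
  have U_iff: "pclass y \<in> U \<longleftrightarrow> y $ i \<noteq> 0 \<and> y $ j / y $ i \<in> ball t0 r \<and> y $ k / y $ i \<in> ball z0 s"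
    if y: "y \<in> zeros" for y
  proof
    assume "pclass y \<in> U"
    then obtain t where t: "pclass y = m t" "t \<in> ball t0 r"
      unfolding U_def by (rule imageE)
    then obtain l where l: "l \<noteq> 0" "y = l *s affine_point i j k t (g t)"
      unfolding m_def by (metis pclass_eq_iff)
    then show "y $ i \<noteq> 0 \<and> y $ j / y $ i \<in> ball t0 r \<and> y $ k / y $ i \<in> ball z0 s"
      using t(2) g(4)[OF t(2)] by (simp add: affine_point_nth[OF ijk])
  next
    assume *: "y $ i \<noteq> 0 \<and> y $ j / y $ i \<in> ball t0 r \<and> y $ k / y $ i \<in> ball z0 s"
    then have eq: "g (y $ j / y $ i) = y $ k / y $ i"
      using g(5)[of "y $ j / y $ i" "y $ k / y $ i"] affine_point_in_zeros[OF ijk y] by (simp add: zeros_def)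
    have "y $ i \<noteq> 0" using * by blast
    then have "pclass y = m (y $ j / y $ i)"
      unfolding m_def eq by (rule pclass_affine_point[OF ijk])
    then show "pclass y \<in> U" using * unfolding U_def by blast
  qed
  have in_U: "pclass y0 \<in> U"
    using U_iff[OF y0(1)] y0(2) g(1,2) by (simp add: t0_def z0_def)
  have dpart: "y $ i \<noteq> 0 \<and> partial3 k h y \<noteq> 0" if "y \<in> zeros" "pclass y \<in> U" for y
  proof -
    have *: "y $ i \<noteq> 0" "y $ j / y $ i \<in> ball t0 r" "y $ k / y $ i \<in> ball z0 s"
      using U_iff that by auto
    then show ?thesis
      using g(6)[OF *(2,3)] partial3_affine_point_eq_0_iff[OF ijk *(1)] by blast
  qed
  have U_sub: "U \<subseteq> pcurve h"
    unfolding U_def m_def pcurve_eq using gcone by blast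
  have open_U: "openin surface U"
  proof -
    define W where "W = {y :: complex ^ 3. y $ i \<noteq> 0}"
    have W: "open W" unfolding W_def by (intro open_Collect_neq continuous_intros)
    have "continuous_on W (\<lambda>y. (y $ j / y $ i, y $ k / y $ i))"
      unfolding W_def by (intro continuous_intros) auto
    then have "open (W \<inter> (\<lambda>y. (y $ j / y $ i, y $ k / y $ i)) -` (ball t0 r \<times> ball z0 s))"
      by (rule continuous_open_preimage) (use W in \<open>auto intro: open_Times\<close>)
    moreover have "{y \<in> zeros. pclass y \<in> U} = zeros \<inter> (W \<inter> (\<lambda>y. (y $ j / y $ i, y $ k / y $ i)) -` (ball t0 r \<times> ball z0 s))"
      using U_iff unfolding W_def by auto
    ultimately show ?thesis
      unfolding openin_surface_iff using U_sub by (auto simp: openin_open)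
  qed
  have ratio_m: "ratio j i (m t) = t" for t
    unfolding m_def ratio_pclass by (simp add: affine_point_nth[OF ijk])
  have m_ratio: "m (ratio j i P) = P" if "P \<in> U" for P
    using that unfolding U_def by (auto simp: ratio_m)
  have im: "ratio j i ` U = ball t0 r"
    unfolding U_def by (simp add: image_image ratio_m)
  have c1: "continuous_map (subtopology surface U) (top_of_set (ball t0 r)) (ratio j i)"
  proof -
    have "continuous_on {y \<in> zeros. pclass y \<in> U} (\<lambda>y. y $ j / y $ i)"
      by (intro continuous_intros) (use U_iff in auto)
    then have "continuous_map (subtopology surface U) euclidean (ratio j i)"
      by (intro continuous_map_surfaceI[OF open_U]) (simp add: ratio_pclass)
    then show ?thesis
      using im topspace_surface U_sub by (auto simp: continuous_map_in_subtopology)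
  qed
  have c2: "continuous_map (top_of_set (ball t0 r)) (subtopology surface U) m"
  proof -
    have "continuous_on (ball t0 r) (\<lambda>t. affine_point i j k (fst (t, g t)) (snd (t, g t)))"
      by (rule continuous_on_compose2[OF continuous_on_affine_point[of UNIV]])
        (auto intro!: continuous_on_Pair continuous_on_id holomorphic_on_imp_continuous_on g(3))
    then have "continuous_map (top_of_set (ball t0 r)) (top_of_set zeros) (\<lambda>t. affine_point i j k t (g t))"
      using gcone by (auto simp: continuous_map_in_subtopology)
    from continuous_map_compose[OF this quotient_imp_continuous_map[OF quotient_map_surface]]
    have "continuous_map (top_of_set (ball t0 r)) surface m"
      by (simp add: o_def m_def)
    then show ?thesis by (auto simp: continuous_map_in_subtopology U_def)
  qed
  have "homeomorphic_maps (subtopology surface U) (top_of_set (ball t0 r)) (ratio j i) m"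
    unfolding homeomorphic_maps_def
  proof (intro conjI ballI c1 c2)
    show "m (ratio j i P) = P" if "P \<in> topspace (subtopology surface U)" for P
      using that m_ratio by simp
    show "ratio j i (m t) = t" for t by (rule ratio_m)
  qed
  then have "homeomorphic_map (subtopology surface U) (top_of_set (ball t0 r)) (ratio j i)"
    unfolding homeomorphic_map_maps by blast
  then have "complex_chart surface U (ratio j i)"
    unfolding complex_chart_def im using open_U by simp
  moreover have "\<exists>i' j' k'. {i', j', k'} = (UNIV :: 3 set) \<and>
      (\<forall>y\<in>zeros. pclass y \<in> U \<longrightarrow> y $ i' \<noteq> 0 \<and> partial3 k' h y \<noteq> 0 \<and> ratio j i (pclass y) = y $ j' / y $ i')"
    using dpart by (intro exI[of _ i] exI[of _ j] exI[of _ k] conjI ijk) (auto simp: ratio_pclass)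
  ultimately have "(U, ratio j i) \<in> atlas" unfolding atlas_iff by blast
  then show ?thesis using that[OF in_U _ dpart] by blast
qed

text \<open>The atlas consists of all charts given by some \<open>y $ j / y $ i\<close>, with
  domains of any shape, so the lift \<open>g\<close> to the cone is defined globally as the third
  coordinate. A priori it is only continuous; its holomorphy is local.\<close>

lemma chart_lift:
  assumes "(U, \<phi>) \<in> atlas"
  obtains i j k g where "{i, j, k} = (UNIV :: 3 set)"
    "\<And>y. y \<in> zeros \<Longrightarrow> pclass y \<in> U \<Longrightarrow> y $ i \<noteq> 0 \<and> partial3 k h y \<noteq> 0 \<and> \<phi> (pclass y) = y $ j / y $ i"
    "g holomorphic_on \<phi> ` U"
    "\<And>t. t \<in> \<phi> ` U \<Longrightarrow> affine_point i j k t (g t) \<in> zeros"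
    "\<And>t. t \<in> \<phi> ` U \<Longrightarrow> inv_into U \<phi> t = pclass (affine_point i j k t (g t))"
proof -
  obtain i j k where ijk: "{i, j, k} = (UNIV :: 3 set)"
    and U: "\<And>y. y \<in> zeros \<Longrightarrow> pclass y \<in> U \<Longrightarrow> y $ i \<noteq> 0 \<and> partial3 k h y \<noteq> 0 \<and> \<phi> (pclass y) = y $ j / y $ i"
    and chart: "complex_chart surface U \<phi>"
    using assms unfolding atlas_iff by blast
  note D = complex_chartD[OF chart]
  define g where "g = (\<lambda>t. ratio k i (inv_into U \<phi> t))"
  have inv: "inv_into U \<phi> t = pclass (affine_point i j k t (g t)) \<and> affine_point i j k t (g t) \<in> zeros"
    if t: "t \<in> \<phi> ` U" for t
  proof -
    have "inv_into U \<phi> t \<in> U" using t by (rule inv_into_into)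
    then obtain y where y: "y \<in> zeros" "inv_into U \<phi> t = pclass y"
      using D(4) unfolding topspace_surface pcurve_eq by blast
    then have yU: "pclass y \<in> U" using \<open>inv_into U \<phi> t \<in> U\<close> by simp
    have yi: "y $ i \<noteq> 0" using U[OF y(1) yU] by blast
    have "t = y $ j / y $ i" using U[OF y(1) yU] f_inv_into_f[OF t] y(2) by simp
    moreover have "g t = y $ k / y $ i" by (simp add: g_def y(2) ratio_pclass)
    ultimately show ?thesis
      using pclass_affine_point[OF ijk yi] affine_point_in_zeros[OF ijk y(1) yi] unfolding y(2) by (simp only:)
  qed
  have "continuous_map (subtopology surface U) euclidean (ratio k i)"
  proof (rule continuous_map_surfaceI[OF D(1)])
    have "continuous_on {y \<in> zeros. pclass y \<in> U} (\<lambda>y. y $ k / y $ i)"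
      by (intro continuous_intros) (use U in auto)
    then show "continuous_map (top_of_set {y \<in> zeros. pclass y \<in> U}) euclidean (\<lambda>y. ratio k i (pclass y))"
      by (simp add: ratio_pclass)
  qed
  from continuous_map_compose[OF D(6) this] have cont: "continuous_on (\<phi> ` U) g"
    by (simp add: g_def o_def)
  have "g field_differentiable at t0" if t0: "t0 \<in> \<phi> ` U" for t0
  proof -
    define p0 where "p0 = affine_point i j k t0 (g t0)"
    have p0: "p0 \<in> zeros" "pclass p0 \<in> U" using inv[OF t0] inv_into_into[OF t0] by (simp_all add: p0_def)
    have h0: "eval3 h (affine_point i j k t0 (g t0)) = 0" using p0 by (simp add: zeros_def p0_def)
    have nz: "partial3 k h (affine_point i j k t0 (g t0)) \<noteq> 0" using U[OF p0] by (simp add: p0_def)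
    \<comment> \<open>Near \<open>t0\<close> continuity keeps \<open>g t\<close> in the disc where
      the implicit function \<open>g'\<close> is the only solution, so the two agree there.\<close>
    obtain g' r s where g': "r > 0" "s > 0" "g' holomorphic_on ball t0 r"
      "\<And>t z. t \<in> ball t0 r \<Longrightarrow> z \<in> ball (g t0) s \<Longrightarrow> eval3 h (affine_point i j k t z) = 0 \<longleftrightarrow> z = g' t"
      by (rule implicit_function[OF ijk h0 nz]) (rule that)
    have "\<forall>\<^sub>F t in nhds t0. g t = g' t"
    proof -
      have "(g \<longlongrightarrow> g t0) (nhds t0)"
        using cont t0 unfolding continuous_on_eq_continuous_at[OF D(2)] isCont_def tendsto_at_iff_tendsto_nhds
        by blast
      then have "\<forall>\<^sub>F t in nhds t0. g t \<in> ball (g t0) s"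
        by (rule topological_tendstoD) (use g'(2) in auto)
      moreover have "\<forall>\<^sub>F t in nhds t0. t \<in> ball t0 r" using g'(1) by (intro eventually_nhds_in_open) auto
      moreover have "\<forall>\<^sub>F t in nhds t0. t \<in> \<phi> ` U" using D(2) t0 by (intro eventually_nhds_in_open) auto
      ultimately show ?thesis
      proof eventually_elim
        case (elim t)
        then show ?case using g'(4) inv[OF elim(3)] unfolding zeros_def by blast
      qed
    qed
    moreover obtain c where "(g' has_field_derivative c) (at t0)"
      using g'(1,3) holomorphic_on_imp_differentiable_at[of g' "ball t0 r" t0]
      unfolding field_differentiable_def by auto
    ultimately have "(g has_field_derivative c) (at t0)"
      by (subst DERIV_cong_ev[OF refl _ refl])
    then show ?thesis unfolding field_differentiable_def by blast
  qed
  then have "g holomorphic_on \<phi> ` U"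
    by (simp add: D(2) holomorphic_on_open field_differentiable_def)
  show ?thesis
  proof (rule that[OF ijk])
    show "g holomorphic_on \<phi> ` U" by fact
    show "y $ i \<noteq> 0 \<and> partial3 k h y \<noteq> 0 \<and> \<phi> (pclass y) = y $ j / y $ i"
      if "y \<in> zeros" "pclass y \<in> U" for y using that by (rule U)
    show "affine_point i j k t (g t) \<in> zeros" "inv_into U \<phi> t = pclass (affine_point i j k t (g t))"
      if "t \<in> \<phi> ` U" for t using inv[OF that] by auto
  qed
qed

text \<open>Along the holomorphic lift of the first chart, the second coordinate is a quotient of
  holomorphic functions with nonvanishing denominator.\<close>

lemma compatible_atlas:
  assumes "(U, \<phi>) \<in> atlas" "(V, \<psi>) \<in> atlas"
  shows "(\<psi> \<circ> inv_into U \<phi>) holomorphic_on \<phi> ` (U \<inter> V)"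
proof -
  obtain i j k g where L: "{i, j, k} = (UNIV :: 3 set)" "g holomorphic_on \<phi> ` U"
    "\<And>t. t \<in> \<phi> ` U \<Longrightarrow> affine_point i j k t (g t) \<in> zeros"
    "\<And>t. t \<in> \<phi> ` U \<Longrightarrow> inv_into U \<phi> t = pclass (affine_point i j k t (g t))"
  proof (rule chart_lift[OF assms(1)])
    fix i j k g
    assume "{i, j, k} = (UNIV :: 3 set)" "g holomorphic_on \<phi> ` U"
      "\<And>t. t \<in> \<phi> ` U \<Longrightarrow> affine_point i j k t (g t) \<in> zeros"
      "\<And>t. t \<in> \<phi> ` U \<Longrightarrow> inv_into U \<phi> t = pclass (affine_point i j k t (g t))"
    then show thesis by (rule that)
  qed
  obtain i' j' k' where V: "\<And>y. y \<in> zeros \<Longrightarrow> pclass y \<in> V \<Longrightarrow> y $ i' \<noteq> 0 \<and> \<psi> (pclass y) = y $ j' / y $ i'"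
    using assms(2) unfolding atlas_iff by blast
  have inj: "inj_on \<phi> U" using assms(1) complex_chartD(3) unfolding atlas_iff by blast
  have *: "affine_point i j k t (g t) $ i' \<noteq> 0 \<and>
      \<psi> (inv_into U \<phi> t) = affine_point i j k t (g t) $ j' / affine_point i j k t (g t) $ i'"
    if "t \<in> \<phi> ` (U \<inter> V)" for t
  proof -
    have t: "t \<in> \<phi> ` U" "inv_into U \<phi> t \<in> V" using that inj by auto
    then show ?thesis using V[OF L(3)[OF t(1)]] L(4)[OF t(1)] by simp
  qed
  have "(\<lambda>t. affine_point i j k t (g t) $ j' / affine_point i j k t (g t) $ i') holomorphic_on \<phi> ` (U \<inter> V)"
    by (intro holomorphic_on_divide holomorphic_affine_point[OF L(1)] holomorphic_on_subset[OF L(2)])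
      (use * in auto)
  then show ?thesis
    by (rule holomorphic_transform) (use * in auto)
qed

lemma complex_atlas_surface: "complex_atlas surface atlas"
  unfolding complex_atlas_def
proof (intro conjI ballI)
  show "case c of (U, \<phi>) \<Rightarrow> complex_chart surface U \<phi>" if "c \<in> atlas" for c
    using that by (cases c) (simp add: atlas_iff)
  then have "(\<Union>(U, \<phi>)\<in>atlas. U) \<subseteq> topspace surface"
    using complex_chartD(4) by fast
  moreover have "P \<in> (\<Union>(U, \<phi>)\<in>atlas. U)" if "P \<in> topspace surface" for P
  proof -
    from that obtain y where y: "P = pclass y" "y \<in> zeros"
      unfolding topspace_surface pcurve_eq by (rule imageE)
    obtain i j k where ijk: "{i, j, k} = (UNIV :: 3 set)" "y $ i \<noteq> 0" "partial3 k h y \<noteq> 0"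
      using chart_indices[OF y(2)] .
    obtain U where "pclass y \<in> U" "(U, ratio j i) \<in> atlas" by (rule chart_exists[OF ijk(1) y(2) ijk(2,3)])
    then show ?thesis using y(1) by blast
  qed
  ultimately show "(\<Union>(U, \<phi>)\<in>atlas. U) = topspace surface" by blast
  show "compatible_charts c c'" if "c \<in> atlas" "c' \<in> atlas" for c c'
  proof -
    obtain U \<phi> V \<psi> where "c = (U, \<phi>)" "c' = (V, \<psi>)" by (cases c, cases c') blast
    then show ?thesis
      using that compatible_atlas[of U \<phi> V \<psi>] compatible_atlas[of V \<psi> U \<phi>]
      by (simp add: compatible_charts_def Int_commute)
  qed
qed

end

section \<open>Connectedness of plane curves\<close>

text \<open>The exceptional points are isolated, so boundedness lets \<open>f\<close> extend over
  them by Riemann's theorem, and Liouville's theorem applies to the extension.\<close>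

lemma bounded_holomorphic_off_discrete_const:
  assumes fin: "\<And>r. finite (S \<inter> cball 0 r)"
    and hol: "f holomorphic_on - S"
    and bound: "\<And>z. z \<notin> S \<Longrightarrow> norm (f z) \<le> B"
  obtains c where "\<And>z. z \<notin> S \<Longrightarrow> f z = c"
proof -
  have sep: "\<exists>r>0. \<forall>x\<in>S. x \<noteq> z \<longrightarrow> r \<le> dist z x" for z
  proof -
    obtain r where r: "r > 0" "\<forall>x\<in>S \<inter> cball 0 (norm z + 1). x \<noteq> z \<longrightarrow> r \<le> dist z x"
      using finite_set_avoid[OF fin] by blast
    have "min r 1 \<le> dist z x" if "x \<in> S" "x \<noteq> z" for x
    proof (cases "x \<in> cball 0 (norm z + 1)")
      case False
      then have "norm z + 1 < norm x" by simp
      moreover have "norm x \<le> norm z + dist z x"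
        using norm_triangle_ineq2[of x z] by (simp add: dist_norm norm_minus_commute)
      ultimately show ?thesis by simp
    qed (use r that in auto)
    then show ?thesis using r(1) by (intro exI[of _ "min r 1"]) auto
  qed
  have nbhd: "\<exists>r>0. ball z r - {z} \<subseteq> - S" for z
  proof -
    obtain r where "r > 0" "\<forall>x\<in>S. x \<noteq> z \<longrightarrow> r \<le> dist z x" using sep by blast
    then show ?thesis by (intro exI[of _ r]) force
  qed
  have op: "open (- S)"
    unfolding open_contains_ball
  proof
    fix z assume "z \<in> - S"
    then show "\<exists>e>0. ball z e \<subseteq> - S" using nbhd[of z] by blast
  qed
  have an: "f analytic_on {z}" if "z \<notin> S" for z
    using that hol op holomorphic_on_imp_analytic_at by blast
  have lim: "isolated_singularity_at f z \<and> (\<exists>c. (f \<longlongrightarrow> c) (at z) \<and> norm c \<le> B)" for z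
  proof -
    obtain r where r: "r > 0" "ball z r - {z} \<subseteq> - S" using nbhd by blast
    have h: "f holomorphic_on (ball z r - {z})" using hol r(2) by (rule holomorphic_on_subset)
    then have iso: "isolated_singularity_at f z"
      using r(1) unfolding isolated_singularity_at_def by (auto simp: analytic_on_open open_delete)
    have ev: "\<forall>\<^sub>F w in at z. w \<in> ball z r - {z}"
      using eventually_at_in_open[of "ball z r" z] r(1) by simp
    then have evB: "\<forall>\<^sub>F w in at z. norm (f w) \<le> B"
      by (rule eventually_mono) (use bound r(2) in blast)
    \<comment> \<open>The extension theorem asks for a positive bound, while \<open>B\<close> may be
      any real number.\<close>
    then have evB': "\<forall>\<^sub>F w in at z. norm (f w) \<le> max B 1"
      by (rule eventually_mono) simp
    obtain g where g: "g holomorphic_on ball z r" "\<forall>w\<in>ball z r - {z}. g w = f w"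
      using holomorphic_on_extend_bounded[OF h] evB' r(1)
      by (metis centre_in_ball interior_ball less_max_iff_disj zero_less_one)
    have "isCont g z"
      using g(1) r(1) by (metis centre_in_ball continuous_on_eq_continuous_at holomorphic_on_imp_continuous_on open_ball)
    then have "(g \<longlongrightarrow> g z) (at z)" by (simp add: isCont_def)
    then have "(f \<longlongrightarrow> g z) (at z)"
      by (rule Lim_transform_eventually) (use ev g(2) in \<open>auto elim: eventually_mono\<close>)
    moreover from this have "norm (g z) \<le> B"
      using evB by (intro Lim_norm_ubound[of "at z" f]) auto
    ultimately show ?thesis using iso by blast
  qed
  have "remove_sings f analytic_on {z}" for z
    using lim[of z] remove_sings_analytic_at by blast
  then have "remove_sings f holomorphic_on UNIV"
    by (metis UNIV_I analytic_imp_holomorphic analytic_on_analytic_at)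
  moreover have "bounded (range (remove_sings f))"
  proof -
    have "norm (remove_sings f z) \<le> B" for z
      using lim[of z] remove_sings_eqI by metis
    then show ?thesis unfolding bounded_iff by blast
  qed
  ultimately obtain c where "\<And>z. remove_sings f z = c"
    using Liouville_theorem unfolding constant_on_def by blast
  then show ?thesis using that an remove_sings_at_analytic by metis
qed

text \<open>The value at \<open>x\<close> is the leading coefficient times the product of the
  differences to the roots; if all of these had modulus at least \<open>e\<close>, the value would
  be too large. This is the continuity of roots in the form used below.\<close>

lemma poly_root_near:
  fixes p :: "complex poly"
  assumes "norm (poly p x) < norm (lead_coeff p) * e ^ degree p" "e > 0"
  obtains z where "poly p z = 0" "norm (x - z) < e"
proof -
  obtain root where root: "smult (lead_coeff p) (\<Prod>i<degree p. [:-root i, 1:]) = p"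
    using complex_poly_decompose' by blast
  have val: "poly p y = lead_coeff p * (\<Prod>i<degree p. y - root i)" for y
    by (subst root[symmetric]) (simp add: poly_prod)
  have "\<exists>i<degree p. norm (x - root i) < e"
  proof (rule ccontr)
    assume "\<not> ?thesis"
    then have "(\<Prod>i<degree p. e) \<le> (\<Prod>i<degree p. norm (x - root i))"
      using assms(2) by (intro prod_mono) force
    then have "norm (lead_coeff p) * e ^ degree p \<le> norm (poly p x)"
      by (simp add: val norm_mult prod_norm mult_left_mono)
    then show False using assms(1) by simp
  qed
  then obtain i where i: "i < degree p" "norm (x - root i) < e" by blast
  have "poly p (root i) = 0" using i(1) by (simp add: val prod_zero_iff) blast
  then show ?thesis using i(2) that by blast
qed

section \<open>Projection of a plane curve from a point off it\<close>

locale plane_curve_projection = plane_curve +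
  fixes u v q :: "complex ^ 3"
  assumes q: "eval3 h q \<noteq> 0"
    and span: "\<exists>s t z. y = s *s u + t *s v + z *s q"
    and indep: "s *s u + t *s v + z *s q = 0 \<Longrightarrow> s = 0 \<and> t = 0 \<and> z = 0"
begin

text \<open>Over \<open>t\<close> lies the line through \<open>q\<close> and
  \<open>u + t *s v\<close>, and \<open>pt t z\<close> runs through its points other than
  \<open>q\<close>. The line through \<open>q\<close> and \<open>v\<close> corresponds to
  \<open>t\<close> at infinity.\<close>

definition pt :: "complex \<Rightarrow> complex \<Rightarrow> complex ^ 3" where "pt t z = u + t *s v + z *s q"

definition "roots t = {z. eval3 h (pt t z) = 0}"

text \<open>With \<open>Dz\<close>, the partial derivatives of \<open>eval3 h (pt t z)\<close> in
  \<open>t\<close> and \<open>z\<close>, written as directional derivatives along \<open>v\<close>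
  and \<open>q\<close>.\<close>

definition "Dt t z = (\<Sum>i\<in>UNIV. partial3 i h (pt t z) * v $ i)"

definition "Dz t z = (\<Sum>i\<in>UNIV. partial3 i h (pt t z) * q $ i)"

definition "good t \<longleftrightarrow> (\<forall>z\<in>roots t. Dz t z \<noteq> 0)"

lemma pt_nonzero: "pt t z \<noteq> 0"
  using indep[of 1 t z] by (auto simp: pt_def)

lemma pt_zeros_iff: "pt t z \<in> zeros \<longleftrightarrow> z \<in> roots t"
  by (simp add: zeros_def pt_nonzero roots_def)

text \<open>Degree and leading coefficient are read off from the growth at infinity: by homogeneity
  \<open>poly p z / z ^ d\<close> is the value of \<open>h\<close> at
  \<open>inverse z *s w + q\<close>, which tends to \<open>eval3 h q\<close>, a nonzero
  number.\<close>

lemma restriction_poly: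
  obtains p where "\<And>z. poly p z = eval3 h (w + z *s q)" "degree p = d" "lead_coeff p = eval3 h q"
proof -
  define p where "p = (\<Sum>c\<in>Poly_Mapping.keys h. smult (Poly_Mapping.lookup h c)
    (\<Prod>i\<in>UNIV. [:w $ i, q $ i:] ^ Poly_Mapping.lookup c i))"
  have p: "poly p z = eval3 h (w + z *s q)" for z
    by (simp add: p_def poly_sum poly_prod eval3_def)
  have "((\<lambda>z. inverse z *s w + q) \<longlongrightarrow> 0 *s w + q) at_infinity"
    unfolding vector_scalar_mult_def by (intro tendsto_intros tendsto_inverse_0)
  moreover have "isCont (eval3 h) (0 *s w + q)"
    using continuous_on_eval3[of UNIV h] by (simp add: continuous_on_eq_continuous_at)
  ultimately have "((\<lambda>z. eval3 h (inverse z *s w + q)) \<longlongrightarrow> eval3 h (0 *s w + q)) at_infinity"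
    by (rule isCont_tendsto_compose[rotated])
  then have "((\<lambda>z. eval3 h (inverse z *s w + q)) \<longlongrightarrow> eval3 h q) at_infinity" by simp
  moreover have "\<forall>\<^sub>F z in at_infinity. eval3 h (inverse z *s w + q) = poly p z / z ^ d"
  proof -
    have "\<forall>\<^sub>F z in at_infinity. z \<noteq> (0 :: complex)" by (rule eventually_not_equal_at_infinity)
    then show ?thesis
    proof eventually_elim
      case (elim z)
      then have "w + z *s q = z *s (inverse z *s w + q)" by (simp add: vec_eq_iff algebra_simps)
      then show ?case using elim homogeneous[of z "inverse z *s w + q"] by (simp add: p)
    qed
  qed
  ultimately have lim_d: "((\<lambda>z. poly p z / z ^ d) \<longlongrightarrow> eval3 h q) at_infinity"
    by (rule Lim_transform_eventually)
  have lim_n: "((\<lambda>z. poly p z / z ^ degree p) \<longlongrightarrow> lead_coeff p) at_infinity"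
    by (rule poly_divide_tendsto_aux)
  have nonconst: "\<not> ((\<lambda>z :: complex. z ^ k) \<longlongrightarrow> c) at_infinity" if "k > 0" for k c
    using that not_tendsto_and_filterlim_at_infinity[OF trivial_limit_at_infinity, of "\<lambda>z :: complex. z ^ k" c]
      filterlim_power_at_infinity[of k, where 'a = complex] by auto
  have p0: "p \<noteq> 0" using lim_d q tendsto_const_iff[OF trivial_limit_at_infinity, of 0 "eval3 h q"] by auto
  have ev: "\<forall>\<^sub>F z in at_infinity. z \<noteq> 0 \<and> poly p z \<noteq> 0"
  proof -
    have "\<forall>\<^sub>F z in at_infinity. poly p z / z ^ d \<noteq> 0"
      using lim_d q by (rule tendsto_imp_eventually_ne)
    moreover have "\<forall>\<^sub>F z in at_infinity. z \<noteq> (0 :: complex)" by (rule eventually_not_equal_at_infinity)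
    ultimately show ?thesis by eventually_elim auto
  qed
  have "degree p = d"
  proof (rule linorder_cases[of "degree p" d])
    assume less: "degree p < d"
    have "((\<lambda>z. (poly p z / z ^ degree p) / (poly p z / z ^ d)) \<longlongrightarrow> lead_coeff p / eval3 h q) at_infinity"
      by (intro tendsto_divide lim_n lim_d q)
    moreover have "\<forall>\<^sub>F z in at_infinity. (poly p z / z ^ degree p) / (poly p z / z ^ d) = z ^ (d - degree p)"
      using ev by eventually_elim (use less in \<open>simp add: power_diff\<close>)
    ultimately have "((\<lambda>z. z ^ (d - degree p)) \<longlongrightarrow> lead_coeff p / eval3 h q) at_infinity"
      by (rule Lim_transform_eventually)
    then show ?thesis using nonconst less by simp
  next
    assume less: "d < degree p"
    have "((\<lambda>z. (poly p z / z ^ d) / (poly p z / z ^ degree p)) \<longlongrightarrow> eval3 h q / lead_coeff p) at_infinity"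
      by (intro tendsto_divide lim_n lim_d) (use p0 in simp)
    moreover have "\<forall>\<^sub>F z in at_infinity. (poly p z / z ^ d) / (poly p z / z ^ degree p) = z ^ (degree p - d)"
      using ev by eventually_elim (use less in \<open>simp add: power_diff\<close>)
    ultimately have "((\<lambda>z. z ^ (degree p - d)) \<longlongrightarrow> eval3 h q / lead_coeff p) at_infinity"
      by (rule Lim_transform_eventually)
    then show ?thesis using nonconst less by simp
  qed
  moreover from this have "lead_coeff p = eval3 h q"
    using lim_n lim_d tendsto_unique[OF trivial_limit_at_infinity] by metis
  ultimately show ?thesis using that[of p] p by simp
qed

lemma finite_roots: "finite (roots t)" and card_roots_le: "card (roots t) \<le> d"
proof -
  obtain p where p: "\<And>z. poly p z = eval3 h (u + t *s v + z *s q)" "degree p = d" "lead_coeff p = eval3 h q"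
    by (rule restriction_poly[of "u + t *s v"]) (rule that)
  have "p \<noteq> 0" using p(3) q by auto
  moreover have "roots t = {z. poly p z = 0}" by (simp add: roots_def p(1) pt_def)
  ultimately show "finite (roots t)" "card (roots t) \<le> d"
    using poly_roots_finite card_poly_roots_bound p(2) by auto
qed

lemma curve_has_derivative:
  "((\<lambda>x. eval3 h (pt (fst x) (snd x))) has_derivative
     (\<lambda>w. Dt (fst x) (snd x) * fst w + Dz (fst x) (snd x) * snd w)) (at x)"
  unfolding pt_def Dt_def Dz_def by (rule eval3_plane_has_derivative)

text \<open>With the variables exchanged, the implicit function theorem solves for \<open>t\<close>
  in terms of \<open>z\<close>, which is what is needed at a multiple root.\<close>

lemma curve_has_derivative_swapped:
  "((\<lambda>x. eval3 h (pt (snd x) (fst x))) has_derivative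
     (\<lambda>w. Dz (snd x) (fst x) * fst w + Dt (snd x) (fst x) * snd w)) (at x)"
  using eval3_plane_has_derivative[of h u q v x]
  unfolding pt_def Dt_def Dz_def by (simp add: add.assoc add.commute[of "_ *s v"])

lemma continuous_Dz: "continuous_on UNIV (\<lambda>x. Dz (fst x) (snd x))"
  unfolding pt_def Dz_def by (rule continuous_on_eval3_plane_partial)

lemma continuous_Dt_swapped: "continuous_on UNIV (\<lambda>x. Dt (snd x) (fst x))"
  using continuous_on_eval3_plane_partial[of h u q v]
  unfolding pt_def Dt_def by (simp add: add.assoc add.commute[of "_ *s v"])

lemma continuous_pt: "continuous_on S f \<Longrightarrow> continuous_on S g \<Longrightarrow> continuous_on S (\<lambda>x. pt (f x) (g x))"
  unfolding pt_def vector_scalar_mult_def by (intro continuous_intros)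

text \<open>Otherwise the derivative of \<open>h\<close> would vanish along \<open>q\<close> and
  \<open>v\<close>, and by Euler's identity also along \<open>pt t z\<close>, hence along
  \<open>u\<close>; these span the space, against non-singularity.\<close>

lemma Dt_nonzero:
  assumes "z \<in> roots t" "Dz t z = 0"
  shows "Dt t z \<noteq> 0"
proof
  assume Dt0: "Dt t z = 0"
  let ?D = "\<lambda>w. \<Sum>i\<in>UNIV. partial3 i h (pt t z) * w $ i"
  have lin: "?D (s *s x + r *s y + m *s w) = s * ?D x + r * ?D y + m * ?D w" for s r m x y w
    by (simp add: sum.distrib sum_distrib_left algebra_simps)
  have "?D (pt t z) = 0" using euler[of "pt t z"] assms(1) by (simp add: roots_def)
  moreover have "pt t z = 1 *s u + t *s v + z *s q" by (simp add: pt_def)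
  ultimately have Du: "?D u = 0"
    using lin[of 1 u t v z q] assms(2) Dt0 unfolding Dt_def Dz_def by simp
  have "?D y = 0" for y
  proof -
    obtain s r m where "y = s *s u + r *s v + m *s q" using span by blast
    then show ?thesis using lin[of s u r v m q] assms(2) Dt0 Du unfolding Dt_def Dz_def by simp
  qed
  then have "partial3 i h (pt t z) = 0" for i
    using \<open>?D (axis i 1) = 0\<close> by (simp add: axis_def if_distrib[of "\<lambda>x. _ * x"] cong: if_cong)
  then show False using nonsing assms(1) pt_nonzero unfolding nonsingular_def roots_def by blast
qed

lemma implicit_roots:
  assumes "z0 \<in> roots t0" "Dz t0 z0 \<noteq> 0" "e > 0"
  obtains g r where "r > 0" "g holomorphic_on ball t0 r" "g t0 = z0"
    "\<And>t. t \<in> ball t0 r \<Longrightarrow> g t \<in> roots t \<and> dist (g t) z0 < e"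
proof -
  have 0: "eval3 h (pt (fst (t0, z0)) (snd (t0, z0))) = 0" using assms(1) by (simp add: roots_def)
  have nz: "Dz (fst (t0, z0)) (snd (t0, z0)) \<noteq> 0" using assms(2) by simp
  obtain g r s where g: "r > 0" "s > 0" "r < e" "s < e" "g holomorphic_on ball t0 r"
    "\<And>t. t \<in> ball t0 r \<Longrightarrow> g t \<in> ball z0 s"
    "\<And>t z. t \<in> ball t0 r \<Longrightarrow> z \<in> ball z0 s \<Longrightarrow>
      eval3 h (pt (fst (t, z)) (snd (t, z))) = 0 \<longleftrightarrow> z = g t"
    by (rule holomorphic_implicit_function[OF curve_has_derivative continuous_Dz 0 nz assms(3)]) (rule that)
  have "g t \<in> roots t \<and> dist (g t) z0 < e" if "t \<in> ball t0 r" for t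
    using g(4) g(6)[OF that] g(7)[OF that g(6)[OF that]] by (simp add: roots_def dist_commute)
  moreover have "g t0 = z0" using g(7)[of t0 z0] g(1,2) 0 by simp
  ultimately show ?thesis using that[OF g(1,5)] by blast
qed

text \<open>Near a critical point the curve is a graph \<open>t = \<tau> z\<close>, and
  differentiating the equation shows that critical points on it are zeros of the derivative of
  \<open>\<tau>\<close>. These are isolated unless \<open>\<tau>\<close> is constant.\<close>

lemma not_islimpt_critical:
  assumes "(t0, z0) \<in> {(t, z). z \<in> roots t \<and> Dz t z = 0}"
  shows "\<not> (t0, z0) islimpt {(t, z). z \<in> roots t \<and> Dz t z = 0}"
proof -
  let ?S = "{(t, z). z \<in> roots t \<and> Dz t z = 0}"
  have 0: "eval3 h (pt (snd (z0, t0)) (fst (z0, t0))) = 0" using assms by (simp add: roots_def)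
  have nz: "Dt (snd (z0, t0)) (fst (z0, t0)) \<noteq> 0" using Dt_nonzero assms by simp
  obtain \<tau> r s where g: "r > 0" "s > 0" "r < 1" "s < 1" "\<tau> holomorphic_on ball z0 r"
    "\<And>z. z \<in> ball z0 r \<Longrightarrow> \<tau> z \<in> ball t0 s"
    "\<And>z t. z \<in> ball z0 r \<Longrightarrow> t \<in> ball t0 s \<Longrightarrow>
      eval3 h (pt (snd (z, t)) (fst (z, t))) = 0 \<longleftrightarrow> t = \<tau> z"
    by (rule holomorphic_implicit_function[OF curve_has_derivative_swapped continuous_Dt_swapped 0 nz zero_less_one])
      (rule that)
  have root: "z \<in> roots (\<tau> z)" if "z \<in> ball z0 r" for z
    using g(7)[OF that g(6)[OF that]] by (simp add: roots_def)
  have der: "Dz (\<tau> z) z + Dt (\<tau> z) z * deriv \<tau> z = 0" if z: "z \<in> ball z0 r" for z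
  proof -
    have "(\<tau> has_field_derivative deriv \<tau> z) (at z)"
      using g(5) z by (simp add: holomorphic_derivI)
    then have "(\<tau> has_derivative (\<lambda>w. deriv \<tau> z * w)) (at z)"
      by (simp add: has_field_derivative_def)
    then have "((\<lambda>z. (z, \<tau> z)) has_derivative (\<lambda>w. (w, deriv \<tau> z * w))) (at z)"
      by (intro has_derivative_Pair has_derivative_ident)
    from has_derivative_compose[OF this curve_has_derivative_swapped]
    have "((\<lambda>z. eval3 h (pt (\<tau> z) z)) has_derivative (\<lambda>w. Dz (\<tau> z) z * w + Dt (\<tau> z) z * (deriv \<tau> z * w))) (at z)"
      by simp
    moreover have "(\<lambda>w. Dz (\<tau> z) z * w + Dt (\<tau> z) z * (deriv \<tau> z * w)) =
        (\<lambda>w. (Dz (\<tau> z) z + Dt (\<tau> z) z * deriv \<tau> z) * w)"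
      by (simp add: distrib_right mult.assoc)
    ultimately have "((\<lambda>z. eval3 h (pt (\<tau> z) z)) has_derivative (\<lambda>w. (Dz (\<tau> z) z + Dt (\<tau> z) z * deriv \<tau> z) * w)) (at z)"
      by (simp only:)
    then have "((\<lambda>z. eval3 h (pt (\<tau> z) z)) has_field_derivative (Dz (\<tau> z) z + Dt (\<tau> z) z * deriv \<tau> z)) (at z)"
      unfolding has_field_derivative_def .
    moreover have "((\<lambda>z. eval3 h (pt (\<tau> z) z)) has_field_derivative 0) (at z)"
    proof (rule has_field_derivative_transform_within_open[of "\<lambda>_. 0" _ _ "ball z0 r"])
      show "0 = eval3 h (pt (\<tau> x) x)" if "x \<in> ball z0 r" for x
        using root[OF that] by (simp add: roots_def)
    qed (use z in auto)
    ultimately show ?thesis by (rule DERIV_unique)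
  qed
  have d0: "deriv \<tau> z0 = 0"
  proof -
    have "\<tau> z0 = t0" using g(7)[of z0 t0] g(1,2) 0 by simp
    then show ?thesis using der[of z0] g(1) assms Dt_nonzero[of z0 t0] by auto
  qed
  \<comment> \<open>A constant \<open>\<tau>\<close> would put a whole disc of roots over a single
    parameter, whereas each fibre is finite.\<close>
  have "\<exists>w\<in>ball z0 r. deriv \<tau> w \<noteq> 0"
  proof (rule ccontr)
    assume "\<not> ?thesis"
    then have "deriv \<tau> w = 0" if "w \<in> ball z0 r" for w using that by blast
    then have const: "(\<tau> has_field_derivative 0) (at w)" if "w \<in> ball z0 r" for w
      using holomorphic_derivI[OF g(5) open_ball that] that by metis
    have "\<tau> w = \<tau> z0" if "w \<in> ball z0 r" for w
    proof (rule has_derivative_zero_unique_connected[OF open_ball connected_ball _ that])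
      show "(\<tau> has_derivative (\<lambda>x. 0)) (at x)" if "x \<in> ball z0 r" for x
        using const[OF that] by (simp add: has_field_derivative_def lambda_zero)
    qed (use g(1) in simp)
    then have "ball z0 r \<subseteq> roots (\<tau> z0)" using root by (metis subsetI)
    then have "finite (ball z0 r)" using finite_roots by (rule finite_subset)
    then show False using uncountable_ball[OF g(1)] countable_finite by blast
  qed
  then obtain w where w: "w \<in> ball z0 r" "deriv \<tau> w \<noteq> 0" by blast
  obtain r' where r': "0 < r'" "ball z0 r' \<subseteq> ball z0 r" "\<And>z. z \<in> ball z0 r' - {z0} \<Longrightarrow> deriv \<tau> z \<noteq> 0"
  proof (rule isolated_zeros[OF holomorphic_deriv[OF g(5) open_ball] open_ball connected_ball _ d0 w])
    show "z0 \<in> ball z0 r" using g(1) by simp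
  qed (rule that)
  have only: "x = (t0, z0)" if "x \<in> ?S" "x \<in> ball t0 s \<times> ball z0 r'" for x
  proof -
    obtain t z where xtz: "x = (t, z)" by (cases x)
    have x: "x = (t, z)" "t \<in> ball t0 s" "z \<in> ball z0 r'" "z \<in> roots t" "Dz t z = 0"
      using that unfolding xtz by blast+
    have z: "z \<in> ball z0 r" using x(3) r'(2) by blast
    have t: "t = \<tau> z" using g(7)[OF z x(2)] x(4) by (simp add: roots_def)
    then have "Dt (\<tau> z) z * deriv \<tau> z = 0" "Dt (\<tau> z) z \<noteq> 0"
      using der[OF z] x(5) Dt_nonzero[OF x(4,5)] by simp_all
    then have "deriv \<tau> z = 0" by (simp only: mult_eq_0_iff simp_thms)
    then have "z = z0" using r'(3) x(3) by blast
    moreover have "\<tau> z0 = t0" using g(7)[of z0 t0] g(1,2) 0 by simp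
    ultimately show ?thesis using x(1) t by simp
  qed
  have op: "open (ball t0 s \<times> ball z0 r')" by (intro open_Times open_ball)
  have mem: "(t0, z0) \<in> ball t0 s \<times> ball z0 r'" using g(2) r'(1) by simp
  show ?thesis
  proof
    assume "(t0, z0) islimpt ?S"
    from islimptE[OF this mem op] obtain x where "x \<in> ?S" "x \<in> ball t0 s \<times> ball z0 r'" "x \<noteq> (t0, z0)" .
    then show False using only[of x] by simp
  qed
qed

text \<open>If \<open>z\<close> were large against \<open>w\<close>, dividing by \<open>z\<close>
  would move the point into a neighbourhood of \<open>q\<close> of radius \<open>\<eta>\<close>,
  where \<open>h\<close> has no zero; so \<open>M\<close> is \<open>1 / \<eta>\<close>.\<close>

lemma root_bound:
  obtains M where "M > 0" "\<And>w z. eval3 h (w + z *s q) = 0 \<Longrightarrow> norm z \<le> M * norm w"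
proof -
  have "\<exists>\<eta>>0. \<forall>x. dist x q < \<eta> \<longrightarrow> dist (eval3 h x) (eval3 h q) < norm (eval3 h q)"
    using continuous_on_eval3[of UNIV h] q unfolding continuous_on_iff by (metis UNIV_I zero_less_norm_iff)
  then obtain \<eta> where \<eta>: "\<eta> > 0" "\<And>x. dist x q < \<eta> \<Longrightarrow> dist (eval3 h x) (eval3 h q) < norm (eval3 h q)"
    by blast
  have "norm z \<le> 1 / \<eta> * norm w" if "eval3 h (w + z *s q) = 0" for w z
  proof (rule ccontr)
    assume "\<not> ?thesis"
    then have less: "norm w < \<eta> * norm z" using \<eta>(1) by (simp add: field_simps)
    then have z: "z \<noteq> 0" by auto
    have eq: "w + z *s q = z *s (inverse z *s w + q)" using z by (simp add: vec_eq_iff algebra_simps)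
    have "dist (inverse z *s w + q) q = norm w / norm z"
      using z by (simp add: dist_norm norm_scale_vec norm_inverse divide_inverse)
    also have "\<dots> < \<eta>" using less z by (simp add: field_simps)
    finally have "eval3 h (inverse z *s w + q) \<noteq> 0" using \<eta>(2) by force
    then show False using that z unfolding eq homogeneous by simp
  qed
  then show ?thesis using that[of "1 / \<eta>"] \<eta>(1) by simp
qed

text \<open>Over a bounded disc of parameters \<open>root_bound\<close> confines the critical points
  to a compact set; being without accumulation points they are finite in number.\<close>

lemma finite_bad: "finite ({t. \<not> good t} \<inter> cball 0 r)"
proof -
  obtain M where M: "M > 0" "\<And>w z. eval3 h (w + z *s q) = 0 \<Longrightarrow> norm z \<le> M * norm w"
    by (rule root_bound) (rule that)
  define R where "R = M * (norm u + r * norm v)"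
  define S where "S = {(t, z). z \<in> roots t \<and> Dz t z = 0}"
  define K where "K = S \<inter> (cball 0 r \<times> cball 0 R)"
  have "closed {x. eval3 h (pt (fst x) (snd x)) = 0}" "closed {x. Dz (fst x) (snd x) = 0}"
    by (intro closed_Collect_eq continuous_on_compose2[OF continuous_on_eval3[of UNIV]] continuous_pt
        continuous_Dz continuous_intros; simp)+
  then have "closed ({x. eval3 h (pt (fst x) (snd x)) = 0} \<inter> {x. Dz (fst x) (snd x) = 0})"
    by (rule closed_Int)
  also have "\<dots> = S" by (auto simp: S_def roots_def)
  finally have comp: "compact K"
    unfolding K_def by (intro closed_Int_compact compact_Times compact_cball)
  have "finite K"
  proof (rule ccontr)
    assume "infinite K"
    then obtain x where "x \<in> K" "x islimpt K"
      using comp unfolding compact_eq_Bolzano_Weierstrass by blast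
    moreover obtain t z where "x = (t, z)" by (cases x)
    ultimately have "(t, z) \<in> S" "(t, z) islimpt S"
      using islimpt_subset[of x K S] by (auto simp: K_def)
    then show False using not_islimpt_critical unfolding S_def by blast
  qed
  moreover have "{t. \<not> good t} \<inter> cball 0 r \<subseteq> fst ` K"
  proof
    fix t assume t: "t \<in> {t. \<not> good t} \<inter> cball 0 r"
    then obtain z where z: "z \<in> roots t" "Dz t z = 0" by (auto simp: good_def)
    have "norm z \<le> M * norm (u + t *s v)" using M(2) z(1) by (simp add: roots_def pt_def)
    also have "norm (u + t *s v) \<le> norm u + norm t * norm v"
      using norm_triangle_ineq[of u "t *s v"] by (simp add: norm_scale_vec)
    also have "norm t * norm v \<le> r * norm v" using t by (intro mult_right_mono) auto
    finally have "z \<in> cball 0 R" using M(1) by (simp add: R_def)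
    then have "(t, z) \<in> K" using z t by (simp add: K_def S_def)
    then show "t \<in> fst ` K" by force
  qed
  ultimately show ?thesis by (meson finite_imageI finite_subset)
qed

lemma countable_bad: "countable {t. \<not> good t}"
proof -
  have "{t. \<not> good t} = (\<Union>n::nat. {t. \<not> good t} \<inter> cball 0 (real n))"
    using real_arch_simple by (auto simp: dist_norm)
  moreover have "countable (\<Union>n::nat. {t. \<not> good t} \<inter> cball 0 (real n))"
    by (intro countable_UN countableI_type countable_finite finite_bad)
  ultimately show ?thesis by simp
qed

lemma connected_good: "connected {t. good t}"
proof -
  have "path_connected (- {t. \<not> good t})"
    by (rule path_connected_complement_countable[OF _ countable_bad]) simp
  then show ?thesis using path_connected_imp_connected by (simp add: Compl_eq)
qed

lemma good_exists: "r > 0 \<Longrightarrow> \<exists>t\<in>ball c r. good t"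
proof (rule ccontr)
  assume "r > 0" "\<not> (\<exists>t\<in>ball c r. good t)"
  then have "ball c r \<subseteq> {t. \<not> good t}" by blast
  then show False using countable_bad countable_subset uncountable_ball[OF \<open>r > 0\<close>] by blast
qed

text \<open>The derivative of the restricted polynomial is \<open>Dz\<close>, so over a good
  parameter all its roots are simple and their number is the degree.\<close>

lemma card_roots_good:
  assumes "good t"
  shows "card (roots t) = d"
proof -
  obtain p where p: "\<And>z. poly p z = eval3 h (u + t *s v + z *s q)" "degree p = d" "lead_coeff p = eval3 h q"
    by (rule restriction_poly[of "u + t *s v"]) (rule that)
  have roots: "roots t = {z. poly p z = 0}" by (simp add: roots_def p(1) pt_def)
  have poly: "poly p = (\<lambda>z. eval3 h (u + t *s v + z *s q))" using p(1) by (rule ext)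
  have "poly (pderiv p) z = Dz t z" for z
  proof -
    have "((\<lambda>z. (t, z)) has_derivative (\<lambda>w. (0, w))) (at z)"
      by (auto intro!: derivative_eq_intros)
    from has_derivative_compose[OF this curve_has_derivative]
    have "(poly p has_field_derivative Dz t z) (at z)"
      unfolding has_field_derivative_def poly by (simp add: pt_def)
    with poly_DERIV show ?thesis by (rule DERIV_unique)
  qed
  then have "rsquarefree p"
    using assms unfolding rsquarefree_roots good_def roots by auto
  from arg_cong[OF complex_poly_decompose_rsquarefree[OF this, symmetric], of degree]
  have "degree p = degree (smult (lead_coeff p) (\<Prod>z\<in>roots t. [:-z, 1:]))"
    unfolding roots .
  also have "\<dots> = card (roots t)"
    using q by (simp add: p(3) degree_prod_sum_eq)
  finally show ?thesis using p(2) by simp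
qed

end

section \<open>A separation of the curve and the resultant of its two parts\<close>

locale disconnected_plane_curve = plane_curve_projection +
  fixes A B OA OB :: "(complex ^ 3) set"
  assumes cover: "A \<union> B = zeros" and disjoint: "A \<inter> B = {}"
    and A_open: "open OA" "A = zeros \<inter> OA" and B_open: "open OB" "B = zeros \<inter> OB"
    and A_scale: "\<And>l y. l \<noteq> 0 \<Longrightarrow> y \<in> A \<Longrightarrow> l *s y \<in> A"
    and B_scale: "\<And>l y. l \<noteq> 0 \<Longrightarrow> y \<in> B \<Longrightarrow> l *s y \<in> B"
    and A_nonempty: "A \<noteq> {}" and B_nonempty: "B \<noteq> {}"
begin

definition "A_roots t = {z. pt t z \<in> A}"
definition "B_roots t = {z. pt t z \<in> B}"

text \<open>
  This is the resultant of the two factors of the restriction of the curve to a line through \<open>q\<close>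
  which correspond to \<open>A\<close> and \<open>B\<close>.
\<close>

definition "resultant t = (\<Prod>\<alpha>\<in>A_roots t. \<Prod>\<beta>\<in>B_roots t. \<alpha> - \<beta>)"

lemma roots_split: "roots t = A_roots t \<union> B_roots t" "A_roots t \<inter> B_roots t = {}"
proof -
  have "z \<in> roots t \<longleftrightarrow> z \<in> A_roots t \<union> B_roots t" for z
    unfolding pt_zeros_iff[symmetric] cover[symmetric] by (simp add: A_roots_def B_roots_def)
  then show "roots t = A_roots t \<union> B_roots t" by blast
  show "A_roots t \<inter> B_roots t = {}" using disjoint by (auto simp: A_roots_def B_roots_def)
qed

lemma finite_A_roots: "finite (A_roots t)" and finite_B_roots: "finite (B_roots t)"
  using finite_roots[of t] by (simp_all add: roots_split(1))

lemma resultant_nonzero: "resultant t \<noteq> 0"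
  using roots_split(2)[of t] finite_A_roots[of t] finite_B_roots[of t]
  by (auto simp: resultant_def)

text \<open>On the cone the two parts are cut out by open sets without a common zero of
  \<open>h\<close>, so a connected family of zeros cannot change sides.\<close>

lemma zeros_path_stays:
  assumes c: "continuous_on S c" "connected S" "c ` S \<subseteq> zeros" and s: "s0 \<in> S" "s \<in> S"
  shows "c s0 \<in> A \<Longrightarrow> c s \<in> A" and "c s0 \<in> B \<Longrightarrow> c s \<in> B"
proof -
  have conn: "connected (c ` S)" using c by (intro connected_continuous_image)
  have "OA \<inter> OB \<inter> c ` S = {}" using c(3) disjoint A_open(2) B_open(2) by blast
  moreover have "c ` S \<subseteq> OA \<union> OB" using c(3) cover A_open(2) B_open(2) by blast
  ultimately have "OA \<inter> c ` S = {} \<or> OB \<inter> c ` S = {}"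
    using connectedD[OF conn A_open(1) B_open(1)] by blast
  moreover have "c s0 \<in> c ` S" "c s \<in> c ` S" "c s0 \<in> zeros" "c s \<in> zeros" using s c(3) by blast+
  ultimately show "c s0 \<in> A \<Longrightarrow> c s \<in> A" "c s0 \<in> B \<Longrightarrow> c s \<in> B"
    using A_open(2) B_open(2) cover by blast+
qed

lemma roots_separated:
  obtains e where "e > 0" "\<And>z w. z \<in> roots t \<Longrightarrow> w \<in> roots t \<Longrightarrow> z \<noteq> w \<Longrightarrow> e \<le> dist z w"
proof -
  \<comment> \<open>The element 1 keeps the set nonempty, so that \<open>Min\<close> is meaningful
    even with fewer than two roots.\<close>
  define D where "D = insert 1 ((\<lambda>(z, w). dist z w) ` (roots t \<times> roots t - Id))"
  have fin: "finite D" unfolding D_def using finite_roots[of t] by simp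
  have "Min D \<in> D" using fin by (intro Min_in) (auto simp: D_def)
  then have "Min D > 0" by (auto simp: D_def)
  moreover have "Min D \<le> dist z w" if "z \<in> roots t" "w \<in> roots t" "z \<noteq> w" for z w
    using that fin by (intro Min_le) (auto simp: D_def)
  ultimately show ?thesis by (rule that)
qed

text \<open>Each simple root continues holomorphically. The continuations move by less than half the
  least distance between roots and so stay distinct, and each remains on its side of the separation
  because its path is connected.\<close>

lemma local_roots:
  assumes "good t0"
  obtains g r where "r > 0" "\<And>z. z \<in> roots t0 \<Longrightarrow> g z holomorphic_on ball t0 r"
    "\<And>t. t \<in> ball t0 r \<Longrightarrow> inj_on (\<lambda>z. g z t) (roots t0)"
    "\<And>t. t \<in> ball t0 r \<Longrightarrow> A_roots t = (\<lambda>z. g z t) ` A_roots t0"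
    "\<And>t. t \<in> ball t0 r \<Longrightarrow> B_roots t = (\<lambda>z. g z t) ` B_roots t0"
proof -
  obtain e where e: "e > 0" "\<And>z w. z \<in> roots t0 \<Longrightarrow> w \<in> roots t0 \<Longrightarrow> z \<noteq> w \<Longrightarrow> e \<le> dist z w"
    by (rule roots_separated) (rule that)
  define P where "P = (\<lambda>z (g, r). r > 0 \<and> g holomorphic_on ball t0 r \<and> g t0 = z \<and>
    (\<forall>t\<in>ball t0 r. g t \<in> roots t \<and> dist (g t) z < e / 2))"
  have "\<exists>gr. P z gr" if z: "z \<in> roots t0" for z
  proof (rule implicit_roots[of z t0 "e / 2"])
    show "Dz t0 z \<noteq> 0" using assms z unfolding good_def by blast
    fix g r
    assume "r > 0" "g holomorphic_on ball t0 r" "g t0 = z"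
      "\<And>t. t \<in> ball t0 r \<Longrightarrow> g t \<in> roots t \<and> dist (g t) z < e / 2"
    then have "P z (g, r)" unfolding P_def by simp
    then show ?thesis by (rule exI)
  qed (use z e(1) in auto)
  then have "\<forall>z\<in>roots t0. \<exists>gr. P z gr" by blast
  from bchoice[OF this] obtain G where G: "\<forall>z\<in>roots t0. P z (G z)" ..
  define g where "g = (\<lambda>z. fst (G z))"
  define r where "r = Min (insert 1 ((\<lambda>z. snd (G z)) ` roots t0))"
  have Pz: "P z (g z, snd (G z))" if "z \<in> roots t0" for z using G that by (simp add: g_def)
  have r: "r \<le> snd (G z)" if "z \<in> roots t0" for z
    unfolding r_def using that finite_roots[of t0] by (intro Min_le) auto
  have r0: "r > 0"
  proof -
    have "r \<in> insert 1 ((\<lambda>z. snd (G z)) ` roots t0)"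
      unfolding r_def using finite_roots[of t0] by (intro Min_in) auto
    then consider "r = 1" | z where "r = snd (G z)" "z \<in> roots t0" by blast
    then show ?thesis
    proof cases
      case (2 z)
      then show ?thesis using Pz[OF 2(2)] by (simp add: P_def)
    qed simp
  qed
  have sub: "ball t0 r \<subseteq> ball t0 (snd (G z))" if "z \<in> roots t0" for z
    using r[OF that] by (rule subset_ball)
  have hol: "g z holomorphic_on ball t0 r" if "z \<in> roots t0" for z
  proof -
    have "g z holomorphic_on ball t0 (snd (G z))" using Pz[OF that] by (simp add: P_def)
    then show ?thesis using sub[OF that] by (rule holomorphic_on_subset)
  qed
  have g0: "g z t0 = z" if "z \<in> roots t0" for z using Pz[OF that] by (simp add: P_def)
  have gt: "g z t \<in> roots t" "dist (g z t) z < e / 2" if "z \<in> roots t0" "t \<in> ball t0 r" for z t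
  proof -
    have "t \<in> ball t0 (snd (G z))" using sub[OF that(1)] that(2) by (rule subsetD)
    then show "g z t \<in> roots t" "dist (g z t) z < e / 2" using Pz[OF that(1)] by (simp_all add: P_def)
  qed
  have inj: "inj_on (\<lambda>z. g z t) (roots t0)" if t: "t \<in> ball t0 r" for t
  proof (rule inj_onI, rule ccontr)
    fix z w assume zw: "z \<in> roots t0" "w \<in> roots t0" "g z t = g w t" "z \<noteq> w"
    have "dist z w \<le> dist (g z t) z + dist (g w t) w"
      using dist_triangle3[of z w "g z t"] zw(3) by (simp add: dist_commute)
    also have "\<dots> < e" using gt(2)[OF zw(1) t] gt(2)[OF zw(2) t] by simp
    finally show False using e(2)[OF zw(1,2,4)] by simp
  qed
  \<comment> \<open>\<open>d\<close> distinct continuations exhaust the fibre, as it never has more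
    than \<open>d\<close> points. In particular no new root can appear on either side.\<close>
  have roots: "roots t = (\<lambda>z. g z t) ` roots t0" if t: "t \<in> ball t0 r" for t
  proof (rule card_subset_eq[symmetric])
    show "finite (roots t)" by (rule finite_roots)
    show "(\<lambda>z. g z t) ` roots t0 \<subseteq> roots t" using gt(1)[OF _ t] by (rule image_subsetI)
    have "card ((\<lambda>z. g z t) ` roots t0) = d"
      using card_image[OF inj[OF t]] card_roots_good[OF assms] by simp
    then show "card ((\<lambda>z. g z t) ` roots t0) = card (roots t)"
      using card_roots_le[of t] card_mono[OF finite_roots \<open>_ \<subseteq> roots t\<close>] by simp
  qed
  have stay: "pt t0 z \<in> A \<Longrightarrow> pt t (g z t) \<in> A" "pt t0 z \<in> B \<Longrightarrow> pt t (g z t) \<in> B"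
    if "z \<in> roots t0" "t \<in> ball t0 r" for z t
  proof -
    have c: "continuous_on (ball t0 r) (\<lambda>t. pt t (g z t))"
      using hol[OF that(1)] by (intro continuous_pt continuous_on_id holomorphic_on_imp_continuous_on)
    have im: "(\<lambda>t. pt t (g z t)) ` ball t0 r \<subseteq> zeros"
      using gt(1)[OF that(1)] by (intro image_subsetI) (simp only: pt_zeros_iff)
    have t0: "t0 \<in> ball t0 r" using r0 by simp
    show "pt t0 z \<in> A \<Longrightarrow> pt t (g z t) \<in> A" "pt t0 z \<in> B \<Longrightarrow> pt t (g z t) \<in> B"
      using zeros_path_stays[OF c connected_ball im t0 that(2)] g0[OF that(1)] by simp_all
  qed
  have subA: "(\<lambda>z. g z t) ` A_roots t0 \<subseteq> A_roots t" and subB: "(\<lambda>z. g z t) ` B_roots t0 \<subseteq> B_roots t"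
    if "t \<in> ball t0 r" for t
    using stay[OF _ that] by (auto simp: A_roots_def B_roots_def roots_split(1))
  have union: "A_roots t \<union> B_roots t = (\<lambda>z. g z t) ` A_roots t0 \<union> (\<lambda>z. g z t) ` B_roots t0"
    if "t \<in> ball t0 r" for t
    using roots[OF that] unfolding roots_split(1) by (simp add: image_Un)
  have sets: "X = X' \<and> Y = Y'" if "X' \<subseteq> X" "Y' \<subseteq> Y" "X \<union> Y = X' \<union> Y'" "X \<inter> Y = {}"
    for X X' Y Y' :: "complex set"
    using that by blast
  show ?thesis
  proof (rule that[OF r0 hol inj])
    fix t assume t: "t \<in> ball t0 r"
    show "A_roots t = (\<lambda>z. g z t) ` A_roots t0" "B_roots t = (\<lambda>z. g z t) ` B_roots t0"
      using sets[OF subA[OF t] subB[OF t] union[OF t] roots_split(2)] by simp_all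
  qed
qed

lemma card_A_roots_const:
  assumes "good t" "good t'"
  shows "card (A_roots t) = card (A_roots t')" "card (B_roots t) = card (B_roots t')"
proof -
  have loc: "\<forall>\<^sub>F t in at t0 within {t. good t}. card (A_roots t0) = card (A_roots t) \<and> card (B_roots t0) = card (B_roots t)"
    if "good t0" for t0
  proof (rule local_roots[OF that])
    fix g r
    assume r: "r > 0" and inj: "\<And>t. t \<in> ball t0 r \<Longrightarrow> inj_on (\<lambda>z. g z t) (roots t0)"
      and A: "\<And>t. t \<in> ball t0 r \<Longrightarrow> A_roots t = (\<lambda>z. g z t) ` A_roots t0"
      and B: "\<And>t. t \<in> ball t0 r \<Longrightarrow> B_roots t = (\<lambda>z. g z t) ` B_roots t0"
    have "card (A_roots t0) = card (A_roots t) \<and> card (B_roots t0) = card (B_roots t)" if "t \<in> ball t0 r" for t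
    proof -
      have "inj_on (\<lambda>z. g z t) (A_roots t0)" "inj_on (\<lambda>z. g z t) (B_roots t0)"
        by (rule inj_on_subset[OF inj[OF that]], simp add: roots_split(1))+
      then show ?thesis unfolding A[OF that] B[OF that] by (simp only: card_image simp_thms)
    qed
    moreover have "\<forall>\<^sub>F t in at t0 within {t. good t}. t \<in> ball t0 r"
      unfolding eventually_at using r by (intro exI[of _ r]) (simp_all add: dist_commute)
    ultimately show ?thesis by (rule eventually_mono[rotated])
  qed
  have good: "t \<in> {t. good t}" "t' \<in> {t. good t}" using assms by simp_all
  show "card (A_roots t) = card (A_roots t')"
  proof (rule connected_local_const[where f = "\<lambda>t. card (A_roots t)", OF connected_good good], intro ballI)
    fix t0 assume "t0 \<in> {t. good t}"
    then show "\<forall>\<^sub>F t in at t0 within {t. good t}. card (A_roots t0) = card (A_roots t)"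
      using loc[of t0] unfolding eventually_conj_iff mem_Collect_eq by blast
  qed
  show "card (B_roots t) = card (B_roots t')"
  proof (rule connected_local_const[where f = "\<lambda>t. card (B_roots t)", OF connected_good good], intro ballI)
    fix t0 assume "t0 \<in> {t. good t}"
    then show "\<forall>\<^sub>F t in at t0 within {t. good t}. card (B_roots t0) = card (B_roots t)"
      using loc[of t0] unfolding eventually_conj_iff mem_Collect_eq by blast
  qed
qed

text \<open>Local branches of the roots may be permuted along loops, but the product runs over the
  sets of roots and does not depend on a labelling; each local choice gives the same
  function.\<close>

lemma resultant_holomorphic: "resultant holomorphic_on {t. good t}"
proof -
  have "resultant field_differentiable (at t0)" if "good t0" for t0
  proof (rule local_roots[OF that])
    fix g r
    assume r: "r > 0" and hol: "\<And>z. z \<in> roots t0 \<Longrightarrow> g z holomorphic_on ball t0 r"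
      and inj: "\<And>t. t \<in> ball t0 r \<Longrightarrow> inj_on (\<lambda>z. g z t) (roots t0)"
      and A: "\<And>t. t \<in> ball t0 r \<Longrightarrow> A_roots t = (\<lambda>z. g z t) ` A_roots t0"
      and B: "\<And>t. t \<in> ball t0 r \<Longrightarrow> B_roots t = (\<lambda>z. g z t) ` B_roots t0"
    define R where "R = (\<lambda>t. \<Prod>\<alpha>\<in>A_roots t0. \<Prod>\<beta>\<in>B_roots t0. g \<alpha> t - g \<beta> t)"
    have "R holomorphic_on ball t0 r"
      unfolding R_def by (intro holomorphic_intros hol) (auto simp: roots_split(1))
    moreover have "R t = resultant t" if "t \<in> ball t0 r" for t
    proof -
      have "inj_on (\<lambda>z. g z t) (A_roots t0)" "inj_on (\<lambda>z. g z t) (B_roots t0)"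
        by (rule inj_on_subset[OF inj[OF that]], simp add: roots_split(1))+
      then show ?thesis
        unfolding resultant_def R_def A[OF that] B[OF that] by (simp add: prod.reindex)
    qed
    ultimately have "resultant holomorphic_on ball t0 r" by (rule holomorphic_transform)
    then show ?thesis using r by (simp add: holomorphic_on_imp_differentiable_at)
  qed
  then show ?thesis
    unfolding holomorphic_on_def by (simp add: field_differentiable_at_within)
qed

text \<open>After scaling \<open>(1, t)\<close> to unit length, every pair of roots from the two
  sides lies in a compact set on which their distance has a positive minimum
  \<open>\<delta>\<close>. Scaling back multiplies the distance by the length of
  \<open>(1, t)\<close>, which is at least \<open>max 1 (norm t)\<close>.\<close>

lemma roots_gap:
  obtains \<delta> where "\<delta> > 0" "\<And>t \<alpha> \<beta>. \<alpha> \<in> A_roots t \<Longrightarrow> \<beta> \<in> B_roots t \<Longrightarrow> \<delta> * max 1 (norm t) \<le> norm (\<alpha> - \<beta>)"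
proof -
  define W where "W = (\<lambda>(w :: complex \<times> complex) z. fst w *s u + snd w *s v + z *s q)"
  define f where "f = (\<lambda>x :: (complex \<times> complex) \<times> complex \<times> complex. norm (fst (snd x) - snd (snd x)))"
  \<comment> \<open>For a nonzero zero of \<open>h\<close>, avoiding the open set \<open>OB\<close>
    is the same as lying in \<open>A\<close>, and likewise for \<open>OA\<close> and
    \<open>B\<close>; this makes both memberships closed conditions. The unit sphere includes the
    directions with \<open>fst w = 0\<close>, which no \<open>t\<close> represents but which are
    needed for compactness.\<close>
  define K where "K = {x :: (complex \<times> complex) \<times> complex \<times> complex. norm (fst x) = 1 \<and>
    eval3 h (W (fst x) (fst (snd x))) = 0 \<and> eval3 h (W (fst x) (snd (snd x))) = 0 \<and>
    W (fst x) (fst (snd x)) \<notin> OB \<and> W (fst x) (snd (snd x)) \<notin> OA}"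
  have contW: "continuous_on UNIV (\<lambda>x :: (complex \<times> complex) \<times> complex \<times> complex. W (fst x) (fst (snd x)))"
    "continuous_on UNIV (\<lambda>x :: (complex \<times> complex) \<times> complex \<times> complex. W (fst x) (snd (snd x)))"
    unfolding W_def vector_scalar_mult_def by (intro continuous_intros)+
  have contH: "continuous_on UNIV (\<lambda>x :: (complex \<times> complex) \<times> complex \<times> complex. eval3 h (W (fst x) (fst (snd x))))"
    "continuous_on UNIV (\<lambda>x :: (complex \<times> complex) \<times> complex \<times> complex. eval3 h (W (fst x) (snd (snd x))))"
    by (rule continuous_on_compose2[OF continuous_on_eval3[of UNIV] contW(1)], simp)
      (rule continuous_on_compose2[OF continuous_on_eval3[of UNIV] contW(2)], simp)
  have closedK: "closed K"
  proof -
    have eq: "K = {x. norm (fst x) = 1} \<inter> {x. eval3 h (W (fst x) (fst (snd x))) = 0} \<inter>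
        {x. eval3 h (W (fst x) (snd (snd x))) = 0} \<inter>
        (\<lambda>x. W (fst x) (fst (snd x))) -` (- OB) \<inter> (\<lambda>x. W (fst x) (snd (snd x))) -` (- OA)"
      unfolding K_def by blast
    have "closed {x :: (complex \<times> complex) \<times> complex \<times> complex. norm (fst x) = 1}"
      by (intro closed_Collect_eq continuous_intros)
    then show ?thesis
      unfolding eq using A_open(1) B_open(1)
      by (intro closed_Int closed_Collect_eq closed_vimage contW contH continuous_on_const continuous_on_norm
          continuous_on_fst continuous_on_id) auto
  qed
  obtain M where M: "M > 0" "\<And>w z. eval3 h (w + z *s q) = 0 \<Longrightarrow> norm z \<le> M * norm w"
    by (rule root_bound) (rule that)
  define L where "L = M * (norm u + norm v)"
  have root_le: "norm z \<le> L" if "norm w = 1" "eval3 h (W w z) = 0" for w z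
  proof -
    have "norm z \<le> M * norm (fst w *s u + snd w *s v)" using M(2) that(2) unfolding W_def by blast
    also have "norm (fst w *s u + snd w *s v) \<le> norm (fst w) * norm u + norm (snd w) * norm v"
      using norm_triangle_ineq[of "fst w *s u" "snd w *s v"] by (simp add: norm_scale_vec)
    also have "\<dots> \<le> 1 * norm u + 1 * norm v"
      using norm_fst_le[of "fst w" "snd w"] norm_snd_le[of "snd w" "fst w"] that(1) by (intro add_mono mult_right_mono) auto
    finally show ?thesis using M(1) by (simp add: L_def)
  qed
  have "K \<subseteq> cball 0 1 \<times> cball 0 L \<times> cball 0 L"
    unfolding K_def using root_le by (auto simp: mem_Times_iff)
  moreover have "bounded (cball 0 1 \<times> cball 0 L \<times> cball 0 L :: ((complex \<times> complex) \<times> complex \<times> complex) set)"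
    by (intro bounded_Times bounded_cball)
  ultimately have compK: "compact K"
    using closedK bounded_subset compact_eq_bounded_closed by blast
  have Wnz: "W w z \<noteq> 0" if "norm w = 1" for w z
  proof
    assume "W w z = 0"
    then have "fst w = 0" "snd w = 0" using indep[of "fst w" "snd w" z] by (auto simp: W_def)
    then have "w = 0" by (simp add: prod_eq_iff)
    then show False using that by simp
  qed
  have KD: "W w \<alpha> \<in> A" "W w \<beta> \<in> B" if "(w, \<alpha>, \<beta>) \<in> K" for w \<alpha> \<beta>
  proof -
    have "W w \<alpha> \<in> zeros" "W w \<beta> \<in> zeros" "W w \<alpha> \<notin> OB" "W w \<beta> \<notin> OA"
      using that Wnz by (auto simp: K_def zeros_def)
    then show "W w \<alpha> \<in> A" "W w \<beta> \<in> B" using cover A_open(2) B_open(2) by blast+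
  qed
  have KI: "(w, \<alpha>, \<beta>) \<in> K" if "norm w = 1" "W w \<alpha> \<in> A" "W w \<beta> \<in> B" for w \<alpha> \<beta>
  proof -
    have "W w \<alpha> \<in> zeros" "W w \<beta> \<in> zeros" "W w \<alpha> \<notin> OB" "W w \<beta> \<notin> OA"
      using that(2,3) cover disjoint A_open(2) B_open(2) by blast+
    then show ?thesis using that(1) by (simp add: K_def zeros_def)
  qed
  have "\<exists>\<delta>>0. \<forall>x\<in>K. \<delta> \<le> f x"
  proof (cases "K = {}")
    case False
    have "continuous_on K f" unfolding f_def by (intro continuous_intros)
    from continuous_attains_inf[OF compK False this] obtain x where x: "x \<in> K" "\<forall>y\<in>K. f x \<le> f y" by blast
    obtain w \<alpha> \<beta> where w: "x = (w, \<alpha>, \<beta>)" by (cases x)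
    have "\<alpha> \<noteq> \<beta>" using KD[of w \<alpha> \<beta>] x(1) disjoint unfolding w by blast
    then have "f x > 0" by (simp add: f_def w)
    then show ?thesis using x(2) by blast
  qed (rule exI[of _ 1], simp)
  then obtain \<delta> where \<delta>: "\<delta> > 0" "\<forall>x\<in>K. \<delta> \<le> f x" by blast
  have "\<delta> * max 1 (norm t) \<le> norm (\<alpha> - \<beta>)" if ab: "\<alpha> \<in> A_roots t" "\<beta> \<in> B_roots t" for t \<alpha> \<beta>
  proof -
    define N where "N = norm (1 :: complex, t)"
    define c where "c = complex_of_real N"
    define w where "w = (1 / c, t / c)"
    have N: "N \<ge> 1" "N \<ge> norm t"
      using norm_fst_le[of "1 :: complex" t] norm_snd_le[of t "1 :: complex"] by (simp_all add: N_def)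
    have c: "c \<noteq> 0" "norm c = N" using N(1) by (auto simp: c_def)
    have "w = (1 / N) *\<^sub>R (1, t)"
      using N(1) by (simp add: w_def c_def scaleR_conv_of_real[where 'a = complex])
    then have "norm w = norm ((1 / N) *\<^sub>R (1 :: complex, t))" by (simp only:)
    also have "\<dots> = 1" unfolding norm_scaleR N_def[symmetric] using N(1) by simp
    finally have w1: "norm w = 1" .
    have scale: "W w (z / c) = (1 / c) *s pt t z" for z
      using c(1) by (simp add: W_def w_def pt_def vec_eq_iff add_divide_distrib)
    have "W w (\<alpha> / c) \<in> A" "W w (\<beta> / c) \<in> B"
      using ab A_scale[of "1 / c" "pt t \<alpha>"] B_scale[of "1 / c" "pt t \<beta>"] c(1)
      unfolding scale A_roots_def B_roots_def by simp_all
    with w1 have "(w, \<alpha> / c, \<beta> / c) \<in> K" by (rule KI)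
    then have "\<delta> \<le> norm (\<alpha> / c - \<beta> / c)" using \<delta>(2) by (auto simp: f_def)
    also have "\<dots> = norm (\<alpha> - \<beta>) / N" by (simp add: c(2) norm_divide flip: diff_divide_distrib)
    finally have "\<delta> * N \<le> norm (\<alpha> - \<beta>)" using N(1) by (simp add: field_simps)
    moreover have "\<delta> * max 1 (norm t) \<le> \<delta> * N" using N \<delta>(1) by (intro mult_left_mono) auto
    ultimately show ?thesis by simp
  qed
  with \<delta>(1) show ?thesis by (rule that)
qed

text \<open>The given point of \<open>Y\<close> may lie over a bad parameter or on the line through
  \<open>q\<close> and \<open>v\<close>. A small change of its first two coordinates avoids both;
  the root follows by continuity of roots and stays in the open set \<open>OY\<close>.\<close>

lemma nonempty_perturb:
  assumes Y: "Y = zeros \<inter> OY" "open OY" "Y \<noteq> {}" and scale: "\<And>l y. l \<noteq> 0 \<Longrightarrow> y \<in> Y \<Longrightarrow> l *s y \<in> Y"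
  obtains t z where "good t" "pt t z \<in> Y"
proof -
  obtain y where y: "y \<in> Y" using Y(3) by blast
  obtain s0 t0 z0 where y_eq: "y = s0 *s u + t0 *s v + z0 *s q" using span by blast
  define W where "W = (\<lambda>x :: complex \<times> complex \<times> complex. fst x *s u + fst (snd x) *s v + snd (snd x) *s q)"
  have contW: "continuous_on UNIV W"
    unfolding W_def vector_scalar_mult_def by (intro continuous_intros)
  have yz: "y \<in> OY" "y \<in> zeros" using y Y(1) by blast+
  have d0: "d > 0"
  proof (rule ccontr)
    assume "\<not> d > 0"
    then have c: "eval3 h x = eval3 h 0" for x using homogeneous[of 0 x] by simp
    show False using c[of q] c[of y] q yz(2) unfolding zeros_def by simp
  qed
  have "open (W -` OY)" using contW Y(2) by (rule open_vimage[rotated])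
  moreover have "(s0, t0, z0) \<in> W -` OY" using yz by (simp add: W_def y_eq)
  ultimately obtain e where e: "e > 0" "ball (s0, t0, z0) e \<subseteq> W -` OY"
    unfolding open_contains_ball by blast
  \<comment> \<open>By \<open>poly_root_near\<close>, a value below this bound at \<open>z0\<close>
    forces a root within \<open>e / 4\<close> of \<open>z0\<close>. The displacements of the three
    coordinates then add up to less than \<open>e\<close>.\<close>
  define \<epsilon> where "\<epsilon> = norm (eval3 h q) * (e / 4) ^ d"
  have \<epsilon>: "\<epsilon> > 0" using q e(1) by (simp add: \<epsilon>_def)
  have "continuous_on UNIV (\<lambda>x. eval3 h (W x))"
    by (rule continuous_on_compose2[OF continuous_on_eval3[of UNIV] contW]) simp
  moreover have "eval3 h (W (s0, t0, z0)) = 0" using yz(2) by (simp add: W_def y_eq zeros_def)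
  ultimately obtain \<eta> where \<eta>: "\<eta> > 0" "\<And>x. dist x (s0, t0, z0) < \<eta> \<Longrightarrow> norm (eval3 h (W x)) < \<epsilon>"
    using \<epsilon> unfolding continuous_on_iff by (metis UNIV_I dist_0_norm dist_commute)
  define r where "r = min (e / 4) (\<eta> / 4)"
  have r: "r > 0" "r \<le> e / 4" "r \<le> \<eta> / 4" using e \<eta> by (auto simp: r_def)
  obtain s where s: "s \<noteq> 0" "dist s s0 < r"
  proof (cases "s0 = 0")
    case True
    show ?thesis by (rule that[of "of_real (r / 2)"]) (use r(1) True in \<open>auto simp: dist_norm\<close>)
  qed (use r(1) that[of s0] in simp)
  \<comment> \<open>\<open>t'\<close> is the affine parameter \<open>t / s\<close>; its disc of
    radius \<open>r / norm s\<close> becomes the disc of radius \<open>r\<close> around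
    \<open>t0\<close> after multiplication by \<open>s\<close>.\<close>
  obtain t' where t': "t' \<in> ball (t0 / s) (r / norm s)" "good t'"
    using good_exists[of "r / norm s" "t0 / s"] r(1) s(1) by auto
  define t where "t = s * t'"
  have "dist t t0 = norm (s * (t0 / s - t'))"
    using s(1) by (simp add: t_def dist_norm right_diff_distrib norm_minus_commute)
  also have "\<dots> = norm s * dist (t0 / s) t'" by (simp add: norm_mult dist_norm)
  also have "\<dots> < norm s * (r / norm s)" using t'(1) s(1) by (intro mult_strict_left_mono) auto
  finally have tt: "dist t t0 < r" using s(1) by simp
  have d3: "dist (s, t, z) (s0, t0, z0) \<le> dist s s0 + (dist t t0 + dist z z0)" for z
    using sqrt_sum_squares_le_sum[of "dist s s0" "dist (t, z) (t0, z0)"]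
      sqrt_sum_squares_le_sum[of "dist t t0" "dist z z0"] by (simp add: dist_Pair_Pair)
  have "norm (eval3 h (W (s, t, z0))) < \<epsilon>"
    by (rule \<eta>(2), rule le_less_trans[OF d3]) (use s(2) tt r in simp)
  moreover obtain p where p: "\<And>z. poly p z = eval3 h (s *s u + t *s v + z *s q)" "degree p = d" "lead_coeff p = eval3 h q"
    by (rule restriction_poly[of "s *s u + t *s v"]) (rule that)
  ultimately have less: "norm (poly p z0) < norm (lead_coeff p) * (e / 4) ^ degree p"
    by (simp only: p(1,2,3) \<epsilon>_def W_def fst_conv snd_conv)
  have e4: "e / 4 > 0" using e(1) by simp
  obtain z where z: "poly p z = 0" "norm (z0 - z) < e / 4"
    by (rule poly_root_near[OF less e4]) (rule that)
  have "dist z z0 < e / 4" using z(2) by (simp add: dist_norm norm_minus_commute)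
  then have "dist (s, t, z) (s0, t0, z0) < e" using d3[of z] s(2) tt r by linarith
  then have "(s, t, z) \<in> ball (s0, t0, z0) e" unfolding mem_ball by (subst dist_commute)
  then have "W (s, t, z) \<in> OY" using e(2) by blast
  moreover have Wpt: "W (s, t, z) = s *s pt (t / s) (z / s)"
    using s(1) by (simp add: W_def pt_def vec_eq_iff algebra_simps)
  moreover have "W (s, t, z) \<in> zeros"
  proof -
    have "eval3 h (W (s, t, z)) = 0" using z(1) p(1) by (simp add: W_def)
    moreover have "W (s, t, z) \<noteq> 0"
      using indep[of s t z] s(1) by (auto simp: W_def)
    ultimately show ?thesis by (simp add: zeros_def)
  qed
  ultimately have "s *s pt (t / s) (z / s) \<in> Y" using Y(1) by simp
  then have "(1 / s) *s (s *s pt (t / s) (z / s)) \<in> Y"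
    by (rule scale[rotated]) (use s(1) in simp)
  moreover have "(1 / s) *s (s *s x) = x" for x :: "complex ^ 3" using s(1) by (simp add: vec_eq_iff)
  ultimately have "pt (t / s) (z / s) \<in> Y" by (simp only:)
  moreover have "good (t / s)" using t'(2) s(1) by (simp add: t_def)
  ultimately show ?thesis by (rule that[rotated])
qed

lemma not_disconnected: False
proof -
  define f where "f = (\<lambda>t. 1 / resultant t)"
  obtain \<delta> where \<delta>: "\<delta> > 0"
    "\<And>t \<alpha> \<beta>. \<alpha> \<in> A_roots t \<Longrightarrow> \<beta> \<in> B_roots t \<Longrightarrow> \<delta> * max 1 (norm t) \<le> norm (\<alpha> - \<beta>)"
    by (rule roots_gap) (rule that)
  obtain ta za where ta: "good ta" "pt ta za \<in> A"
    by (rule nonempty_perturb[OF A_open(2,1) A_nonempty A_scale]) (assumption | rule that)+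
  obtain tb zb where tb: "good tb" "pt tb zb \<in> B"
    by (rule nonempty_perturb[OF B_open(2,1) B_nonempty B_scale]) (assumption | rule that)+
  define a where "a = card (A_roots ta)"
  define b where "b = card (B_roots tb)"
  have "za \<in> A_roots ta" "zb \<in> B_roots tb" using ta tb by (simp_all add: A_roots_def B_roots_def)
  then have ab: "a > 0" "b > 0"
    using finite_A_roots finite_B_roots by (auto simp: a_def b_def card_gt_0_iff)
  \<comment> \<open>Both fibres keep their cardinalities \<open>a\<close> and \<open>b\<close> over
    all good parameters, and both are positive because neither part is empty; the exponent is thus
    fixed and nonzero, which makes the lower bound grow with \<open>t\<close>.\<close>
  have lower: "(\<delta> * max 1 (norm t)) ^ (a * b) \<le> norm (resultant t)" if t: "good t" for t
  proof -
    have card: "card (A_roots t) = a" "card (B_roots t) = b"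
      using card_A_roots_const(1)[OF t ta(1)] card_A_roots_const(2)[OF t tb(1)] by (simp_all add: a_def b_def)
    have nn: "0 \<le> \<delta> * max 1 (norm t)" using \<delta>(1) by simp
    have "(\<delta> * max 1 (norm t)) ^ (a * b) = (\<Prod>\<alpha>\<in>A_roots t. \<Prod>\<beta>\<in>B_roots t. \<delta> * max 1 (norm t))"
      by (simp add: card mult.commute[of a] power_mult)
    also have "\<dots> \<le> (\<Prod>\<alpha>\<in>A_roots t. \<Prod>\<beta>\<in>B_roots t. norm (\<alpha> - \<beta>))"
      using nn \<delta>(2) by (intro prod_mono conjI prod_nonneg) auto
    also have "\<dots> = norm (resultant t)" by (simp add: resultant_def prod_norm)
    finally show ?thesis .
  qed
  have bound: "norm (f t) \<le> 1 / (\<delta> * max 1 (norm t)) ^ (a * b)" if "good t" for t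
    using lower[OF that] \<delta>(1) by (simp add: f_def norm_divide frac_le)
  have bd: "norm (f t) \<le> 1 / \<delta> ^ (a * b)" if "t \<notin> {t. \<not> good t}" for t
  proof -
    have "\<delta> ^ (a * b) \<le> (\<delta> * max 1 (norm t)) ^ (a * b)" using \<delta>(1) by (intro power_mono) auto
    then have "1 / (\<delta> * max 1 (norm t)) ^ (a * b) \<le> 1 / \<delta> ^ (a * b)" using \<delta>(1) by (intro frac_le) auto
    then show ?thesis using bound[of t] that by simp
  qed
  have hol: "f holomorphic_on - {t. \<not> good t}"
  proof -
    have "- {t. \<not> good t} = {t. good t}" by blast
    then show ?thesis unfolding f_def using resultant_holomorphic resultant_nonzero
      by (auto intro!: holomorphic_intros)
  qed
  obtain c where c: "\<And>t. t \<notin> {t. \<not> good t} \<Longrightarrow> f t = c"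
  proof (rule bounded_holomorphic_off_discrete_const[OF finite_bad hol])
    show "norm (f t) \<le> 1 / \<delta> ^ (a * b)" if "t \<notin> {t. \<not> good t}" for t using that by (rule bd)
  qed (rule that)
  have "c \<noteq> 0" using c[of ta] ta(1) resultant_nonzero[of ta] by (auto simp: f_def)
  \<comment> \<open>The three terms ensure, for \<open>norm t > T\<close>, that the maximum is
    \<open>norm t\<close>, that \<open>X\<close> exceeds 1 and so is at most its power, and that
    \<open>X\<close> exceeds \<open>1 / norm c\<close>. The shift by 1 below leaves room to choose a
    good parameter in a unit disc.\<close>
  define T where "T = 1 + 1 / \<delta> + 1 / (\<delta> * norm c)"
  have pos: "1 / \<delta> > 0" "1 / (\<delta> * norm c) > 0" using \<delta>(1) \<open>c \<noteq> 0\<close> by simp_all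
  obtain t where t: "t \<in> ball (of_real (T + 1)) 1" "good t"
    using good_exists[OF zero_less_one, of "of_real (T + 1)"] by blast
  have "T > 0" using pos unfolding T_def by linarith
  then have "norm (of_real (T + 1) :: complex) = T + 1" unfolding norm_of_real by simp
  moreover have "norm (of_real (T + 1) - t) < 1" using t(1) unfolding mem_ball dist_norm .
  ultimately have "norm t > T"
    using norm_triangle_ineq2[of "of_real (T + 1)" t] by linarith
  then have t1: "norm t > 1" "norm t > 1 / \<delta>" "norm t > 1 / (\<delta> * norm c)"
    using pos unfolding T_def by linarith+
  define X where "X = \<delta> * max 1 (norm t)"
  have X: "X = \<delta> * norm t" using t1(1) by (simp add: X_def)
  have X1: "X > 1" using mult_strict_left_mono[OF t1(2) \<delta>(1)] \<delta>(1) by (simp add: X)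
  have "X > 1 / norm c" using mult_strict_left_mono[OF t1(3) \<delta>(1)] \<delta>(1) by (simp add: X)
  moreover have "X ^ 1 \<le> X ^ (a * b)"
    by (rule power_increasing) (use X1 ab in \<open>simp_all add: One_nat_def Suc_le_eq\<close>)
  ultimately have "X ^ (a * b) > 1 / norm c" by simp
  moreover have "X ^ (a * b) > 0" using X1 by simp
  ultimately have "1 / X ^ (a * b) < norm c"
    using \<open>c \<noteq> 0\<close> by (simp add: divide_less_eq mult.commute)
  then have "1 / (\<delta> * max 1 (norm t)) ^ (a * b) < norm c" unfolding X_def .
  then show False using bound[OF t(2)] c[of t] t(2) by simp
qed

end

context plane_curve
begin

lemma connected_space_surface: "connected_space surface"
proof (rule ccontr)
  assume "\<not> connected_space surface"
  then obtain E1 E2 where E: "openin surface E1" "openin surface E2" "pcurve h \<subseteq> E1 \<union> E2" "E1 \<inter> E2 = {}"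
    "E1 \<noteq> {}" "E2 \<noteq> {}"
    unfolding connected_space_def topspace_surface by blast
  define A where "A = {y \<in> zeros. pclass y \<in> E1}"
  define B where "B = {y \<in> zeros. pclass y \<in> E2}"
  obtain OA where OA: "open OA" "A = zeros \<inter> OA"
    using E(1) unfolding openin_surface_iff A_def openin_open by blast
  obtain OB where OB: "open OB" "B = zeros \<inter> OB"
    using E(2) unfolding openin_surface_iff B_def openin_open by blast
  \<comment> \<open>If \<open>h\<close> vanished away from the origin, its partial derivatives would
    vanish at the point with all coordinates 1, where changing a single coordinate never reaches the
    origin; this contradicts non-singularity.\<close>
  have "\<exists>q. q \<noteq> 0 \<and> eval3 h q \<noteq> 0"
  proof (rule ccontr)
    assume "\<not> ?thesis"
    then have z: "eval3 h q = 0" if "q \<noteq> 0" for q using that by blast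
    define p :: "complex ^ 3" where "p = (\<chi> i. 1)"
    have "partial3 i h p = 0" for i
    proof -
      have "eval3 h (\<chi> j. if j = i then t else p $ j) = 0" for t
      proof (rule z)
        have "(\<chi> j. if j = i then t else p $ j) $ (i + 1) = 1" by (simp add: p_def)
        then show "(\<chi> j. if j = i then t else p $ j) \<noteq> 0" by (metis zero_index zero_neq_one)
      qed
      then show ?thesis unfolding partial3_def by simp
    qed
    moreover have "p \<noteq> 0" by (simp add: p_def vec_eq_iff)
    ultimately show False using nonsing z unfolding nonsingular_def by blast
  qed
  then obtain q where q: "q \<noteq> 0" "eval3 h q \<noteq> 0" by blast
  then obtain i where i: "q $ i \<noteq> 0" by (auto simp: vec_eq_iff)
  have "{i, i + 1, i + 2} = (UNIV :: 3 set)"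
    using exhaust_3[of i] unfolding UNIV_3 by auto
  then obtain j k where ijk: "{i, j, k} = (UNIV :: 3 set)" by (rule that)
  note dist = distinct_indices[OF ijk]
  have vec: "x = y" if "x $ i = y $ i" "x $ j = y $ j" "x $ k = y $ k" for x y :: "complex ^ 3"
  proof -
    have "x $ l = y $ l" for l
    proof -
      have "l \<in> {i, j, k}" unfolding ijk by simp
      then show ?thesis using that by blast
    qed
    then show ?thesis unfolding vec_eq_iff by blast
  qed
  \<comment> \<open>Since \<open>q $ i\<close> is nonzero, \<open>q\<close> and the axes
    \<open>j\<close> and \<open>k\<close> form a basis; the coefficients of a vector are found by
    first solving for its coordinate \<open>i\<close>.\<close>
  interpret disconnected_plane_curve h d "axis j 1" "axis k 1" q A B OA OB
  proof
    show "eval3 h q \<noteq> 0" by (rule q(2))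
    show "\<exists>s t z. y = s *s axis j 1 + t *s axis k 1 + z *s q" for y
      by (rule exI[of _ "y $ j - y $ i / q $ i * q $ j"], rule exI[of _ "y $ k - y $ i / q $ i * q $ k"],
          rule exI[of _ "y $ i / q $ i"], rule vec) (use i dist in \<open>simp_all add: axis_def\<close>)
    show "s = 0 \<and> t = 0 \<and> z = 0" if 0: "s *s axis j 1 + t *s axis k 1 + z *s q = 0" for s t z
    proof -
      have comp: "(s *s axis j 1 + t *s axis k 1 + z *s q) $ l = 0" for l unfolding 0 by simp
      have "z = 0" using comp[of i] i dist by (simp add: axis_def)
      then show ?thesis using comp[of j] comp[of k] dist by (simp add: axis_def)
    qed
    show "A \<union> B = zeros" using E(3) pclass_in_pcurve_iff unfolding A_def B_def by blast
    show "A \<inter> B = {}" using E(4) unfolding A_def B_def by blast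
    show "open OA" "A = zeros \<inter> OA" "open OB" "B = zeros \<inter> OB" by fact+
    show "l *s y \<in> A" if "l \<noteq> 0" "y \<in> A" for l y
      using that pclass_scale[OF that(1)] zeros_scale[OF that(1)] by (simp add: A_def)
    show "l *s y \<in> B" if "l \<noteq> 0" "y \<in> B" for l y
      using that pclass_scale[OF that(1)] zeros_scale[OF that(1)] by (simp add: B_def)
    show "A \<noteq> {}" using E(1,5) unfolding openin_surface_iff pcurve_eq A_def by blast
    show "B \<noteq> {}" using E(2,6) unfolding openin_surface_iff pcurve_eq B_def by blast
  qed
  show False by (rule not_disconnected)
qed

theorem compact_riemann_surface: "compact_riemann_surface surface atlas"
  unfolding compact_riemann_surface_def riemann_surface_def
  using connected_space_surface Hausdorff_space_surface second_countable_surface complex_atlas_surface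
    compact_space_surface by blast

end

section \<open>Branched coverings in local coordinates\<close>

lemma finite_fibre_not_constant_on:
  assumes "open S" "S \<noteq> {}" "finite {w \<in> S. h w = h z}" "z \<in> S"
  shows "\<not> (h :: complex \<Rightarrow> complex) constant_on S"
proof
  assume "h constant_on S"
  then have "{w \<in> S. h w = h z} = S" using assms(4) unfolding constant_on_def by force
  then have "finite S" using assms(3) by simp
  then show False using finite_imp_not_open[of S] assms(1,2) by blast
qed

text \<open>The set \<open>S\<close> may be disconnected, so the open mapping theorem is applied on
  discs, where finite fibres exclude a constant function.\<close>

lemma open_image_finite_fibres:
  fixes h :: "complex \<Rightarrow> complex"
  assumes S: "open S" and h: "h holomorphic_on S" and fin: "\<And>z. z \<in> S \<Longrightarrow> finite {w \<in> S. h w = h z}"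
  shows "open (h ` S)"
  unfolding open_contains_ball
proof
  fix v assume "v \<in> h ` S"
  then obtain z where z: "z \<in> S" "v = h z" by blast
  obtain r where r: "r > 0" "ball z r \<subseteq> S" using S z(1) open_contains_ball by blast
  have hr: "h holomorphic_on ball z r" using h r(2) by (rule holomorphic_on_subset)
  have "\<not> h constant_on ball z r"
  proof (rule finite_fibre_not_constant_on)
    have "{w \<in> ball z r. h w = h z} \<subseteq> {w \<in> S. h w = h z}" using r(2) by blast
    then show "finite {w \<in> ball z r. h w = h z}" using fin[OF z(1)] by (rule finite_subset)
  qed (use r(1) in auto)
  then have "open (h ` ball z r)"
    by (intro open_mapping_thm[OF hr open_ball connected_ball open_ball subset_refl])
  moreover have "v \<in> h ` ball z r" unfolding z(2) using r(1) by simp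
  ultimately obtain e where "e > 0" "ball v e \<subseteq> h ` ball z r" unfolding open_contains_ball by blast
  then show "\<exists>e>0. ball v e \<subseteq> h ` S" using image_mono[OF r(2), of h] by blast
qed

text \<open>Where the derivative of \<open>h\<close> is nonzero, a local inverse exhibits
  \<open>T\<close> as \<open>k\<close> after that inverse. Critical points are isolated, and at the
  remaining value \<open>h z0\<close> continuity of \<open>T\<close> removes the
  singularity.\<close>

lemma holomorphic_factor:
  fixes h k T :: "complex \<Rightarrow> complex"
  assumes S: "open S" and h: "h holomorphic_on S" and k: "k holomorphic_on S"
    and fin: "\<And>z. z \<in> S \<Longrightarrow> finite {w \<in> S. h w = h z}"
    and T: "continuous_on (h ` S) T" and eq: "\<And>z. z \<in> S \<Longrightarrow> T (h z) = k z"
  shows "T holomorphic_on (h ` S)"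
proof -
  have "T field_differentiable at (h z0)" if z0: "z0 \<in> S" for z0
  proof -
    obtain r0 where r0: "r0 > 0" "ball z0 r0 \<subseteq> S" using S z0 open_contains_ball by blast
    have nonconst: "\<not> h constant_on ball z0 r" if "r > 0" "r \<le> r0" for r
    proof (rule finite_fibre_not_constant_on)
      have "ball z0 r \<subseteq> S" using subset_ball[OF that(2)] r0(2) by (rule subset_trans)
      then have "{w \<in> ball z0 r. h w = h z0} \<subseteq> {w \<in> S. h w = h z0}" by blast
      then show "finite {w \<in> ball z0 r. h w = h z0}" using fin[OF z0] by (rule finite_subset)
    qed (use that(1) in auto)
    have h0: "h holomorphic_on ball z0 r0" using h r0(2) by (rule holomorphic_on_subset)
    have dh0: "deriv h holomorphic_on ball z0 r0" by (rule holomorphic_deriv[OF h0 open_ball])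
    have "\<exists>w\<in>ball z0 r0. deriv h w \<noteq> 0"
    proof (rule ccontr)
      assume "\<not> ?thesis"
      then have d0: "deriv h w = 0" if "w \<in> ball z0 r0" for w using that by blast
      have "(h has_field_derivative 0) (at w)" if "w \<in> ball z0 r0" for w
        using holomorphic_derivI[OF h0 open_ball that] unfolding d0[OF that] .
      from has_field_derivative_0_imp_constant_on[OF this connected_ball open_ball]
      show False using nonconst[of r0] r0(1) by simp
    qed
    then obtain w0 where w0: "w0 \<in> ball z0 r0" "deriv h w0 \<noteq> 0" by blast
    have "\<exists>r>0. r \<le> r0 \<and> (\<forall>z\<in>ball z0 r - {z0}. deriv h z \<noteq> 0)"
    proof (cases "deriv h z0 = 0")
      case True
      obtain r where r: "0 < r" "ball z0 r \<subseteq> ball z0 r0" "\<And>z. z \<in> ball z0 r - {z0} \<Longrightarrow> deriv h z \<noteq> 0"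
      proof (rule isolated_zeros[OF dh0 open_ball connected_ball _ True w0])
        show "z0 \<in> ball z0 r0" using r0(1) by simp
      qed (rule that)
      have "ball z0 (min r r0) \<subseteq> ball z0 r" by (rule subset_ball) simp
      then show ?thesis using r(1,3) r0(1) by (intro exI[of _ "min r r0"]) auto
    next
      case False
      have "isCont (deriv h) z0"
        using holomorphic_on_imp_continuous_on[OF dh0] r0(1) continuous_on_eq_continuous_at[OF open_ball]
        by (metis centre_in_ball)
      then obtain r where r: "r > 0" "\<forall>z. dist z0 z < r \<longrightarrow> deriv h z \<noteq> 0"
        using continuous_at_avoid[of z0 "deriv h" 0] False by blast
      then show ?thesis using r0(1) by (intro exI[of _ "min r r0"]) auto
    qed
    then obtain r where r: "r > 0" "r \<le> r0" "\<And>z. z \<in> ball z0 r - {z0} \<Longrightarrow> deriv h z \<noteq> 0" by blast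
    have sub: "ball z0 r \<subseteq> S" using subset_ball[OF r(2)] r0(2) by (rule subset_trans)
    have hr: "h holomorphic_on ball z0 r" using h sub by (rule holomorphic_on_subset)
    define N where "N = h ` ball z0 r"
    have N: "open N"
      unfolding N_def
      by (rule open_mapping_thm[OF hr open_ball connected_ball open_ball subset_refl nonconst[OF r(1,2)]])
    \<comment> \<open>A value of \<open>h\<close> on the disc other than \<open>h z0\<close> is
      attained away from \<open>z0\<close>, hence at a point where \<open>h\<close> is locally
      invertible.\<close>
    have "T field_differentiable at v" if v: "v \<in> N - {h z0}" for v
    proof -
      obtain z where z: "z \<in> ball z0 r" "v = h z" using v unfolding N_def by blast
      then have "deriv h z \<noteq> 0" using r(3)[of z] v by blast
      then obtain e where e: "e > 0" "ball z e \<subseteq> ball z0 r" "open (h ` ball z e)" "inj_on h (ball z e)"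
        using has_complex_derivative_locally_invertible[OF hr z(1) open_ball] by blast
      have he: "h holomorphic_on ball z e" using hr e(2) by (rule holomorphic_on_subset)
      obtain g where g: "g holomorphic_on h ` ball z e" "\<And>x. x \<in> ball z e \<Longrightarrow> g (h x) = x"
        by (rule holomorphic_has_inverse[OF he open_ball e(4)]) (rule that)
      have "ball z e \<subseteq> S" using e(2) sub by (rule subset_trans)
      then have "k holomorphic_on ball z e" using k holomorphic_on_subset by blast
      moreover have "g ` h ` ball z e \<subseteq> ball z e" using g(2) by auto
      ultimately have "(k \<circ> g) holomorphic_on h ` ball z e"
        using g(1) by (intro holomorphic_on_compose_gen[of _ _ _ "ball z e"]) auto
      then have "T holomorphic_on h ` ball z e"
      proof (rule holomorphic_transform)
        fix y assume "y \<in> h ` ball z e"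
        then obtain x where x: "x \<in> ball z e" "y = h x" by blast
        then have "x \<in> S" using \<open>ball z e \<subseteq> S\<close> by blast
        then show "(k \<circ> g) y = T y" using eq g(2)[OF x(1)] by (simp add: x(2))
      qed
      moreover have "v \<in> h ` ball z e" unfolding z(2) using e(1) by simp
      ultimately show ?thesis using e(3) holomorphic_on_imp_differentiable_at by blast
    qed
    then have "T holomorphic_on N - {h z0}"
      unfolding holomorphic_on_def by (simp add: field_differentiable_at_within)
    moreover have "continuous_on N T"
      using T by (rule continuous_on_subset) (use sub in \<open>auto simp: N_def\<close>)
    ultimately have "T holomorphic_on N" by (intro no_isolated_singularity[OF _ _ N]) auto
    moreover have "h z0 \<in> N" unfolding N_def using r(1) by simp
    ultimately show ?thesis using N holomorphic_on_imp_differentiable_at by blast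
  qed
  then show ?thesis
    unfolding holomorphic_on_def by (auto intro: field_differentiable_at_within)
qed

text \<open>An injective holomorphic function has nonzero derivative, so its difference quotient
  \<open>T1\<close> is holomorphic and nonzero at \<open>v0\<close>. Substituting the power
  therefore gives \<open>(z - z0) ^ n\<close> times a function that does not vanish at
  \<open>z0\<close>.\<close>

lemma zorder_injective_comp_power:
  fixes T :: "complex \<Rightarrow> complex"
  assumes T: "T holomorphic_on V" "open V" "inj_on T V" and v0: "v0 \<in> V" and "c \<noteq> 0" "n > 0"
    and "open S" "z0 \<in> S"
    and h: "\<And>z. z \<in> S \<Longrightarrow> v0 + c * (z - z0) ^ n \<in> V"
    and f: "\<And>z. z \<in> S \<Longrightarrow> f z = T (v0 + c * (z - z0) ^ n) - T v0"
  shows "zorder f z0 = int n"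
proof -
  define T1 where "T1 = (\<lambda>v. if v = v0 then deriv T v0 else (T v - T v0) / (v - v0))"
  define g where "g = (\<lambda>z. c * T1 (v0 + c * (z - z0) ^ n))"
  have T1: "T1 holomorphic_on V" unfolding T1_def by (rule pole_lemma_open[OF T(1,2)])
  have nz: "deriv T v0 \<noteq> 0" by (rule holomorphic_injective_imp_regular[OF T v0])
  have "(T1 \<circ> (\<lambda>z. v0 + c * (z - z0) ^ n)) holomorphic_on S"
    by (intro holomorphic_on_compose_gen[OF _ T1] holomorphic_intros) (use h in auto)
  then have "g holomorphic_on S" unfolding g_def by (intro holomorphic_intros) (simp add: o_def)
  moreover have "g z0 \<noteq> 0" using assms(5,6) nz by (simp add: g_def T1_def)
  moreover have "f w = g w * (w - z0) powi int n" if "w \<in> S" "w \<noteq> z0" for w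
    using that assms(5) f[OF that(1)] by (simp add: g_def T1_def power_int_of_nat)
  ultimately show ?thesis using assms(7,8) by (intro zorder_eqI[of S z0 g])
qed

lemma complex_chart_transport:
  assumes F: "homeomorphic_map Z Y F" and V: "V \<subseteq> topspace Y"
  shows "complex_chart Z {q \<in> topspace Z. F q \<in> V} (\<psi> \<circ> F) \<longleftrightarrow> complex_chart Y V \<psi>"
proof -
  define W where "W = {q \<in> topspace Z. F q \<in> V}"
  have im: "F ` W = V"
  proof (rule equalityI)
    show "V \<subseteq> F ` W"
    proof
      fix v assume v: "v \<in> V"
      then have "v \<in> F ` topspace Z" using V homeomorphic_imp_surjective_map[OF F] by blast
      then obtain q where "q \<in> topspace Z" "v = F q" by blast
      then show "v \<in> F ` W" using v unfolding W_def by blast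
    qed
  qed (auto simp: W_def)
  have open_iff: "openin Z W \<longleftrightarrow> openin Y V"
    using homeomorphic_map_openness[OF F, of W] im unfolding W_def by auto
  have sub: "homeomorphic_map (subtopology Z W) (subtopology Y V) F"
    using V by (intro homeomorphic_map_subtopologies_alt[OF F]) (auto simp: W_def)
  have img: "(\<psi> \<circ> F) ` W = \<psi> ` V" unfolding im[symmetric] by (simp add: image_comp)
  have "homeomorphic_map (subtopology Z W) (top_of_set (\<psi> ` V)) (\<psi> \<circ> F) \<longleftrightarrow>
      homeomorphic_map (subtopology Y V) (top_of_set (\<psi> ` V)) \<psi>"
  proof
    assume h: "homeomorphic_map (subtopology Z W) (top_of_set (\<psi> ` V)) (\<psi> \<circ> F)"
    obtain G where G: "homeomorphic_maps (subtopology Z W) (subtopology Y V) F G"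
      using sub homeomorphic_map_maps by blast
    have "homeomorphic_map (subtopology Y V) (subtopology Z W) G"
      using G homeomorphic_maps_map by blast
    from homeomorphic_map_compose[OF this h]
    have "homeomorphic_map (subtopology Y V) (top_of_set (\<psi> ` V)) ((\<psi> \<circ> F) \<circ> G)" .
    then show "homeomorphic_map (subtopology Y V) (top_of_set (\<psi> ` V)) \<psi>"
      by (rule homeomorphic_map_eq) (use G in \<open>auto simp: homeomorphic_maps_def\<close>)
  qed (rule homeomorphic_map_compose[OF sub])
  then show ?thesis unfolding W_def[symmetric] complex_chart_def open_iff img by blast
qed

lemma prod_UNIV_3: "(\<Prod>i\<in>UNIV. g i) = g 0 * g 1 * g (2 :: 3)" for g :: "3 \<Rightarrow> 'a :: comm_monoid_mult"
proof -
  \<comment> \<open>\<open>UNIV_3\<close> lists the indices as 1, 2, 3, and the numeral 3 denotes 0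
    in this type.\<close>
  have "g 3 = g 0" by (rule arg_cong[of _ _ g]) simp
  then show ?thesis unfolding UNIV_3 by (simp add: mult_ac)
qed

lemma coprime_roots_of_unity:
  fixes z :: complex
  assumes "z ^ m = 1" "z ^ n = 1" "coprime m n" "m > 0"
  shows "z = 1"
proof -
  obtain x y where "m * x = n * y + gcd m n" using bezout_nat[of m n] assms(4) by auto
  then have xy: "m * x = n * y + 1" using assms(3) by simp
  have "1 = z ^ (m * x)" using assms(1) by (simp add: power_mult)
  also have "\<dots> = z" unfolding xy using assms(2) by (simp add: power_add power_mult)
  finally show ?thesis by simp
qed

section \<open>The group action on the straight cover\<close>

lemma image_times_pclass: "(*) s ` pclass y = pclass (s * y)"
proof -
  have "s * (l *s y) = l *s (s * y)" for l by (simp add: vec_eq_iff mult_ac)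
  moreover have "pclass w = (\<lambda>l. l *s w) ` {l. l \<noteq> 0}" for w
    unfolding pclass_eq_scale by blast
  ultimately show ?thesis by (simp only: image_image)
qed

lemma wclass_scale:
  assumes "l \<noteq> 0"
  shows "wclass a (\<chi> i. l ^ a i * x $ i) = wclass a x"
proof (rule Set.set_eqI)
  fix w
  show "w \<in> wclass a (\<chi> i. l ^ a i * x $ i) \<longleftrightarrow> w \<in> wclass a x"
  proof
    assume "w \<in> wclass a (\<chi> i. l ^ a i * x $ i)"
    then obtain k where "k \<noteq> 0" "w = (\<chi> i. k ^ a i * (\<chi> i. l ^ a i * x $ i) $ i)"
      unfolding wclass_def by blast
    then have "w = (\<chi> i. (k * l) ^ a i * x $ i)" "k * l \<noteq> 0"
      using assms by (simp_all add: vec_eq_iff power_mult_distrib mult_ac)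
    then show "w \<in> wclass a x" unfolding wclass_def by blast
  next
    assume "w \<in> wclass a x"
    then obtain k where "k \<noteq> 0" "w = (\<chi> i. k ^ a i * x $ i)" unfolding wclass_def by blast
    then have "w = (\<chi> i. (k / l) ^ a i * (\<chi> i. l ^ a i * x $ i) $ i)" "k / l \<noteq> 0"
      using assms by (simp_all add: vec_eq_iff power_divide)
    then show "w \<in> wclass a (\<chi> i. l ^ a i * x $ i)" unfolding wclass_def by blast
  qed
qed

lemma wclass_self: "x \<in> wclass a x"
proof -
  have "x = (\<chi> i. 1 ^ a i * x $ i)" by (simp add: vec_eq_iff)
  then show ?thesis unfolding wclass_def by (intro CollectI exI[of _ 1] conjI) simp_all
qed

lemma wclass_eqD: "wclass a x = wclass a w \<Longrightarrow> \<exists>l. l \<noteq> 0 \<and> w = (\<chi> i. l ^ a i * x $ i)"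
  using wclass_self[of w a] unfolding wclass_def[of a x] by blast

lemma group_mu_group:
  assumes "\<And>i. a i > 0"
  shows "group (mu_group a)"
proof (rule groupI)
  fix x assume x: "x \<in> carrier (mu_group a)"
  have "x $ i \<noteq> 0" for i
  proof
    assume "x $ i = 0"
    moreover have "x $ i ^ a i = 1" using x by (simp add: mu_group_def)
    ultimately show False using assms[of i] by (simp add: power_0_left)
  qed
  then have "(\<chi> i. inverse (x $ i)) * x = 1" by (simp add: vec_eq_iff)
  moreover have "(\<chi> i. inverse (x $ i)) \<in> carrier (mu_group a)"
    using x by (simp add: mu_group_def power_inverse)
  ultimately show "\<exists>y\<in>carrier (mu_group a). y \<otimes>\<^bsub>mu_group a\<^esub> x = \<one>\<^bsub>mu_group a\<^esub>"
    by (intro bexI[of _ "\<chi> i. inverse (x $ i)"]) (simp_all add: mu_group_def)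
qed (auto simp: mu_group_def power_mult_distrib mult.assoc)

locale straight_cover =
  fixes a :: "3 \<Rightarrow> nat" and f :: poly3 and d :: nat
  assumes pos: "\<And>i. a i > 0"
    and coprime: "\<And>i j. i \<noteq> j \<Longrightarrow> coprime (a i) (a j)"
    and weighted: "weighted_homogeneous a d f"
    and nonsing_cover: "nonsingular (straight_cover_poly a f)"
begin

text \<open>Raising coordinate \<open>i\<close> to the power \<open>a i\<close> turns the weight of
  a monomial into an ordinary degree, so every term scales by the same factor
  \<open>l ^ d\<close>.\<close>

sublocale plane_curve "straight_cover_poly a f" d
proof
  show "eval3 (straight_cover_poly a f) (l *s y) = l ^ d * eval3 (straight_cover_poly a f) y" for l y
  proof -
    have "(\<Prod>i\<in>UNIV. ((l * y $ i) ^ a i) ^ Poly_Mapping.lookup c i) =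
        l ^ d * (\<Prod>i\<in>UNIV. ((y $ i) ^ a i) ^ Poly_Mapping.lookup c i)" if "c \<in> Poly_Mapping.keys f" for c
    proof -
      have "(\<Prod>i\<in>UNIV. ((l * y $ i) ^ a i) ^ Poly_Mapping.lookup c i) =
          (\<Prod>i\<in>UNIV. l ^ (a i * Poly_Mapping.lookup c i)) * (\<Prod>i\<in>UNIV. ((y $ i) ^ a i) ^ Poly_Mapping.lookup c i)"
        by (simp add: power_mult_distrib power_mult prod.distrib)
      also have "(\<Prod>i\<in>UNIV. l ^ (a i * Poly_Mapping.lookup c i)) = l ^ d"
        using weighted that by (simp add: weighted_homogeneous_def flip: power_sum)
      finally show ?thesis .
    qed
    then show ?thesis
      unfolding eval3_straight_cover_poly by (simp add: eval3_def sum_distrib_left mult_ac)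
  qed
qed (rule nonsing_cover)

abbreviation "E \<equiv> pcurve (straight_cover_poly a f)"
abbreviation "G \<equiv> mu_group a"
abbreviation "act \<equiv> cover_act a f"

lemma carrier_iff: "s \<in> carrier G \<longleftrightarrow> (\<forall>i. s $ i ^ a i = 1)"
  by (simp add: mu_group_def)

lemma carrier_nonzero: "s \<in> carrier G \<Longrightarrow> s $ i \<noteq> 0"
  using pos[of i] by (auto simp: carrier_iff power_0_left dest!: spec[of _ i])

lemma one_eq: "\<one>\<^bsub>G\<^esub> = 1" and mult_eq: "s \<otimes>\<^bsub>G\<^esub> t = s * t"
  by (simp_all add: mu_group_def)

lemma eval_act: "s \<in> carrier G \<Longrightarrow> eval3 (straight_cover_poly a f) (s * y) = eval3 (straight_cover_poly a f) y"
  by (simp add: eval3_straight_cover_poly carrier_iff power_mult_distrib)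

lemma zeros_act:
  assumes "s \<in> carrier G"
  shows "s * y \<in> zeros \<longleftrightarrow> y \<in> zeros"
proof -
  have "s * y = 0 \<longleftrightarrow> y = 0" using carrier_nonzero[OF assms] by (auto simp: vec_eq_iff)
  then show ?thesis by (simp add: zeros_def eval_act[OF assms])
qed

lemma act_pclass: "y \<in> zeros \<Longrightarrow> act s (pclass y) = pclass (s * y)"
  by (simp add: mu_act_def pclass_in_pcurve_iff image_times_pclass)

lemma E_cases:
  assumes "P \<in> E"
  obtains y where "y \<in> zeros" "P = pclass y"
  using assms unfolding pcurve_eq by blast

lemma act_in_E: "s \<in> carrier G \<Longrightarrow> P \<in> E \<Longrightarrow> act s P \<in> E"
  by (erule E_cases) (simp add: act_pclass zeros_act pclass_in_pcurve_iff)

lemma act_mult: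
  assumes "s \<in> carrier G" "t \<in> carrier G" "P \<in> E"
  shows "act (s * t) P = act s (act t P)"
  using assms(3) by (rule E_cases) (simp add: act_pclass zeros_act[OF assms(2)] mult.assoc)

lemma act_one: "P \<in> E \<Longrightarrow> act 1 P = P"
  by (erule E_cases) (simp add: act_pclass)

lemma finite_carrier: "finite (carrier G)" and order_G: "order G = a 0 * a 1 * a 2"
proof -
  define R where "R = (\<lambda>i. {z :: complex. z ^ a i = 1})"
  have eq: "carrier G = (\<lambda>g. (\<chi> i. g i) :: complex ^ 3) ` (\<Pi>\<^sub>E i\<in>UNIV. R i)"
  proof (intro equalityI subsetI)
    fix s assume "s \<in> carrier G"
    then show "s \<in> (\<lambda>g. \<chi> i. g i) ` (\<Pi>\<^sub>E i\<in>UNIV. R i)"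
      by (intro image_eqI[of _ _ "\<lambda>i. s $ i"]) (simp_all add: carrier_iff R_def PiE_UNIV_domain)
  qed (auto simp: carrier_iff R_def)
  have fin: "finite (R i)" for i unfolding R_def using pos[of i] by (intro finite_roots_unity) auto
  then show "finite (carrier G)" unfolding eq by (intro finite_imageI finite_PiE) auto
  have inj: "inj_on (\<lambda>g. (\<chi> i. g i) :: complex ^ 3) (\<Pi>\<^sub>E i\<in>UNIV. R i)"
    by (rule inj_onI) (simp add: vec_eq_iff fun_eq_iff)
  have "order G = (\<Prod>i\<in>UNIV. card (R i))"
    unfolding order_def eq by (simp add: card_image[OF inj] card_PiE)
  also have "\<dots> = (\<Prod>i\<in>UNIV. a i)"
    by (intro prod.cong refl) (simp add: R_def card_roots_unity_eq pos)
  finally show "order G = a 0 * a 1 * a 2" by (simp only: prod_UNIV_3)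
qed

sublocale group G by (rule group_mu_group[OF pos])

text \<open>Elements of \<open>BijGroup E\<close> are extensional functions; the restriction to the
  curve built into \<open>mu_act\<close> makes the action a homomorphism into that group.\<close>

lemma group_action_cover: "group_action G E act"
  unfolding group_action_def group_hom_def group_hom_axioms_def
proof (intro conjI group_mu_group[OF pos] group_BijGroup homI)
  have bij: "act s \<in> Bij E" if s: "s \<in> carrier G" for s
  proof -
    have inv: "inv\<^bsub>G\<^esub> s \<in> carrier G" using s by simp
    have "inv\<^bsub>G\<^esub> s * s = 1" "s * inv\<^bsub>G\<^esub> s = 1" using l_inv[OF s] r_inv[OF s] by (simp_all add: one_eq mult_eq)
    then have "bij_betw (act s) E E"
      using act_mult[OF inv s] act_mult[OF s inv]
      by (intro bij_betw_byWitness[where f' = "act (inv\<^bsub>G\<^esub> s)"]) (auto simp: act_one act_in_E s inv)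
    then show ?thesis by (simp add: Bij_def mu_act_def)
  qed
  then show "act s \<in> carrier (BijGroup E)" if "s \<in> carrier G" for s
    using that by (simp add: BijGroup_def)
  show "act (s \<otimes>\<^bsub>G\<^esub> t) = act s \<otimes>\<^bsub>BijGroup E\<^esub> act t" if st: "s \<in> carrier G" "t \<in> carrier G" for s t
  proof -
    have "act (s * t) P = compose E (act s) (act t) P" for P
    proof (cases "P \<in> E")
      case True
      then show ?thesis using act_mult[OF st] by (simp add: compose_def)
    qed (simp add: mu_act_def compose_def)
    then show ?thesis using bij st by (simp add: BijGroup_def mult_eq fun_eq_iff)
  qed
qed

lemma mem_orbit_iff: "Q \<in> orbit G act P \<longleftrightarrow> (\<exists>s\<in>carrier G. Q = act s P)"
  by (auto simp: orbit_def)

lemma mem_stabilizer_iff: "s \<in> stabilizer G act P \<longleftrightarrow> s \<in> carrier G \<and> act s P = P"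
  by (simp add: stabilizer_def)

text \<open>Changing only coordinate \<open>k\<close> by the factor \<open>s $ k\<close> fixes the
  vector \<open>y\<close> and leaves \<open>h\<close> invariant; differentiating the invariance in
  direction \<open>k\<close> at \<open>y\<close> gives the claim. It controls the component that the
  coordinate \<open>y $ j / y $ i\<close> does not see.\<close>

lemma partial_fixed:
  fixes y s :: "complex ^ 3"
  assumes s: "s \<in> carrier G" and "y $ k = 0" "partial3 k (straight_cover_poly a f) y \<noteq> 0"
  shows "s $ k = 1"
proof -
  define s' where "s' = (\<chi> i. if i = k then s $ k else 1)"
  have s': "s' \<in> carrier G" using s by (simp add: s'_def carrier_iff)
  have "s' $ k * partial3 k (straight_cover_poly a f) (s' * y) = 1 * partial3 k (straight_cover_poly a f) y"
    by (rule partial3_diagonal) (simp add: eval_act[OF s'])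
  moreover have "s' * y = y" using assms(2) by (simp add: s'_def vec_eq_iff)
  ultimately show ?thesis using assms(3) by (simp add: s'_def)
qed

text \<open>An element that fixes the class rescales \<open>y\<close> by one common factor, so its
  components agree wherever \<open>y\<close> is nonzero.\<close>

lemma stabilizer_ratio:
  fixes y s :: "complex ^ 3"
  assumes y: "y \<in> zeros" and s: "s \<in> stabilizer G act (pclass y)" and "y $ i \<noteq> 0" "y $ j \<noteq> 0"
  shows "s $ j = s $ i"
proof -
  have "pclass (s * y) = pclass y" using s act_pclass[OF y] by (simp add: mem_stabilizer_iff)
  then obtain l where l: "y = l *s (s * y)" unfolding pclass_eq_iff by blast
  have "y $ m = l * (s $ m * y $ m)" for m using arg_cong[OF l, of "\<lambda>v. v $ m"] by simp
  then have "(l * s $ m) * y $ m = 1 * y $ m" for m by (simp only: mult.assoc mult_1)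
  then have "l * s $ i = 1" "l * s $ j = 1" using assms(3,4) mult_cancel_right by blast+
  then have "l * s $ j = l * s $ i" "l \<noteq> 0" by auto
  then show ?thesis by simp
qed

text \<open>The common value at \<open>i\<close> and \<open>j\<close> is a root of unity of two
  coprime orders, hence 1. The component at \<open>k\<close> is compared with the one at
  \<open>i\<close> if \<open>y $ k\<close> is nonzero, and otherwise fixed by the nonvanishing
  partial derivative.\<close>

lemma stabilizer_faithful:
  fixes y s :: "complex ^ 3"
  assumes ijk: "{i, j, k} = (UNIV :: 3 set)" and y: "y \<in> zeros" "y $ i \<noteq> 0"
    "partial3 k (straight_cover_poly a f) y \<noteq> 0"
    and s: "s \<in> stabilizer G act (pclass y)" and eq: "s $ j = s $ i"
  shows "s = 1"
proof -
  note dist = distinct_indices[OF ijk]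
  have sG: "s \<in> carrier G" using s by (simp add: mem_stabilizer_iff)
  have "s $ i = 1"
  proof (rule coprime_roots_of_unity[OF _ _ coprime[OF dist(1)] pos])
    show "s $ i ^ a i = 1" using sG by (simp only: carrier_iff)
    show "s $ i ^ a j = 1" using sG unfolding eq[symmetric] by (simp only: carrier_iff)
  qed
  moreover have "s $ k = 1"
  proof (cases "y $ k = 0")
    case True
    then show ?thesis using partial_fixed[OF sG _ y(3)] by blast
  next
    case False
    then show ?thesis using stabilizer_ratio[OF y(1) s y(2), of k] \<open>s $ i = 1\<close> by simp
  qed
  ultimately have si: "s $ l = 1" for l
  proof -
    have "l \<in> {i, j, k}" unfolding ijk by simp
    then consider "l = i" | "l = j" | "l = k" by blast
    then show ?thesis using \<open>s $ i = 1\<close> \<open>s $ k = 1\<close> eq by cases simp_all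
  qed
  show ?thesis by (simp add: vec_eq_iff si)
qed

subsection \<open>The covering map\<close>

abbreviation "\<pi> \<equiv> cover_map a"

lemma cover_map_pclass: "\<pi> (pclass y) = wclass a (\<chi> i. (y $ i) ^ a i)"
proof -
  have "wclass a (\<chi> i. (w $ i) ^ a i) = wclass a (\<chi> i. (y $ i) ^ a i)" if w: "w \<in> pclass y" for w
  proof -
    obtain l where "l \<noteq> 0" "w = l *s y" using w by (subst (asm) pclass_eq_scale) blast
    then show ?thesis
      using wclass_scale[of l a "\<chi> i. (y $ i) ^ a i"] by (simp add: power_mult_distrib)
  qed
  then have "(\<lambda>y. wclass a (\<chi> i. (y $ i) ^ a i)) ` pclass y = {wclass a (\<chi> i. (y $ i) ^ a i)}"
    using pclass_self[of y] by blast
  then show ?thesis by (simp add: cover_map_def)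
qed

lemma cover_map_image: "\<pi> ` E = wcurve a f"
proof (intro equalityI subsetI)
  fix q assume "q \<in> \<pi> ` E"
  then obtain P where "P \<in> E" "q = \<pi> P" by blast
  from \<open>P \<in> E\<close> obtain y where "y \<in> zeros" "P = pclass y" by (rule E_cases)
  then have y: "y \<in> zeros" "q = \<pi> (pclass y)" using \<open>q = \<pi> P\<close> by simp_all
  have "(\<chi> i. (y $ i) ^ a i) \<noteq> 0" using y(1) by (auto simp: zeros_def vec_eq_iff)
  moreover have "eval3 f (\<chi> i. (y $ i) ^ a i) = 0" using y(1) by (simp add: zeros_def eval3_straight_cover_poly)
  ultimately show "q \<in> wcurve a f" unfolding y(2) cover_map_pclass wcurve_def by blast
next
  fix q assume "q \<in> wcurve a f"
  then obtain x where x: "x \<noteq> 0" "eval3 f x = 0" "q = wclass a x" unfolding wcurve_def by blast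
  have "\<exists>w. x $ i = w ^ a i" for i
  proof (rule exists_complex_root[of "a i" "x $ i"])
    show "a i \<noteq> 0" using pos[of i] by simp
  qed (rule exI)
  then obtain w where w: "\<And>i. x $ i = w i ^ a i" using choice[of "\<lambda>i w. x $ i = w ^ a i"] by blast
  define y where "y = (\<chi> i. w i)"
  have xy: "(\<chi> i. (y $ i) ^ a i) = x" by (simp add: y_def vec_eq_iff w)
  have "y \<noteq> 0"
  proof
    assume "y = 0"
    then have "x $ i = 0" for i using pos[of i] by (simp add: flip: xy)
    then show False using x(1) by (simp add: vec_eq_iff)
  qed
  then have "y \<in> zeros" using x(2) by (simp add: zeros_def eval3_straight_cover_poly xy)
  then show "q \<in> \<pi> ` E" unfolding x(3) xy[symmetric] cover_map_pclass[symmetric] pcurve_eq by blast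
qed

lemma cover_map_act:
  assumes "s \<in> carrier G" "P \<in> E"
  shows "\<pi> (act s P) = \<pi> P"
  using assms(2)
  by (rule E_cases) (use assms(1) in \<open>simp add: act_pclass cover_map_pclass power_mult_distrib carrier_iff\<close>)

lemma cover_map_eqD:
  assumes "P \<in> E" "Q \<in> E" "\<pi> P = \<pi> Q"
  shows "\<exists>s\<in>carrier G. Q = act s P"
proof -
  obtain y where y: "y \<in> zeros" "P = pclass y" using assms(1) by (rule E_cases)
  obtain w where w: "w \<in> zeros" "Q = pclass w" using assms(2) by (rule E_cases)
  obtain l where l: "l \<noteq> 0" "(\<chi> i. (w $ i) ^ a i) = (\<chi> i. l ^ a i * (\<chi> i. (y $ i) ^ a i) $ i)"
    using wclass_eqD[OF assms(3)[unfolded y(2) w(2) cover_map_pclass]] by blast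
  have pw: "w $ i ^ a i = (l * y $ i) ^ a i" for i
    using arg_cong[OF l(2), of "\<lambda>v. v $ i"] by (simp add: power_mult_distrib)
  \<comment> \<open>Where \<open>y $ i\<close> is zero so is \<open>w $ i\<close>, and any root of
    unity would do; 1 is chosen.\<close>
  define s where "s = (\<chi> i. if y $ i = 0 then 1 else w $ i / (l * y $ i))"
  have "s \<in> carrier G" using pw l(1) by (auto simp: carrier_iff s_def power_divide)
  moreover have wl: "w = l *s (s * y)"
  proof -
    have "w $ i = (l *s (s * y)) $ i" for i
      using pw[of i] l(1) pos[of i] by (auto simp: s_def power_0_left)
    then show ?thesis unfolding vec_eq_iff by blast
  qed
  have "pclass w = pclass (s * y)" unfolding wl by (rule pclass_scale[OF l(1)])
  then have "Q = act s P" unfolding w(2) y(2) act_pclass[OF y(1)] .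
  ultimately show ?thesis by blast
qed

lemma fibre_eq_orbit:
  assumes "P \<in> E"
  shows "{Q \<in> E. \<pi> Q = \<pi> P} = orbit G act P"
proof (intro equalityI subsetI)
  fix Q assume "Q \<in> {Q \<in> E. \<pi> Q = \<pi> P}"
  then have "Q \<in> E" "\<pi> P = \<pi> Q" by simp_all
  then show "Q \<in> orbit G act P" using cover_map_eqD[OF assms] by (simp only: mem_orbit_iff)
next
  fix Q assume "Q \<in> orbit G act P"
  then obtain s where "s \<in> carrier G" "Q = act s P" unfolding mem_orbit_iff by blast
  then show "Q \<in> {Q \<in> E. \<pi> Q = \<pi> P}" using act_in_E[OF _ assms] cover_map_act[OF _ assms] by simp
qed

lemma finite_fibre: "finite {Q \<in> E. \<pi> Q = q}"
proof (cases "\<exists>P\<in>E. \<pi> P = q")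
  case True
  then obtain P where P: "P \<in> E" "\<pi> P = q" by blast
  have "orbit G act P = (\<lambda>s. act s P) ` carrier G" unfolding orbit_def by blast
  then show ?thesis using fibre_eq_orbit[OF P(1)] finite_carrier by (simp add: P(2))
next
  case False
  then have "{Q \<in> E. \<pi> Q = q} = {}" by blast
  then show ?thesis by (simp only: finite.emptyI)
qed

lemma orbit_map_orbit:
  assumes "P \<in> E"
  shows "orbit_map a (orbit G act P) = \<pi> P"
proof -
  have "\<pi> Q = \<pi> P" if "Q \<in> orbit G act P" for Q
    using that cover_map_act[OF _ assms] unfolding mem_orbit_iff by blast
  moreover have "P \<in> orbit G act P"
    using group_action.orbit_refl[OF group_action_cover assms] .
  ultimately have "\<pi> ` orbit G act P = {\<pi> P}" by blast
  then show ?thesis by (simp add: orbit_map_def)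
qed

lemma cover_topology_eq: "cover_topology a f = surface"
  by (simp add: cover_topology_def surface_def)

lemma cover_atlas_eq: "cover_atlas a f = atlas"
  by (simp add: cover_atlas_def atlas_def cover_topology_eq)

subsection \<open>The topology of the curve\<close>

definition "orbit_space = orbit_space_topology surface G act"
definition "curve = curve_topology a f"

lemma topspace_orbit_space: "topspace orbit_space = orbits G E act"
  unfolding orbit_space_def orbit_space_topology_def topspace_surface
  by (rule topspace_final_topology) (auto simp: topspace_surface orbits_def)

lemma orbit_in_orbits: "P \<in> E \<Longrightarrow> orbit G act P \<in> orbits G E act"
  unfolding orbits_def by blast

lemma homeomorphic_orbit_map: "homeomorphic_map orbit_space curve (orbit_map a)"
proof -
  have "orbit_map a ` orbits G E act = wcurve a f"
  proof -
    have "orbits G E act = orbit G act ` E" unfolding orbits_def by blast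
    then have "orbit_map a ` orbits G E act = \<pi> ` E" by (simp add: image_image orbit_map_orbit)
    then show ?thesis using cover_map_image by simp
  qed
  moreover have "inj_on (orbit_map a) (orbits G E act)"
  proof (rule inj_onI)
    fix x y assume "x \<in> orbits G E act" "y \<in> orbits G E act" and eq: "orbit_map a x = orbit_map a y"
    then obtain P Q where P: "P \<in> E" "x = orbit G act P" and Q: "Q \<in> E" "y = orbit G act Q"
      unfolding orbits_def by blast
    have "\<pi> P = \<pi> Q" using eq unfolding P(2) Q(2) orbit_map_orbit[OF P(1)] orbit_map_orbit[OF Q(1)] .
    then show "x = y" unfolding P(2) Q(2) fibre_eq_orbit[OF P(1), symmetric] fibre_eq_orbit[OF Q(1), symmetric] by simp
  qed
  ultimately show ?thesis
    unfolding curve_def curve_topology_def cover_topology_eq orbit_space_def[symmetric]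
    by (intro homeomorphic_map_final_topology) (simp_all only: topspace_orbit_space)
qed

lemma topspace_curve: "topspace curve = wcurve a f"
  unfolding cover_map_image[symmetric] homeomorphic_imp_surjective_map[OF homeomorphic_orbit_map, symmetric]
    topspace_orbit_space
proof -
  have "orbits G E act = orbit G act ` E" unfolding orbits_def by blast
  then show "orbit_map a ` orbits G E act = \<pi> ` E" by (simp add: image_image orbit_map_orbit)
qed

text \<open>Composing the quotient by the group with the homeomorphism to the curve lets the
  topology of the curve be read directly on the cover.\<close>

lemma quotient_map_cover: "quotient_map surface curve \<pi>"
proof -
  have "quotient_map surface orbit_space (orbit G act)"
    unfolding orbit_space_def orbit_space_topology_def topspace_surface
    by (rule quotient_map_final_topology) (auto simp: topspace_surface orbits_def)
  then have "quotient_map surface curve (orbit_map a \<circ> orbit G act)"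
    by (rule quotient_map_compose) (rule homeomorphic_orbit_map[unfolded homeomorphic_map_def, THEN conjunct1])
  then show ?thesis
    by (rule quotient_map_eq) (simp add: topspace_surface orbit_map_orbit)
qed

lemma openin_curve_iff:
  "V \<subseteq> wcurve a f \<Longrightarrow> openin curve V \<longleftrightarrow> openin surface {P \<in> E. \<pi> P \<in> V}"
  using quotient_map_cover unfolding quotient_map_def topspace_curve topspace_surface by blast

lemma continuous_act:
  assumes s: "s \<in> carrier G"
  shows "continuous_map surface surface (act s)"
proof (rule continuous_compose_quotient_map[OF quotient_map_surface])
  have "continuous_on zeros (\<lambda>y. \<chi> i. s $ i * y $ i)" by (intro continuous_intros)
  moreover have "(\<lambda>y. \<chi> i. s $ i * y $ i) = (*) s" by (simp add: vec_eq_iff fun_eq_iff)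
  ultimately have "continuous_on zeros ((*) s)" by (simp only:)
  then have "continuous_map (top_of_set zeros) (top_of_set zeros) ((*) s)"
    using zeros_act[OF s] by (auto simp: continuous_map_in_subtopology)
  from continuous_map_compose[OF this quotient_imp_continuous_map[OF quotient_map_surface]]
  show "continuous_map (top_of_set zeros) surface (act s \<circ> pclass)"
    by (rule continuous_map_eq) (simp add: act_pclass)
qed

lemma act_inverse:
  assumes s: "s \<in> carrier G" and P: "P \<in> E"
  shows "act (inv\<^bsub>G\<^esub> s) (act s P) = P" "act s (act (inv\<^bsub>G\<^esub> s) P) = P"
proof -
  have inv: "inv\<^bsub>G\<^esub> s \<in> carrier G" using s by simp
  have "inv\<^bsub>G\<^esub> s * s = 1" "s * inv\<^bsub>G\<^esub> s = 1" using l_inv[OF s] r_inv[OF s] by (simp_all add: one_eq mult_eq)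
  then show "act (inv\<^bsub>G\<^esub> s) (act s P) = P" "act s (act (inv\<^bsub>G\<^esub> s) P) = P"
    using act_mult[OF inv s P] act_mult[OF s inv P] act_one[OF P] by simp_all
qed

lemma act_image_eq:
  assumes s: "s \<in> carrier G" and U: "U \<subseteq> E"
  shows "act s ` U = {P \<in> topspace surface. act (inv\<^bsub>G\<^esub> s) P \<in> U}"
proof (intro equalityI subsetI)
  fix Q assume "Q \<in> act s ` U"
  then obtain P where P: "P \<in> U" "Q = act s P" by blast
  then have "P \<in> E" using U by blast
  then show "Q \<in> {P \<in> topspace surface. act (inv\<^bsub>G\<^esub> s) P \<in> U}"
    using P(1) act_inverse(1)[OF s \<open>P \<in> E\<close>] act_in_E[OF s \<open>P \<in> E\<close>] by (simp add: P(2) topspace_surface)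
next
  fix Q assume "Q \<in> {P \<in> topspace surface. act (inv\<^bsub>G\<^esub> s) P \<in> U}"
  then have Q: "Q \<in> E" "act (inv\<^bsub>G\<^esub> s) Q \<in> U" by (simp_all add: topspace_surface)
  have "Q = act s (act (inv\<^bsub>G\<^esub> s) Q)" using act_inverse(2)[OF s Q(1)] by simp
  then show "Q \<in> act s ` U" using Q(2) by (rule image_eqI)
qed

lemma openin_act_image: "s \<in> carrier G \<Longrightarrow> openin surface U \<Longrightarrow> openin surface (act s ` U)"
  using openin_continuous_map_preimage[OF continuous_act, of "inv\<^bsub>G\<^esub> s" U] openin_subset[of surface U]
  by (simp add: act_image_eq topspace_surface)

lemma closedin_act_image: "s \<in> carrier G \<Longrightarrow> closedin surface U \<Longrightarrow> closedin surface (act s ` U)"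
  using closedin_continuous_map_preimage[OF continuous_act, of "inv\<^bsub>G\<^esub> s" U] closedin_subset[of surface U]
  by (simp add: act_image_eq topspace_surface)

text \<open>The fibres are orbits, so a saturation is a union of translates. Finiteness of the group
  then makes \<open>\<pi>\<close> closed as well as open.\<close>

lemma saturation:
  assumes "U \<subseteq> E"
  shows "{P \<in> E. \<pi> P \<in> \<pi> ` U} = (\<Union>s\<in>carrier G. act s ` U)"
proof (intro equalityI subsetI)
  fix P assume "P \<in> {P \<in> E. \<pi> P \<in> \<pi> ` U}"
  then obtain Q where Q: "Q \<in> U" "\<pi> Q = \<pi> P" and P: "P \<in> E" by auto
  then have "Q \<in> E" using assms by blast
  from cover_map_eqD[OF this P Q(2)] show "P \<in> (\<Union>s\<in>carrier G. act s ` U)" using Q(1) by blast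
next
  fix P assume "P \<in> (\<Union>s\<in>carrier G. act s ` U)"
  then obtain s Q where s: "s \<in> carrier G" "Q \<in> U" "P = act s Q" by blast
  then have "Q \<in> E" using assms by blast
  then show "P \<in> {P \<in> E. \<pi> P \<in> \<pi> ` U}"
    using s act_in_E[OF s(1)] cover_map_act[OF s(1)] by simp
qed

lemma openin_cover_image:
  assumes "openin surface U"
  shows "openin curve (\<pi> ` U)"
proof -
  have U: "U \<subseteq> E" using openin_subset[OF assms] by (simp add: topspace_surface)
  then have "\<pi> ` U \<subseteq> wcurve a f" unfolding cover_map_image[symmetric] by (rule image_mono)
  from openin_curve_iff[OF this] have "openin curve (\<pi> ` U) \<longleftrightarrow> openin surface (\<Union>s\<in>carrier G. act s ` U)"
    unfolding saturation[OF U] .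
  moreover have "openin surface (\<Union>s\<in>carrier G. act s ` U)"
    by (intro openin_Union ballI) (use openin_act_image assms in auto)
  ultimately show ?thesis by blast
qed

text \<open>This is what makes the quotient Hausdorff: a closed continuous image of a normal
  Hausdorff space is Hausdorff.\<close>

lemma closed_map_cover: "closed_map surface curve \<pi>"
  unfolding closed_map_def
proof (intro allI impI)
  fix U assume U: "closedin surface U"
  then have sub: "U \<subseteq> E" using closedin_subset by (metis topspace_surface)
  have "closedin surface (\<Union>((\<lambda>s. act s ` U) ` carrier G))"
    by (rule closedin_Union) (use finite_carrier closedin_act_image U in auto)
  then have "closedin surface {P \<in> topspace surface. \<pi> P \<in> \<pi> ` U}"
    unfolding topspace_surface saturation[OF sub] .
  moreover have "\<pi> ` U \<subseteq> topspace curve"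
    unfolding topspace_curve cover_map_image[symmetric] using sub by (rule image_mono)
  moreover have "\<forall>V\<subseteq>topspace curve. closedin surface {x \<in> topspace surface. \<pi> x \<in> V} = closedin curve V"
    using quotient_map_cover unfolding quotient_map_closedin by blast
  ultimately show "closedin curve (\<pi> ` U)" by simp
qed

lemma continuous_cover: "continuous_map surface curve \<pi>"
  by (rule quotient_imp_continuous_map[OF quotient_map_cover])

lemma surj_cover: "\<pi> ` topspace surface = topspace curve"
  by (rule quotient_imp_surjective_map[OF quotient_map_cover])

lemma compact_space_curve: "compact_space curve"
  using image_compactin[OF _ continuous_cover, of "topspace surface"] compact_space_surface
  by (simp add: compact_space_def surj_cover)

lemma connected_space_curve: "connected_space curve"
  using connected_space_surface quotient_map_cover connected_space_quotient_map_image by blast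

lemma Hausdorff_space_curve: "Hausdorff_space curve"
  using normal_Hausdorff_space_closed_continuous_map_image[OF _ Hausdorff_space_surface closed_map_cover
      continuous_cover surj_cover]
    compact_Hausdorff_or_regular_imp_normal_space[OF compact_space_surface] Hausdorff_space_surface by blast

lemma second_countable_curve: "second_countable curve"
  by (rule second_countable_open_map_image[OF continuous_cover _ surj_cover second_countable_surface])
    (simp add: open_map_def openin_cover_image)


subsection \<open>Charts of the curve\<close>

text \<open>The condition of \<open>orbit_space_atlas\<close> after transport: each orbit is
  replaced by its image under \<open>orbit_map\<close>, which is the value of \<open>\<pi>\<close>
  on any of its points.\<close>

definition orbit_chart_data where
  "orbit_chart_data V \<psi> P U \<phi> \<longleftrightarrow> (U, \<phi>) \<in> maximal_atlas surface atlas \<and> P \<in> U \<and>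
     (\<forall>g\<in>stabilizer G act P. act g ` U = U) \<and>
     (\<forall>g\<in>carrier G - stabilizer G act P. act g ` U \<inter> U = {}) \<and> V = \<pi> ` U \<and>
     (\<forall>x\<in>U. \<psi> (\<pi> x) = (\<Prod>g\<in>stabilizer G act P. \<phi> (act g x) - \<phi> P))"

lemma maximal_atlas_subset: "(U, \<phi>) \<in> maximal_atlas surface atlas \<Longrightarrow> U \<subseteq> E"
  using complex_chartD(4) topspace_surface unfolding maximal_atlas_def by blast

lemma curve_atlas_iff:
  "(V, \<psi>) \<in> curve_atlas a f \<longleftrightarrow> complex_chart curve V \<psi> \<and> (\<exists>P U \<phi>. orbit_chart_data V \<psi> P U \<phi>)"
proof -
  define W where "W = {q \<in> topspace orbit_space. orbit_map a q \<in> V}"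
  have W_iff: "W = orbit G act ` U \<longleftrightarrow> V = \<pi> ` U" if UV: "U \<subseteq> E" "V \<subseteq> wcurve a f" for U
  proof -
    have im: "orbit_map a ` W = V"
    proof (intro equalityI subsetI)
      fix v assume v: "v \<in> V"
      then obtain P where P: "P \<in> E" "v = \<pi> P" using UV(2) unfolding cover_map_image[symmetric] by blast
      then have "orbit G act P \<in> W"
        using v orbit_in_orbits[OF P(1)] by (simp add: W_def topspace_orbit_space orbit_map_orbit)
      then show "v \<in> orbit_map a ` W" unfolding P(2) orbit_map_orbit[OF P(1), symmetric] by (rule imageI)
    qed (auto simp: W_def)
    have im_U: "orbit_map a ` orbit G act ` U = \<pi> ` U"
      using orbit_map_orbit UV(1) by (auto simp: image_image intro!: image_cong)
    have "W \<subseteq> topspace orbit_space" "orbit G act ` U \<subseteq> topspace orbit_space"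
      using UV(1) unfolding W_def topspace_orbit_space orbits_def by blast+
    from inj_on_image_eq_iff[OF homeomorphic_imp_injective_map[OF homeomorphic_orbit_map] this]
    show ?thesis unfolding im im_U by blast
  qed
  have vals: "(\<forall>x\<in>U. (\<psi> \<circ> orbit_map a) (orbit G act x) = g x) \<longleftrightarrow> (\<forall>x\<in>U. \<psi> (\<pi> x) = g x)"
    if "U \<subseteq> E" for U and g
    using that orbit_map_orbit by (intro ball_cong) auto
  have "(V, \<psi>) \<in> curve_atlas a f \<longleftrightarrow> V \<subseteq> wcurve a f \<and> complex_chart orbit_space W (\<psi> \<circ> orbit_map a) \<and>
     (\<exists>P U \<phi>. (U, \<phi>) \<in> maximal_atlas surface atlas \<and> P \<in> U \<and>
        (\<forall>g\<in>stabilizer G act P. act g ` U = U) \<and>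
        (\<forall>g\<in>carrier G - stabilizer G act P. act g ` U \<inter> U = {}) \<and>
        W = orbit G act ` U \<and>
        (\<forall>x\<in>U. (\<psi> \<circ> orbit_map a) (orbit G act x) = (\<Prod>g\<in>stabilizer G act P. \<phi> (act g x) - \<phi> P)))"
    unfolding curve_atlas_def transported_atlas_def orbit_space_atlas_def cover_topology_eq cover_atlas_eq
      orbit_space_def[symmetric] W_def by simp
  also have "\<dots> \<longleftrightarrow> V \<subseteq> wcurve a f \<and> complex_chart curve V \<psi> \<and> (\<exists>P U \<phi>. orbit_chart_data V \<psi> P U \<phi>)"
  proof (intro conj_cong refl)
    assume V: "V \<subseteq> wcurve a f"
    then show "complex_chart orbit_space W (\<psi> \<circ> orbit_map a) \<longleftrightarrow> complex_chart curve V \<psi>"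
      unfolding W_def by (intro complex_chart_transport homeomorphic_orbit_map) (simp add: topspace_curve)
    show "(\<exists>P U \<phi>. (U, \<phi>) \<in> maximal_atlas surface atlas \<and> P \<in> U \<and>
        (\<forall>g\<in>stabilizer G act P. act g ` U = U) \<and>
        (\<forall>g\<in>carrier G - stabilizer G act P. act g ` U \<inter> U = {}) \<and>
        W = orbit G act ` U \<and>
        (\<forall>x\<in>U. (\<psi> \<circ> orbit_map a) (orbit G act x) = (\<Prod>g\<in>stabilizer G act P. \<phi> (act g x) - \<phi> P)))
      \<longleftrightarrow> (\<exists>P U \<phi>. orbit_chart_data V \<psi> P U \<phi>)"
      unfolding orbit_chart_data_def
      by (intro ex_cong1 conj_cong refl W_iff vals V maximal_atlas_subset) assumption+
  qed
  also have "\<dots> \<longleftrightarrow> complex_chart curve V \<psi> \<and> (\<exists>P U \<phi>. orbit_chart_data V \<psi> P U \<phi>)"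
    using complex_chartD(4)[of curve V \<psi>] topspace_curve by blast
  finally show ?thesis .
qed

text \<open>
  Holomorphic functions on an open part of the surface, tested on holomorphic curves in the affine
  cone; this makes their invariance under the group obvious.
\<close>

definition holomorphic_fun :: "(complex ^ 3) set set \<Rightarrow> ((complex ^ 3) set \<Rightarrow> complex) \<Rightarrow> bool" where
  "holomorphic_fun U F \<longleftrightarrow> (\<forall>S c. open S \<longrightarrow> (\<forall>i. (\<lambda>t. c t $ i) holomorphic_on S) \<longrightarrow>
     (\<forall>t\<in>S. c t \<in> zeros \<and> pclass (c t) \<in> U) \<longrightarrow> (\<lambda>t. F (pclass (c t))) holomorphic_on S)"

lemma holomorphic_funD:
  fixes c :: "complex \<Rightarrow> complex ^ 3"
  assumes "holomorphic_fun U F" "open S" "\<And>i. (\<lambda>t. c t $ i) holomorphic_on S"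
    "\<And>t. t \<in> S \<Longrightarrow> c t \<in> zeros" "\<And>t. t \<in> S \<Longrightarrow> pclass (c t) \<in> U"
  shows "(\<lambda>t. F (pclass (c t))) holomorphic_on S"
  using assms unfolding holomorphic_fun_def by simp

lemma open_curve_preimage:
  fixes c :: "complex \<Rightarrow> complex ^ 3"
  assumes "open S" "\<And>i. (\<lambda>t. c t $ i) holomorphic_on S" "\<And>t. t \<in> S \<Longrightarrow> c t \<in> zeros" "openin surface U"
  shows "open {t \<in> S. pclass (c t) \<in> U}"
proof -
  have "continuous_on S (\<lambda>t. \<chi> i. c t $ i)"
    by (intro continuous_on_vec_lambda holomorphic_on_imp_continuous_on assms(2))
  then have "continuous_map (top_of_set S) (top_of_set zeros) c"
    using assms(3) by (auto simp: continuous_map_in_subtopology)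
  from continuous_map_compose[OF this quotient_imp_continuous_map[OF quotient_map_surface]]
  have "openin (top_of_set S) {t \<in> topspace (top_of_set S). (pclass \<circ> c) t \<in> U}"
    using assms(4) by (rule openin_continuous_map_preimage)
  then have "openin (top_of_set S) {t \<in> S. pclass (c t) \<in> U}" by simp
  then show ?thesis using assms(1) openin_open_trans by blast
qed

lemma chart_at:
  assumes "P \<in> E"
  obtains U \<phi> where "(U, \<phi>) \<in> atlas" "P \<in> U"
proof -
  have "P \<in> (\<Union>(U, \<phi>)\<in>atlas. U)"
    using complex_atlas_surface assms unfolding complex_atlas_def topspace_surface by simp
  then show ?thesis using that by blast
qed

text \<open>Locally the test curve is compared with a chart of the affine type, where its coordinate
  is a quotient of its components; compatibility within the maximal atlas carries holomorphy over to
  \<open>\<phi>\<close>.\<close>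

lemma holomorphic_fun_chart:
  assumes "(U, \<phi>) \<in> maximal_atlas surface atlas"
  shows "holomorphic_fun U \<phi>"
  unfolding holomorphic_fun_def
proof (intro allI impI)
  fix S and c :: "complex \<Rightarrow> complex ^ 3"
  assume S: "open S" and c: "\<forall>i. (\<lambda>t. c t $ i) holomorphic_on S"
    and cU: "\<forall>t\<in>S. c t \<in> zeros \<and> pclass (c t) \<in> U"
  have "(\<lambda>t. \<phi> (pclass (c t))) field_differentiable at t0" if t0: "t0 \<in> S" for t0
  proof -
    have "pclass (c t0) \<in> E" using cU t0 pclass_in_pcurve_iff by blast
    then obtain V \<psi> where V: "(V, \<psi>) \<in> atlas" "pclass (c t0) \<in> V" by (rule chart_at)
    obtain i j k where ij: "\<forall>y\<in>zeros. pclass y \<in> V \<longrightarrow>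
        y $ i \<noteq> 0 \<and> partial3 k (straight_cover_poly a f) y \<noteq> 0 \<and> \<psi> (pclass y) = y $ j / y $ i"
      and V_chart: "complex_chart surface V \<psi>"
      using V(1) unfolding atlas_iff by blast
    define S' where "S' = {t \<in> S. pclass (c t) \<in> V}"
    have S': "open S'" unfolding S'_def
      by (rule open_curve_preimage[OF S _ _ complex_chartD(1)[OF V_chart]]) (use c cU in auto)
    have sub: "S' \<subseteq> S" by (auto simp: S'_def)
    have cV: "c t $ i \<noteq> 0 \<and> \<psi> (pclass (c t)) = c t $ j / c t $ i" if "t \<in> S'" for t
      using that ij cU by (simp add: S'_def)
    have comp: "(\<phi> \<circ> inv_into V \<psi>) holomorphic_on \<psi> ` (U \<inter> V)"
      using assms V(1) unfolding maximal_atlas_def compatible_charts_def by auto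
    have "(\<lambda>t. c t $ j / c t $ i) holomorphic_on S'"
      using c cV by (intro holomorphic_on_divide) (auto intro: holomorphic_on_subset[OF _ sub])
    moreover have "(\<lambda>t. c t $ j / c t $ i) ` S' \<subseteq> \<psi> ` (U \<inter> V)"
    proof (rule image_subsetI)
      fix t assume t: "t \<in> S'"
      then have "pclass (c t) \<in> U \<inter> V" using cU by (simp add: S'_def)
      then have "\<psi> (pclass (c t)) \<in> \<psi> ` (U \<inter> V)" by (rule imageI)
      then show "c t $ j / c t $ i \<in> \<psi> ` (U \<inter> V)" using cV[OF t] by simp
    qed
    ultimately have "((\<phi> \<circ> inv_into V \<psi>) \<circ> (\<lambda>t. c t $ j / c t $ i)) holomorphic_on S'"
      by (rule holomorphic_on_compose_gen[OF _ comp])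
    then have "(\<lambda>t. \<phi> (pclass (c t))) holomorphic_on S'"
    proof (rule holomorphic_transform)
      fix t assume t: "t \<in> S'"
      then have "pclass (c t) \<in> V" by (simp add: S'_def)
      then have "inv_into V \<psi> (\<psi> (pclass (c t))) = pclass (c t)"
        by (rule inv_into_f_f[OF complex_chartD(3)[OF V_chart]])
      then show "((\<phi> \<circ> inv_into V \<psi>) \<circ> (\<lambda>t. c t $ j / c t $ i)) t = \<phi> (pclass (c t))"
        using cV[OF t] by simp
    qed
    moreover have "t0 \<in> S'" using t0 V(2) by (simp add: S'_def)
    ultimately show ?thesis using S' holomorphic_on_imp_differentiable_at by blast
  qed
  then show "(\<lambda>t. \<phi> (pclass (c t))) holomorphic_on S"
    unfolding holomorphic_on_def by (simp add: field_differentiable_at_within)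
qed

text \<open>A test curve over \<open>V\<close> need not meet \<open>U\<close>, but near each
  parameter a group element \<open>r\<close> moves it into \<open>U\<close> without changing its
  image under \<open>\<pi>\<close>. There the defining product expresses \<open>\<psi>\<close>
  through \<open>\<phi>\<close> along diagonal translates of the curve, which are again holomorphic
  curves in the cone.\<close>

lemma holomorphic_fun_curve_chart:
  assumes "(V, \<psi>) \<in> curve_atlas a f"
  shows "holomorphic_fun {P \<in> E. \<pi> P \<in> V} (\<lambda>P. \<psi> (\<pi> P))"
  unfolding holomorphic_fun_def
proof (intro allI impI)
  fix S and c :: "complex \<Rightarrow> complex ^ 3"
  assume S: "open S" and c: "\<forall>i. (\<lambda>t. c t $ i) holomorphic_on S"
    and cV: "\<forall>t\<in>S. c t \<in> zeros \<and> pclass (c t) \<in> {P \<in> E. \<pi> P \<in> V}"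
  obtain P U \<phi> where data: "orbit_chart_data V \<psi> P U \<phi>" using assms unfolding curve_atlas_iff by blast
  have max: "(U, \<phi>) \<in> maximal_atlas surface atlas" and V: "V = \<pi> ` U"
    and stable: "\<And>g. g \<in> stabilizer G act P \<Longrightarrow> act g ` U = U"
    and vals: "\<And>x. x \<in> U \<Longrightarrow> \<psi> (\<pi> x) = (\<Prod>g\<in>stabilizer G act P. \<phi> (act g x) - \<phi> P)"
    using data unfolding orbit_chart_data_def by blast+
  have openU: "openin surface U" and UE: "U \<subseteq> E"
    using max complex_chartD(1) maximal_atlas_subset[OF max] unfolding maximal_atlas_def by blast+
  have "(\<lambda>t. \<psi> (\<pi> (pclass (c t)))) field_differentiable at t0" if t0: "t0 \<in> S" for t0
  proof -
    have "\<pi> (pclass (c t0)) \<in> \<pi> ` U" "pclass (c t0) \<in> E" using cV t0 V by blast+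
    then have "pclass (c t0) \<in> (\<Union>s\<in>carrier G. act s ` U)" using saturation[OF UE] by blast
    then obtain s x where s: "s \<in> carrier G" "x \<in> U" "pclass (c t0) = act s x" by blast
    define r where "r = inv\<^bsub>G\<^esub> s"
    have r: "r \<in> carrier G" using s(1) by (simp add: r_def)
    define S' where "S' = {t \<in> S. pclass (r * c t) \<in> U}"
    have rc: "(\<lambda>t. (g * c t) $ i) holomorphic_on S" for g i
      using c by (simp add: holomorphic_on_mult)
    have rz: "g * c t \<in> zeros" if "t \<in> S" "g \<in> carrier G" for t g
      using that cV zeros_act by blast
    have S': "open S'" unfolding S'_def
      by (rule open_curve_preimage[OF S rc _ openU]) (rule rz[OF _ r])
    have sub: "S' \<subseteq> S" by (auto simp: S'_def)
    have "pclass (r * c t0) = x"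
      using act_pclass[of "c t0" r] cV t0 s act_inverse(1)[OF s(1), of x] UE unfolding r_def by auto
    then have t0': "t0 \<in> S'" using t0 s(2) by (simp add: S'_def)
    \<comment> \<open>Stability of \<open>U\<close> under the stabiliser keeps each translated curve
      inside the domain of \<open>\<phi>\<close>.\<close>
    have hol: "(\<lambda>t. \<phi> (pclass (g * (r * c t)))) holomorphic_on S'" if g: "g \<in> stabilizer G act P" for g
    proof (rule holomorphic_funD[OF holomorphic_fun_chart[OF max] S'])
      have gG: "g \<in> carrier G" using g by (simp add: mem_stabilizer_iff)
      show "(\<lambda>t. (g * (r * c t)) $ i) holomorphic_on S'" for i
        using holomorphic_on_subset[OF rc[of "g * r" i] sub] by (simp add: mult.assoc)
      fix t assume t: "t \<in> S'"
      then have "r * c t \<in> zeros" using rz[OF _ r] sub by blast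
      then show "g * (r * c t) \<in> zeros" using zeros_act[OF gG] by simp
      have "act g (pclass (r * c t)) \<in> act g ` U" using t by (intro imageI) (simp add: S'_def)
      then show "pclass (g * (r * c t)) \<in> U"
        unfolding stable[OF g] act_pclass[OF \<open>r * c t \<in> zeros\<close>] .
    qed
    have "(\<lambda>t. \<Prod>g\<in>stabilizer G act P. \<phi> (pclass (g * (r * c t))) - \<phi> P) holomorphic_on S'"
      by (intro holomorphic_on_prod holomorphic_on_diff holomorphic_on_const hol)
    then have "(\<lambda>t. \<psi> (\<pi> (pclass (c t)))) holomorphic_on S'"
    proof (rule holomorphic_transform)
      fix t assume t: "t \<in> S'"
      then have tS: "t \<in> S" and tU: "pclass (r * c t) \<in> U" by (simp_all add: S'_def)
      have ct: "c t \<in> zeros" using cV tS by blast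
      have "\<pi> (pclass (c t)) = \<pi> (act r (pclass (c t)))"
        using cover_map_act[OF r] ct pclass_in_pcurve_iff by simp
      also have "\<dots> = \<pi> (pclass (r * c t))" by (simp only: act_pclass[OF ct])
      finally have "\<psi> (\<pi> (pclass (c t))) = \<psi> (\<pi> (pclass (r * c t)))" by (rule arg_cong)
      also have "\<dots> = (\<Prod>g\<in>stabilizer G act P. \<phi> (act g (pclass (r * c t))) - \<phi> P)" by (rule vals[OF tU])
      also have "\<dots> = (\<Prod>g\<in>stabilizer G act P. \<phi> (pclass (g * (r * c t))) - \<phi> P)"
        by (simp only: act_pclass[OF rz[OF tS r]])
      finally show "(\<Prod>g\<in>stabilizer G act P. \<phi> (pclass (g * (r * c t))) - \<phi> P) = \<psi> (\<pi> (pclass (c t)))"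
        by (rule sym)
    qed
    then show ?thesis using S' t0' holomorphic_on_imp_differentiable_at by blast
  qed
  then show "(\<lambda>t. \<psi> (\<pi> (pclass (c t)))) holomorphic_on S"
    unfolding holomorphic_on_def by (simp add: field_differentiable_at_within)
qed

lemma chart_preimage_open:
  assumes "(U, \<phi>) \<in> atlas" "openin curve V"
  shows "open (\<phi> ` (U \<inter> \<pi> -` V))" "openin surface (U \<inter> \<pi> -` V)"
proof -
  have chart: "complex_chart surface U \<phi>" using assms(1) unfolding atlas_iff by blast
  have "openin surface {P \<in> topspace surface. \<pi> P \<in> V}"
    using assms(2) by (rule openin_continuous_map_preimage[OF continuous_cover])
  then have "openin surface (U \<inter> {P \<in> topspace surface. \<pi> P \<in> V})"
    using complex_chartD(1)[OF chart] by (intro openin_Int)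
  moreover have "U \<inter> {P \<in> topspace surface. \<pi> P \<in> V} = U \<inter> \<pi> -` V"
    using complex_chartD(4)[OF chart] by blast
  ultimately show o: "openin surface (U \<inter> \<pi> -` V)" by simp
  show "open (\<phi> ` (U \<inter> \<pi> -` V))" by (rule complex_chart_image_open[OF chart o]) blast
qed

text \<open>The lift of a chart of the cover to the affine cone is itself a test curve.\<close>

lemma cover_local_holomorphic:
  assumes U: "(U, \<phi>) \<in> atlas" and V: "(V, \<psi>) \<in> curve_atlas a f"
  shows "(\<lambda>z. \<psi> (\<pi> (inv_into U \<phi> z))) holomorphic_on \<phi> ` (U \<inter> \<pi> -` V)"
proof (rule chart_lift[OF U])
  fix i j k g
  assume ijk: "{i, j, k} = (UNIV :: 3 set)" and g: "g holomorphic_on \<phi> ` U"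
    and z: "\<And>t. t \<in> \<phi> ` U \<Longrightarrow> affine_point i j k t (g t) \<in> zeros"
    and inv: "\<And>t. t \<in> \<phi> ` U \<Longrightarrow> inv_into U \<phi> t = pclass (affine_point i j k t (g t))"
  define S where "S = \<phi> ` (U \<inter> \<pi> -` V)"
  have sub: "S \<subseteq> \<phi> ` U" unfolding S_def by blast
  have inj: "inj_on \<phi> U" using U complex_chartD(3) unfolding atlas_iff by blast
  have UE: "U \<subseteq> E" using U complex_chartD(4) topspace_surface unfolding atlas_iff by blast
  have "openin curve V" using V complex_chartD(1) unfolding curve_atlas_iff by blast
  then have S: "open S" unfolding S_def by (rule chart_preimage_open(1)[OF U])
  have "(\<lambda>t. \<psi> (\<pi> (pclass (affine_point i j k t (g t))))) holomorphic_on S"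
  proof (rule holomorphic_funD[OF holomorphic_fun_curve_chart[OF V] S])
    show "(\<lambda>t. affine_point i j k t (g t) $ l) holomorphic_on S" for l
      by (rule holomorphic_affine_point[OF ijk holomorphic_on_subset[OF g sub]])
    fix t assume t: "t \<in> S"
    then have tU: "t \<in> \<phi> ` U" using sub by blast
    show "affine_point i j k t (g t) \<in> zeros" by (rule z[OF tU])
    obtain x where x: "x \<in> U" "\<pi> x \<in> V" "t = \<phi> x" using t unfolding S_def by blast
    have "inv_into U \<phi> t = x" unfolding x(3) by (rule inv_into_f_f[OF inj x(1)])
    then have "pclass (affine_point i j k t (g t)) = x" using inv[OF tU] by simp
    then show "pclass (affine_point i j k t (g t)) \<in> {P \<in> E. \<pi> P \<in> V}" using x UE by blast
  qed
  then have "(\<lambda>z. \<psi> (\<pi> (inv_into U \<phi> z))) holomorphic_on S"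
    by (rule holomorphic_transform) (use inv sub in auto)
  then show ?thesis unfolding S_def .
qed

lemma holomorphic_map_cover: "holomorphic_map surface atlas curve (curve_atlas a f) \<pi>"
  unfolding holomorphic_map_def o_def
  using continuous_cover by (auto intro: cover_local_holomorphic)

text \<open>In a chart of the cover both charts of the curve become holomorphic functions
  \<open>h\<close> and \<open>k\<close>, and the transition \<open>T\<close> satisfies
  \<open>T (h z) = k z\<close>. \<open>T\<close> is continuous because the charts are
  homeomorphisms, so it is holomorphic by \<open>holomorphic_factor\<close>.\<close>

lemma curve_transition_holomorphic:
  assumes V: "(V, \<psi>) \<in> curve_atlas a f" and V': "(V', \<psi>') \<in> curve_atlas a f"
  shows "(\<psi>' \<circ> inv_into V \<psi>) holomorphic_on \<psi> ` (V \<inter> V')"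
proof -
  define T where "T = \<psi>' \<circ> inv_into V \<psi>"
  have chart: "complex_chart curve V \<psi>" and chart': "complex_chart curve V' \<psi>'"
    using V V' unfolding curve_atlas_iff by blast+
  note D = complex_chartD[OF chart] and D' = complex_chartD[OF chart']
  have inv: "inv_into V \<psi> (\<psi> q) = q" if "q \<in> V" for q using D(3) that by (rule inv_into_f_f)
  have contT: "continuous_on (\<psi> ` (V \<inter> V')) T"
  proof -
    have "continuous_map (top_of_set (\<psi> ` (V \<inter> V'))) curve (inv_into V \<psi>)"
      using continuous_map_from_subtopology_mono[OF D(6), of "\<psi> ` (V \<inter> V')"]
        continuous_map_into_fulltopology by blast
    moreover have "inv_into V \<psi> ` (\<psi> ` (V \<inter> V')) \<subseteq> V'" using inv by auto
    ultimately have "continuous_map (top_of_set (\<psi> ` (V \<inter> V'))) (subtopology curve V') (inv_into V \<psi>)"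
      by (auto simp: continuous_map_in_subtopology)
    from continuous_map_compose[OF this D'(5)] show ?thesis by (simp add: T_def)
  qed
  have "T field_differentiable at v0" if v0: "v0 \<in> \<psi> ` (V \<inter> V')" for v0
  proof -
    obtain q where q: "q \<in> V" "q \<in> V'" "v0 = \<psi> q" using v0 by blast
    have "q \<in> \<pi> ` E" using q(1) D(4) unfolding topspace_curve cover_map_image by blast
    then obtain P where P: "P \<in> E" "q = \<pi> P" by blast
    obtain U \<phi> where U: "(U, \<phi>) \<in> atlas" "P \<in> U" using P(1) by (rule chart_at)
    have chartU: "complex_chart surface U \<phi>" using U(1) unfolding atlas_iff by blast
    define S where "S = \<phi> ` (U \<inter> \<pi> -` (V \<inter> V'))"
    define h where "h = (\<lambda>z. \<psi> (\<pi> (inv_into U \<phi> z)))"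
    define k where "k = (\<lambda>z. \<psi>' (\<pi> (inv_into U \<phi> z)))"
    have S: "open S" unfolding S_def
      by (rule chart_preimage_open(1)[OF U(1) openin_Int[OF D(1) D'(1)]])
    have h: "h holomorphic_on S" unfolding h_def
      by (rule holomorphic_on_subset[OF cover_local_holomorphic[OF U(1) V]]) (auto simp: S_def)
    have k: "k holomorphic_on S" unfolding k_def
      by (rule holomorphic_on_subset[OF cover_local_holomorphic[OF U(1) V']]) (auto simp: S_def)
    have invS: "inv_into U \<phi> z \<in> U" "\<phi> (inv_into U \<phi> z) = z" "\<pi> (inv_into U \<phi> z) \<in> V \<inter> V'" if zS: "z \<in> S" for z
    proof -
      obtain x where x: "x \<in> U" "\<pi> x \<in> V \<inter> V'" "z = \<phi> x" using zS unfolding S_def by blast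
      have "inv_into U \<phi> z = x" unfolding x(3) by (rule inv_into_f_f[OF complex_chartD(3)[OF chartU] x(1)])
      then show "inv_into U \<phi> z \<in> U" "\<phi> (inv_into U \<phi> z) = z" "\<pi> (inv_into U \<phi> z) \<in> V \<inter> V'" using x by simp_all
    qed
    have Th: "T (h z) = k z" if "z \<in> S" for z
      using inv[of "\<pi> (inv_into U \<phi> z)"] invS(3)[OF that] by (simp add: T_def h_def k_def)
    have hS: "h ` S \<subseteq> \<psi> ` (V \<inter> V')"
    proof (rule image_subsetI)
      show "h z \<in> \<psi> ` (V \<inter> V')" if "z \<in> S" for z unfolding h_def using invS(3)[OF that] by (rule imageI)
    qed
    \<comment> \<open>Injectivity of \<open>\<psi>\<close> on \<open>V\<close> identifies fibres of
      \<open>h\<close> with parts of fibres of \<open>\<pi>\<close>, which are finite.\<close>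
    have fin: "finite {w \<in> S. h w = h z}" if z: "z \<in> S" for z
    proof (rule finite_subset)
      show "{w \<in> S. h w = h z} \<subseteq> \<phi> ` {Q \<in> E. \<pi> Q = \<pi> (inv_into U \<phi> z)}"
      proof
        fix w assume "w \<in> {w \<in> S. h w = h z}"
        then have w: "w \<in> S" "\<psi> (\<pi> (inv_into U \<phi> w)) = \<psi> (\<pi> (inv_into U \<phi> z))" by (simp_all add: h_def)
        have "\<pi> (inv_into U \<phi> w) = \<pi> (inv_into U \<phi> z)"
          by (rule inj_onD[OF D(3) w(2)]) (use invS(3)[OF w(1)] invS(3)[OF z] in blast)+
        moreover have "inv_into U \<phi> w \<in> E"
          using invS(1)[OF w(1)] complex_chartD(4)[OF chartU] topspace_surface by blast
        ultimately have "\<phi> (inv_into U \<phi> w) \<in> \<phi> ` {Q \<in> E. \<pi> Q = \<pi> (inv_into U \<phi> z)}" by blast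
        then show "w \<in> \<phi> ` {Q \<in> E. \<pi> Q = \<pi> (inv_into U \<phi> z)}" unfolding invS(2)[OF w(1)] .
      qed
      show "finite (\<phi> ` {Q \<in> E. \<pi> Q = \<pi> (inv_into U \<phi> z)})" by (rule finite_imageI[OF finite_fibre])
    qed
    note factor = S h k fin continuous_on_subset[OF contT hS] Th
    have "T holomorphic_on h ` S" by (rule holomorphic_factor[OF factor])
    moreover have "open (h ` S)" by (rule open_image_finite_fibres[OF S h fin])
    moreover have "v0 \<in> h ` S"
    proof (rule image_eqI[of _ _ "\<phi> P"])
      have "inv_into U \<phi> (\<phi> P) = P" by (rule inv_into_f_f[OF complex_chartD(3)[OF chartU] U(2)])
      then show "v0 = h (\<phi> P)" by (simp add: h_def q(3) P(2))
      show "\<phi> P \<in> S" unfolding S_def using U(2) q(1,2) P(2) by blast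
    qed
    ultimately show ?thesis using holomorphic_on_imp_differentiable_at by blast
  qed
  then show ?thesis unfolding T_def[symmetric] holomorphic_on_def by (simp add: field_differentiable_at_within)
qed

lemma atlas_maximal: "(U, \<phi>) \<in> atlas \<Longrightarrow> (U, \<phi>) \<in> maximal_atlas surface atlas"
  using complex_atlas_surface unfolding complex_atlas_def maximal_atlas_def by blast

lemma atlas_restrict:
  assumes "(U, \<phi>) \<in> atlas" "openin surface U'" "U' \<subseteq> U"
  shows "(U', \<phi>) \<in> atlas"
proof -
  have "complex_chart surface U \<phi>" using assms(1) unfolding atlas_iff by blast
  then have "complex_chart surface U' \<phi>" using assms(2,3) by (rule complex_chart_subset)
  then show ?thesis using assms(1,3) unfolding atlas_iff by blast
qed

section \<open>Stabilisers, invariant neighbourhoods and the character of a stabiliser\<close>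

lemma subgroup_stabilizer: "P \<in> E \<Longrightarrow> subgroup (stabilizer G act P) G"
  by (rule group_action.stabilizer_subgroup[OF group_action_cover])

lemma stabilizer_mult:
  assumes "P \<in> E" "g \<in> stabilizer G act P" "h \<in> stabilizer G act P"
  shows "g * h \<in> stabilizer G act P"
  using subgroup.m_closed[OF subgroup_stabilizer assms(2,3)] assms(1) by (simp add: mult_eq)

lemma stabilizer_inv:
  assumes "P \<in> E" "g \<in> stabilizer G act P"
  shows "inv\<^bsub>G\<^esub> g \<in> stabilizer G act P"
  using subgroup.m_inv_closed[OF subgroup_stabilizer assms(2)] assms(1) by blast

lemma one_in_stabilizer: "P \<in> E \<Longrightarrow> 1 \<in> stabilizer G act P"
  using subgroup.one_closed[OF subgroup_stabilizer] by (simp add: one_eq)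

lemma finite_stabilizer: "finite (stabilizer G act P)"
  by (rule finite_subset[OF _ finite_carrier]) (auto simp: mem_stabilizer_iff)

lemma inv_mult: "g \<in> carrier G \<Longrightarrow> inv\<^bsub>G\<^esub> g * g = 1" "g \<in> carrier G \<Longrightarrow> g * inv\<^bsub>G\<^esub> g = 1"
  using l_inv[of g] r_inv[of g] by (simp_all add: one_eq mult_eq)

text \<open>An element outside the stabiliser moves \<open>P\<close>, so by the Hausdorff property
  it moves some neighbourhood of \<open>P\<close> off itself. Finitely many such neighbourhoods are
  intersected, and the result is made invariant by intersecting its preimages under the
  stabiliser.\<close>

lemma small_invariant_neighbourhood:
  assumes P: "P \<in> E" and U0: "openin surface U0" "P \<in> U0"
  obtains U where "openin surface U" "P \<in> U" "U \<subseteq> U0"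
    "\<And>g. g \<in> stabilizer G act P \<Longrightarrow> act g ` U = U"
    "\<And>g. g \<in> carrier G - stabilizer G act P \<Longrightarrow> act g ` U \<inter> U = {}"
proof -
  let ?H = "stabilizer G act P"
  have "\<exists>N. openin surface N \<and> P \<in> N \<and> (\<forall>x\<in>N. act g x \<notin> N)" if g: "g \<in> carrier G - ?H" for g
  proof -
    have gG: "g \<in> carrier G" and ne: "P \<noteq> act g P" using g by (auto simp: mem_stabilizer_iff)
    have "act g P \<in> E" using act_in_E[OF gG P] .
    then obtain N M where N: "openin surface N" "openin surface M" "P \<in> N" "act g P \<in> M" "disjnt N M"
      using Hausdorff_space_surface P ne unfolding Hausdorff_space_def topspace_surface by metis
    have "openin surface (N \<inter> {x \<in> topspace surface. act g x \<in> M})"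
      by (intro openin_Int N openin_continuous_map_preimage[OF continuous_act[OF gG]])
    moreover have "P \<in> N \<inter> {x \<in> topspace surface. act g x \<in> M}"
      using N P by (simp add: topspace_surface)
    ultimately show ?thesis using N(5) unfolding disjnt_def by blast
  qed
  then have "\<forall>g\<in>carrier G - ?H. \<exists>N. openin surface N \<and> P \<in> N \<and> (\<forall>x\<in>N. act g x \<notin> N)" by blast
  from bchoice[OF this] obtain N where
    N: "\<forall>g\<in>carrier G - ?H. openin surface (N g) \<and> P \<in> N g \<and> (\<forall>x\<in>N g. act g x \<notin> N g)" ..
  \<comment> \<open>Disjointness from the translates passes to subsets, so it is arranged first; the
    later shrinking to an invariant set cannot destroy it.\<close>
  define M where "M = U0 \<inter> \<Inter>(N ` (carrier G - ?H))"
  have M: "openin surface M" unfolding M_def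
    by (rule openin_Int_Inter) (use N U0 finite_carrier in auto)
  have PM: "P \<in> M" using N U0 by (auto simp: M_def)
  define W where "W = (\<lambda>h. {x \<in> topspace surface. act h x \<in> M})"
  define U where "U = topspace surface \<inter> \<Inter>(W ` ?H)"
  have W: "openin surface (W h)" if "h \<in> ?H" for h
    unfolding W_def using that
    by (intro openin_continuous_map_preimage[OF continuous_act M]) (simp add: mem_stabilizer_iff)
  have U_open: "openin surface U" unfolding U_def
    by (rule openin_Int_Inter) (use W finite_stabilizer in auto)
  have U_iff: "x \<in> U \<longleftrightarrow> x \<in> E \<and> (\<forall>h\<in>?H. act h x \<in> M)" for x
    by (auto simp: U_def W_def topspace_surface)
  have "P \<in> U" unfolding U_iff using P PM by (simp add: mem_stabilizer_iff)
  moreover have UM: "x \<in> M" if "x \<in> U" for x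
    using that one_in_stabilizer[OF P] act_one[of x] unfolding U_iff by force
  then have "U \<subseteq> U0" unfolding M_def by blast
  moreover have sub: "act g ` U \<subseteq> U" if g: "g \<in> ?H" for g
  proof (rule image_subsetI)
    fix x assume x: "x \<in> U"
    have gG: "g \<in> carrier G" using g by (simp add: mem_stabilizer_iff)
    have xE: "x \<in> E" using x unfolding U_iff by blast
    have "act h (act g x) \<in> M" if h: "h \<in> ?H" for h
    proof -
      have hG: "h \<in> carrier G" using h by (simp add: mem_stabilizer_iff)
      have "act (h * g) x \<in> M" using x stabilizer_mult[OF P h g] unfolding U_iff by blast
      then show ?thesis unfolding act_mult[OF hG gG xE] .
    qed
    then show "act g x \<in> U" unfolding U_iff using act_in_E[OF gG xE] by blast
  qed
  have stable: "act g ` U = U" if g: "g \<in> ?H" for g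
  proof (rule equalityI[OF sub[OF g]])
    have gG: "g \<in> carrier G" using g by (simp add: mem_stabilizer_iff)
    show "U \<subseteq> act g ` U"
    proof
      fix x assume x: "x \<in> U"
      then have "x \<in> E" unfolding U_iff by blast
      then have "x = act g (act (inv\<^bsub>G\<^esub> g) x)" using act_inverse(2)[OF gG] by simp
      moreover have "act (inv\<^bsub>G\<^esub> g) x \<in> U" using sub[OF stabilizer_inv[OF P g]] x by blast
      ultimately show "x \<in> act g ` U" by (rule image_eqI)
    qed
  qed
  have disj: "act g ` U \<inter> U = {}" if g: "g \<in> carrier G - ?H" for g
  proof (rule ccontr)
    assume "act g ` U \<inter> U \<noteq> {}"
    then obtain x where "x \<in> U" "act g x \<in> U" by blast
    then have "x \<in> N g" "act g x \<in> N g" using UM g unfolding M_def by blast+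
    then show False using N g by blast
  qed
  from that[OF U_open \<open>P \<in> U\<close> \<open>U \<subseteq> U0\<close> stable disj] show ?thesis .
qed

text \<open>Multiplication by \<open>g\<close> permutes the stabiliser, so the product of all
  character values is unchanged when multiplied by the \<open>n\<close>-th power of the value at
  \<open>g\<close>, where \<open>n\<close> is the order; that power is therefore 1. Injectivity then
  gives \<open>n\<close> distinct \<open>n\<close>-th roots of unity, which is all of them.\<close>

lemma stabilizer_character:
  fixes y :: "complex ^ 3"
  assumes ijk: "{i, j, k} = (UNIV :: 3 set)" and y: "y \<in> zeros" "y $ i \<noteq> 0"
    "partial3 k (straight_cover_poly a f) y \<noteq> 0"
  defines "H \<equiv> stabilizer G act (pclass y)"
  shows "(\<lambda>g :: complex ^ 3. g $ j / g $ i) ` H = {z. z ^ card H = 1}"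
proof (rule card_subset_eq)
  have P: "pclass y \<in> E" using y(1) pclass_in_pcurve_iff by blast
  have HG: "g \<in> carrier G" if "g \<in> H" for g using that by (simp add: H_def mem_stabilizer_iff)
  have fin: "finite H" unfolding H_def by (rule finite_stabilizer)
  have "1 \<in> H" unfolding H_def by (rule one_in_stabilizer[OF P])
  then have card0: "card H > 0" using fin by (auto simp: card_gt_0_iff)
  then show "finite {z :: complex. z ^ card H = 1}" by (intro finite_roots_unity) simp
  show "(\<lambda>g :: complex ^ 3. g $ j / g $ i) ` H \<subseteq> {z. z ^ card H = 1}"
  proof (rule image_subsetI)
    fix g assume g: "g \<in> H"
    have inv: "inv\<^bsub>G\<^esub> g \<in> H" using g unfolding H_def by (rule stabilizer_inv[OF P])
    have "bij_betw ((*) g) H H"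
    proof (rule bij_betw_byWitness[where f' = "(*) (inv\<^bsub>G\<^esub> g)"])
      show "\<forall>h\<in>H. inv\<^bsub>G\<^esub> g * (g * h) = h" "\<forall>h\<in>H. g * (inv\<^bsub>G\<^esub> g * h) = h"
        using inv_mult[OF HG[OF g]] by (simp_all add: mult.assoc[symmetric])
      show "(*) g ` H \<subseteq> H" "(*) (inv\<^bsub>G\<^esub> g) ` H \<subseteq> H"
        using stabilizer_mult[OF P] g inv unfolding H_def by blast+
    qed
    from prod.reindex_bij_betw[OF this, of "\<lambda>g :: complex ^ 3. g $ j / g $ i"]
    have "(\<Prod>h\<in>H. (g $ j / g $ i) * (h $ j / h $ i)) = (\<Prod>h\<in>H. h $ j / h $ i)" by simp
    then have "(g $ j / g $ i) ^ card H * (\<Prod>h\<in>H. h $ j / h $ i) = 1 * (\<Prod>h\<in>H. h $ j / h $ i)"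
      unfolding prod.distrib by simp
    moreover have "(\<Prod>h\<in>H. h $ j / h $ i) \<noteq> 0"
      using fin HG carrier_nonzero by auto
    ultimately have "(g $ j / g $ i) ^ card H = 1" using mult_cancel_right by blast
    then show "g $ j / g $ i \<in> {z. z ^ card H = 1}" by blast
  qed
  have "inj_on (\<lambda>g :: complex ^ 3. g $ j / g $ i) H"
  proof (rule inj_onI)
    fix g h assume g: "g \<in> H" and h: "h \<in> H" and eq: "g $ j / g $ i = h $ j / h $ i"
    have "inv\<^bsub>G\<^esub> h \<in> H" using h unfolding H_def by (rule stabilizer_inv[OF P])
    then have m: "inv\<^bsub>G\<^esub> h * g \<in> H" using g stabilizer_mult[OF P] unfolding H_def by blast
    have ih: "(inv\<^bsub>G\<^esub> h) $ l = 1 / h $ l" for l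
      using arg_cong[OF inv_mult(1)[OF HG[OF h]], of "\<lambda>v. v $ l"] carrier_nonzero[OF HG[OF h], of l]
      by (simp add: field_simps)
    have "(inv\<^bsub>G\<^esub> h * g) $ j = (inv\<^bsub>G\<^esub> h * g) $ i"
      using eq carrier_nonzero[OF HG[OF h]] carrier_nonzero[OF HG[OF g]] by (simp add: ih field_simps)
    then have "inv\<^bsub>G\<^esub> h * g = 1" using stabilizer_faithful[OF ijk y] m unfolding H_def by blast
    then have "h * (inv\<^bsub>G\<^esub> h * g) = h" by simp
    then show "g = h" using inv_mult(2)[OF HG[OF h]] by (simp add: mult.assoc[symmetric])
  qed
  then show "card ((\<lambda>g :: complex ^ 3. g $ j / g $ i) ` H) = card {z :: complex. z ^ card H = 1}"
    using card0 by (simp add: card_image card_roots_unity_eq)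
qed

text \<open>
  In the affine coordinate of the plane curve the stabiliser acts linearly, so that the orbit chart
  is a power map up to a constant.
\<close>

lemma orbit_chart_exists:
  assumes U0: "(U0, \<phi>) \<in> atlas" and PU0: "P \<in> U0"
  obtains V \<psi> U b where "(V, \<psi>) \<in> curve_atlas a f" "openin surface U" "U \<subseteq> U0" "P \<in> U" "V = \<pi> ` U"
    "b \<noteq> 0" "\<And>x. x \<in> U \<Longrightarrow> \<psi> (\<pi> x) = b * (\<phi> x - \<phi> P) ^ card (stabilizer G act P)"
proof -
  define H where "H = stabilizer G act P"
  define n where "n = card H"
  obtain i j k where ijk: "{i, j, k} = (UNIV :: 3 set)" and chart0: "complex_chart surface U0 \<phi>"
    and coord: "\<And>y. y \<in> zeros \<Longrightarrow> pclass y \<in> U0 \<Longrightarrow>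
      y $ i \<noteq> 0 \<and> partial3 k (straight_cover_poly a f) y \<noteq> 0 \<and> \<phi> (pclass y) = y $ j / y $ i"
    using U0 unfolding atlas_iff by blast
  have U0E: "U0 \<subseteq> E" using complex_chartD(4)[OF chart0] topspace_surface by simp
  have PE: "P \<in> E" using PU0 U0E by blast
  then obtain y where y: "y \<in> zeros" "P = pclass y" by (rule E_cases)
  have yc: "y $ i \<noteq> 0" "partial3 k (straight_cover_poly a f) y \<noteq> 0" "\<phi> P = y $ j / y $ i"
    using coord[OF y(1)] PU0 y(2) by simp_all
  define \<rho> where "\<rho> = (\<lambda>g :: complex ^ 3. g $ j / g $ i)"
  have char: "\<rho> ` H = {z. z ^ n = 1}"
    unfolding \<rho>_def n_def H_def y(2) by (rule stabilizer_character[OF ijk y(1) yc(1,2)])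
  have HG: "g \<in> carrier G" if "g \<in> H" for g using that by (simp add: H_def mem_stabilizer_iff)
  have fin: "finite H" unfolding H_def by (rule finite_stabilizer)
  have one: "1 \<in> H" unfolding H_def by (rule one_in_stabilizer[OF PE])
  have n0: "n > 0" using fin one by (auto simp: n_def card_gt_0_iff)
  \<comment> \<open>If \<open>\<phi> P\<close> is nonzero then so are \<open>y $ i\<close> and
    \<open>y $ j\<close>; an element fixing the class has equal components there, so its character
    is trivial and the element is 1.\<close>
  have triv: "H = {1}" if "\<phi> P \<noteq> 0"
  proof -
    have yj: "y $ j \<noteq> 0" using that yc(3) by auto
    have "s = 1" if s: "s \<in> H" for s
      using stabilizer_faithful[OF ijk y(1) yc(1,2)] stabilizer_ratio[OF y(1) _ yc(1) yj] s
      unfolding H_def y(2) by blast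
    then show ?thesis using one by blast
  qed
  obtain U where U': "openin surface U" "P \<in> U" "U \<subseteq> U0"
    "\<And>g. g \<in> stabilizer G act P \<Longrightarrow> act g ` U = U"
    "\<And>g. g \<in> carrier G - stabilizer G act P \<Longrightarrow> act g ` U \<inter> U = {}"
    by (rule small_invariant_neighbourhood[OF PE complex_chartD(1)[OF chart0] PU0]) (rule that)
  note U = U'[folded H_def]
  have UA: "(U, \<phi>) \<in> atlas" by (rule atlas_restrict[OF U0 U(1,3)])
  have chart: "complex_chart surface U \<phi>" using UA unfolding atlas_iff by blast
  note D = complex_chartD[OF chart]
  have UE: "U \<subseteq> E" using U(3) U0E by (rule subset_trans)
  have act_coord: "\<phi> (act g x) = \<rho> g * \<phi> x" if x: "x \<in> U" and g: "g \<in> H" for g x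
  proof -
    have "x \<in> E" using x UE by blast
    then obtain w where w: "w \<in> zeros" "x = pclass w" by (rule E_cases)
    have "act g x \<in> act g ` U" using x by (rule imageI)
    then have "pclass (g * w) \<in> U" unfolding U(4)[OF g] w(2) act_pclass[OF w(1)] .
    then have "pclass (g * w) \<in> U0" "pclass w \<in> U0" using x w(2) U(3) by blast+
    moreover have "g * w \<in> zeros" using zeros_act[OF HG[OF g]] w(1) by blast
    ultimately have "\<phi> (pclass (g * w)) = (g * w) $ j / (g * w) $ i" "\<phi> (pclass w) = w $ j / w $ i"
      using coord w(1) by blast+
    then show ?thesis unfolding w(2) act_pclass[OF w(1)] by (simp add: \<rho>_def)
  qed
  \<comment> \<open>If \<open>\<phi> P = 0\<close>, the factors of the orbit chart are
    \<open>\<rho> g * \<phi> x\<close>, and their constants multiply to \<open>b\<close>. Otherwise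
    the stabiliser is trivial, \<open>n = 1\<close>, and the chart is the centred coordinate
    itself.\<close>
  define b where "b = (if \<phi> P = 0 then \<Prod>g\<in>H. \<rho> g else 1)"
  define F where "F = (\<lambda>z. b * (z - \<phi> P) ^ n)"
  have b: "b \<noteq> 0" using fin HG carrier_nonzero by (auto simp: b_def \<rho>_def)
  have vals: "(\<Prod>g\<in>H. \<phi> (act g x) - \<phi> P) = F (\<phi> x)" if x: "x \<in> U" for x
  proof (cases "\<phi> P = 0")
    case True
    have "(\<Prod>g\<in>H. \<phi> (act g x) - \<phi> P) = (\<Prod>g\<in>H. \<rho> g * \<phi> x)"
      by (intro prod.cong refl) (simp add: act_coord[OF x] True)
    then show ?thesis by (simp add: True F_def b_def n_def prod.distrib)
  next
    case False
    have "x \<in> E" using x UE by blast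
    then show ?thesis using triv[OF False] False by (simp add: F_def b_def n_def act_one)
  qed
  \<comment> \<open>This is the injectivity of \<open>\<psi>\<close>: two coordinates with equal
    \<open>n\<close>-th powers differ by an \<open>n\<close>-th root of unity, and every such root
    is the character of some element of the stabiliser.\<close>
  have F_orbit: "\<pi> x = \<pi> x'" if x: "x \<in> U" "x' \<in> U" and eq: "F (\<phi> x) = F (\<phi> x')" for x x'
  proof -
    have "\<exists>g\<in>H. \<phi> x' = \<rho> g * \<phi> x"
    proof (cases "\<phi> P = 0")
      case True
      then have pow: "\<phi> x' ^ n = \<phi> x ^ n" using eq b by (simp add: F_def)
      show ?thesis
      proof (cases "\<phi> x = 0")
        case True
        then have "\<phi> x' = 0" using pow n0 by (simp add: power_0_left)
        then show ?thesis using one True by auto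
      next
        case False
        then have "\<phi> x' / \<phi> x \<in> {z. z ^ n = 1}" using pow by (simp add: power_divide)
        then obtain g where "g \<in> H" "\<phi> x' / \<phi> x = \<rho> g" unfolding char[symmetric] by blast
        then show ?thesis using False by (metis nonzero_divide_eq_eq)
      qed
    next
      case False
      then have "\<phi> x' = \<phi> x" using eq b triv[OF False] by (simp add: F_def n_def)
      moreover have "\<rho> 1 = 1" by (simp add: \<rho>_def)
      ultimately show ?thesis using one by (intro bexI[of _ 1]) simp_all
    qed
    then obtain g where g: "g \<in> H" "\<phi> x' = \<rho> g * \<phi> x" by blast
    have "act g x \<in> act g ` U" using x(1) by (rule imageI)
    then have "act g x \<in> U" unfolding U(4)[OF g(1)] .
    then have "act g x = x'" using act_coord[OF x(1) g(1)] g(2) inj_onD[OF D(3) _ _ x(2)] by simp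
    then show ?thesis using cover_map_act[OF HG[OF g(1)], of x] x(1) UE by auto
  qed
  \<comment> \<open>This makes \<open>\<psi>\<close> well defined: points of \<open>U\<close> in one
    orbit are related by an element of the stabiliser, as all other elements move \<open>U\<close>
    off itself.\<close>
  have F_well: "F (\<phi> x) = F (\<phi> x')" if x: "x \<in> U" "x' \<in> U" and eq: "\<pi> x = \<pi> x'" for x x'
  proof -
    have "x \<in> E" "x' \<in> E" using x UE by blast+
    then obtain s where s: "s \<in> carrier G" "x' = act s x" using cover_map_eqD[OF _ _ eq] by blast
    have "x' \<in> act s ` U" unfolding s(2) using x(1) by (rule imageI)
    then have sH: "s \<in> H" using U(5)[of s] s(1) x(2) by blast
    have \<rho>s: "\<phi> x' = \<rho> s * \<phi> x" unfolding s(2) by (rule act_coord[OF x(1) sH])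
    show ?thesis
    proof (cases "\<phi> P = 0")
      case True
      have "\<rho> s \<in> \<rho> ` H" using sH by (rule imageI)
      then have "\<rho> s ^ n = 1" unfolding char by blast
      then show ?thesis by (simp add: F_def True \<rho>s power_mult_distrib)
    next
      case False
      then have "s = 1" using triv sH by blast
      then show ?thesis unfolding s(2) using act_one[OF \<open>x \<in> E\<close>] by simp
    qed
  qed
  define V where "V = \<pi> ` U"
  define \<psi> where "\<psi> = (\<lambda>v. F (\<phi> (inv_into U \<pi> v)))"
  have \<psi>: "\<psi> (\<pi> x) = F (\<phi> x)" if x: "x \<in> U" for x
  proof -
    have "\<pi> x \<in> \<pi> ` U" using x by (rule imageI)
    from F_well[OF inv_into_into[OF this] x f_inv_into_f[OF this]] show ?thesis unfolding \<psi>_def .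
  qed
  have V: "openin curve V" unfolding V_def by (rule openin_cover_image[OF U(1)])
  have VY: "V \<subseteq> topspace curve" using V by (rule openin_subset)
  have F_hol: "F holomorphic_on UNIV" unfolding F_def by (intro holomorphic_intros)
  have F_open: "open (F ` A)" if "open A" for A
  proof (rule open_mapping_thm[OF F_hol open_UNIV connected_UNIV that subset_UNIV])
    have "F (\<phi> P) \<noteq> F (\<phi> P + 1)" using b n0 by (simp add: F_def power_0_left)
    then show "\<not> F constant_on UNIV" unfolding constant_on_def by (metis UNIV_I)
  qed
  have F_cont: "continuous_on UNIV F" using F_hol by (rule holomorphic_on_imp_continuous_on)
  have im: "\<psi> ` W = F ` \<phi> ` (U \<inter> \<pi> -` W)" if "W \<subseteq> V" for W
  proof (intro equalityI subsetI)
    fix z assume "z \<in> \<psi> ` W"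
    then obtain v where v: "v \<in> W" "z = \<psi> v" by blast
    then have "v \<in> \<pi> ` U" using that unfolding V_def by blast
    then obtain x where x: "x \<in> U" "v = \<pi> x" by blast
    have "z = F (\<phi> x)" unfolding v(2) x(2) by (rule \<psi>[OF x(1)])
    then show "z \<in> F ` \<phi> ` (U \<inter> \<pi> -` W)" using x v(1) by blast
  next
    fix z assume "z \<in> F ` \<phi> ` (U \<inter> \<pi> -` W)"
    then obtain x where x: "x \<in> U" "\<pi> x \<in> W" "z = F (\<phi> x)" by blast
    have "z = \<psi> (\<pi> x)" unfolding x(3) by (rule \<psi>[OF x(1), symmetric])
    then show "z \<in> \<psi> ` W" using x(2) by (rule image_eqI)
  qed
  have im_open: "open (\<psi> ` W)" if "openin curve W" "W \<subseteq> V" for W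
    unfolding im[OF that(2)] by (rule F_open[OF chart_preimage_open(1)[OF UA that(1)]])
  have inj: "inj_on \<psi> V"
  proof (rule inj_onI)
    fix v v' assume "v \<in> V" "v' \<in> V" and eq: "\<psi> v = \<psi> v'"
    then obtain x x' where x: "x \<in> U" "v = \<pi> x" "x' \<in> U" "v' = \<pi> x'" unfolding V_def by blast
    show "v = v'" unfolding x(2,4)
      by (rule F_orbit[OF x(1,3)]) (use eq \<psi>[OF x(1)] \<psi>[OF x(3)] in \<open>simp only: x(2,4)\<close>)
  qed
  have cont: "continuous_map (subtopology curve V) (top_of_set (\<psi> ` V)) \<psi>"
  proof -
    have "openin curve {v \<in> V. \<psi> v \<in> N}" if N: "open N" for N
    proof -
      have "open (F -` N)" using F_cont N by (rule open_vimage[rotated])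
      then have "openin (subtopology surface U) {x \<in> topspace (subtopology surface U). \<phi> x \<in> F -` N}"
        by (intro openin_continuous_map_preimage[OF D(5)]) (simp only: open_openin)
      then have "openin surface {x \<in> topspace (subtopology surface U). \<phi> x \<in> F -` N}"
        using U(1) by (rule openin_trans_full)
      then have "openin curve (\<pi> ` {x \<in> topspace (subtopology surface U). \<phi> x \<in> F -` N})"
        by (rule openin_cover_image)
      moreover have "\<pi> ` {x \<in> topspace (subtopology surface U). \<phi> x \<in> F -` N} = {v \<in> V. \<psi> v \<in> N}"
        using UE \<psi> unfolding V_def topspace_subtopology topspace_surface by auto
      ultimately show ?thesis by simp
    qed
    then have "openin (subtopology curve V) {v \<in> V. \<psi> v \<in> N}" if "open N" for N
      using that V by (simp add: openin_open_subtopology)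
    then have "continuous_map (subtopology curve V) euclidean \<psi>"
      using VY by (auto simp: continuous_map_def topspace_subtopology Int_absorb1 simp flip: open_openin)
    then show ?thesis by (auto simp: continuous_map_in_subtopology)
  qed
  have "homeomorphic_map (subtopology curve V) (top_of_set (\<psi> ` V)) \<psi>"
  proof (rule bijective_open_imp_homeomorphic_map[OF cont])
    show "open_map (subtopology curve V) (top_of_set (\<psi> ` V)) \<psi>"
      unfolding open_map_def
    proof (intro allI impI)
      fix W assume "openin (subtopology curve V) W"
      then have W: "openin curve W" "W \<subseteq> V" using V by (simp_all add: openin_open_subtopology)
      show "openin (top_of_set (\<psi> ` V)) (\<psi> ` W)"
        by (rule open_subset[OF image_mono[OF W(2)] im_open[OF W]])
    qed
    show "\<psi> ` topspace (subtopology curve V) = topspace (top_of_set (\<psi> ` V))"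
      "inj_on \<psi> (topspace (subtopology curve V))"
      using VY inj by (simp_all add: Int_absorb1)
  qed
  then have "complex_chart curve V \<psi>"
    unfolding complex_chart_def using V im_open[OF V subset_refl] by blast
  moreover have "orbit_chart_data V \<psi> P U \<phi>"
    unfolding orbit_chart_data_def H_def[symmetric]
    using atlas_maximal[OF UA] U(2,4,5) V_def \<psi> vals by simp
  ultimately have "(V, \<psi>) \<in> curve_atlas a f" unfolding curve_atlas_iff by blast
  moreover have "\<psi> (\<pi> x) = b * (\<phi> x - \<phi> P) ^ card (stabilizer G act P)" if "x \<in> U" for x
    using \<psi>[OF that] by (simp add: F_def n_def H_def)
  ultimately show ?thesis using U(1,3,2) V_def b by (intro that)
qed

lemma complex_atlas_curve: "complex_atlas curve (curve_atlas a f)"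
  unfolding complex_atlas_def
proof (intro conjI ballI)
  show "case c of (V, \<psi>) \<Rightarrow> complex_chart curve V \<psi>" if "c \<in> curve_atlas a f" for c
    using that by (cases c) (simp add: curve_atlas_iff)
  then have "(\<Union>(V, \<psi>)\<in>curve_atlas a f. V) \<subseteq> topspace curve"
    using complex_chartD(4) by fast
  moreover have "q \<in> (\<Union>(V, \<psi>)\<in>curve_atlas a f. V)" if q: "q \<in> topspace curve" for q
  proof -
    have "q \<in> \<pi> ` E" using q unfolding topspace_curve cover_map_image .
    then obtain P where P: "P \<in> E" "q = \<pi> P" by blast
    obtain U \<phi> where U: "(U, \<phi>) \<in> atlas" "P \<in> U" using P(1) by (rule chart_at)
    obtain V \<psi> U' b where "(V, \<psi>) \<in> curve_atlas a f" "openin surface U'" "U' \<subseteq> U" "P \<in> U'" "V = \<pi> ` U'"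
      "b \<noteq> 0" "\<And>x. x \<in> U' \<Longrightarrow> \<psi> (\<pi> x) = b * (\<phi> x - \<phi> P) ^ card (stabilizer G act P)"
      by (rule orbit_chart_exists[OF U]) (rule that)
    then have "(V, \<psi>) \<in> curve_atlas a f" "q \<in> V" unfolding P(2) by blast+
    then show ?thesis by blast
  qed
  ultimately show "(\<Union>(V, \<psi>)\<in>curve_atlas a f. V) = topspace curve" by blast
  show "compatible_charts c c'" if "c \<in> curve_atlas a f" "c' \<in> curve_atlas a f" for c c'
  proof -
    obtain V \<psi> V' \<psi>' where "c = (V, \<psi>)" "c' = (V', \<psi>')" by (cases c, cases c') blast
    then show ?thesis
      using that curve_transition_holomorphic[of V \<psi> V' \<psi>'] curve_transition_holomorphic[of V' \<psi>' V \<psi>]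
      by (simp add: compatible_charts_def Int_commute)
  qed
qed

theorem compact_riemann_surface_curve: "compact_riemann_surface curve (curve_atlas a f)"
  unfolding compact_riemann_surface_def riemann_surface_def
  using connected_space_curve Hausdorff_space_curve second_countable_curve complex_atlas_curve
    compact_space_curve by blast

section \<open>Ramification indices and the degree\<close>

lemma zorder_cover:
  assumes U: "(U, \<phi>) \<in> atlas" "P \<in> U" and V: "(V, \<psi>) \<in> curve_atlas a f" "\<pi> P \<in> V"
  shows "zorder (\<lambda>z. \<psi> (\<pi> (inv_into U \<phi> z)) - \<psi> (\<pi> P)) (\<phi> P) = int (card (stabilizer G act P))"
proof -
  obtain V0 \<psi>0 U' b where V0: "(V0, \<psi>0) \<in> curve_atlas a f" "openin surface U'" "U' \<subseteq> U" "P \<in> U'" "V0 = \<pi> ` U'"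
    "b \<noteq> 0" "\<And>x. x \<in> U' \<Longrightarrow> \<psi>0 (\<pi> x) = b * (\<phi> x - \<phi> P) ^ card (stabilizer G act P)"
    by (rule orbit_chart_exists[OF U]) (rule that)
  \<comment> \<open>The charts at hand are arbitrary. \<open>T\<close> changes from the special
    chart at \<open>\<pi> P\<close>, in which the map is a constant times a power, to
    \<open>\<psi>\<close>; being injective and holomorphic, it does not affect the order of
    vanishing.\<close>
  define T where "T = \<psi> \<circ> inv_into V0 \<psi>0"
  have chart: "complex_chart curve V \<psi>" and chart0: "complex_chart curve V0 \<psi>0"
    using V(1) V0(1) unfolding curve_atlas_iff by blast+
  have chartU: "complex_chart surface U \<phi>" using U(1) unfolding atlas_iff by blast
  have inv: "inv_into V0 \<psi>0 (\<psi>0 q) = q" if "q \<in> V0" for q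
    using complex_chartD(3)[OF chart0] that by (rule inv_into_f_f)
  have T: "T (\<psi>0 q) = \<psi> q" if "q \<in> V0" for q using inv[OF that] by (simp add: T_def)
  have n0: "card (stabilizer G act P) > 0"
  proof -
    have "P \<in> E" using U(2) complex_chartD(4)[OF chartU] topspace_surface by blast
    from one_in_stabilizer[OF this] show ?thesis using finite_stabilizer by (auto simp: card_gt_0_iff)
  qed
  have PV0: "\<pi> P \<in> V0 \<inter> V" using V0(4,5) V(2) by blast
  have at0: "\<psi>0 (\<pi> P) = 0" using V0(7)[OF V0(4)] n0 by (simp add: power_0_left)
  define S where "S = \<phi> ` (U' \<inter> \<pi> -` V)"
  have pt: "\<psi>0 (\<pi> (inv_into U \<phi> z)) = 0 + b * (z - \<phi> P) ^ card (stabilizer G act P)"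
    "\<pi> (inv_into U \<phi> z) \<in> V0 \<inter> V" if zS: "z \<in> S" for z
  proof -
    obtain x where x: "x \<in> U'" "\<pi> x \<in> V" "z = \<phi> x" using zS unfolding S_def by blast
    have "x \<in> U" using x(1) V0(3) by blast
    then have ix: "inv_into U \<phi> z = x" unfolding x(3) by (rule inv_into_f_f[OF complex_chartD(3)[OF chartU]])
    show "\<psi>0 (\<pi> (inv_into U \<phi> z)) = 0 + b * (z - \<phi> P) ^ card (stabilizer G act P)"
      unfolding ix using V0(7)[OF x(1)] by (simp add: x(3))
    show "\<pi> (inv_into U \<phi> z) \<in> V0 \<inter> V" unfolding ix using x(1,2) V0(5) by blast
  qed
  show ?thesis
  proof (rule zorder_injective_comp_power[where T = T and V = "\<psi>0 ` (V0 \<inter> V)" and S = S and c = b])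
    show "T holomorphic_on \<psi>0 ` (V0 \<inter> V)" unfolding T_def by (rule curve_transition_holomorphic[OF V0(1) V(1)])
    show "open (\<psi>0 ` (V0 \<inter> V))"
      by (rule complex_chart_image_open[OF chart0 openin_Int[OF complex_chartD(1)[OF chart0] complex_chartD(1)[OF chart]]]) blast
    show "inj_on T (\<psi>0 ` (V0 \<inter> V))"
    proof (rule inj_onI)
      fix z w assume "z \<in> \<psi>0 ` (V0 \<inter> V)" "w \<in> \<psi>0 ` (V0 \<inter> V)" and eq: "T z = T w"
      then obtain p q where p: "p \<in> V0" "p \<in> V" "z = \<psi>0 p" and q: "q \<in> V0" "q \<in> V" "w = \<psi>0 q" by blast
      have "\<psi> p = \<psi> q" using eq T[OF p(1)] T[OF q(1)] by (simp only: p(3) q(3))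
      then have "p = q" using inj_onD[OF complex_chartD(3)[OF chart] _ p(2) q(2)] by blast
      then show "z = w" by (simp only: p(3) q(3))
    qed
    show "0 \<in> \<psi>0 ` (V0 \<inter> V)" using PV0 at0 by (metis imageI)
    show "open S" unfolding S_def
      by (rule chart_preimage_open(1)[OF atlas_restrict[OF U(1) V0(2,3)] complex_chartD(1)[OF chart]])
    show "\<phi> P \<in> S" unfolding S_def using V0(4) V(2) by blast
    fix z assume z: "z \<in> S"
    show "0 + b * (z - \<phi> P) ^ card (stabilizer G act P) \<in> \<psi>0 ` (V0 \<inter> V)"
      unfolding pt(1)[OF z, symmetric] using pt(2)[OF z] by (rule imageI)
    have "T (\<psi>0 (\<pi> (inv_into U \<phi> z))) = \<psi> (\<pi> (inv_into U \<phi> z))" using T pt(2)[OF z] by blast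
    moreover have "T 0 = \<psi> (\<pi> P)" using T[of "\<pi> P"] PV0 at0 by simp
    ultimately show "\<psi> (\<pi> (inv_into U \<phi> z)) - \<psi> (\<pi> P) =
        T (0 + b * (z - \<phi> P) ^ card (stabilizer G act P)) - T 0"
      unfolding pt(1)[OF z] by simp
  qed (rule V0(6), rule n0)
qed

text \<open>\<open>zorder_cover\<close> gives the value for all pairs of charts. Uniqueness also
  needs one pair of charts around \<open>P\<close> and its image, since without any pair every
  number would satisfy the condition.\<close>

lemma ramification_index_cover:
  assumes P: "P \<in> E"
  shows "ramification_index atlas (curve_atlas a f) \<pi> P = card (stabilizer G act P)"
  unfolding ramification_index_def
proof (rule the_equality)
  show "\<forall>(U, \<phi>)\<in>atlas. \<forall>(V, \<psi>)\<in>curve_atlas a f. P \<in> U \<longrightarrow> \<pi> P \<in> V \<longrightarrow>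
      zorder (\<lambda>z. \<psi> (\<pi> (inv_into U \<phi> z)) - \<psi> (\<pi> P)) (\<phi> P) = int (card (stabilizer G act P))"
    using zorder_cover by auto
  fix m assume m: "\<forall>(U, \<phi>)\<in>atlas. \<forall>(V, \<psi>)\<in>curve_atlas a f. P \<in> U \<longrightarrow> \<pi> P \<in> V \<longrightarrow>
      zorder (\<lambda>z. \<psi> (\<pi> (inv_into U \<phi> z)) - \<psi> (\<pi> P)) (\<phi> P) = int m"
  obtain U \<phi> where U: "(U, \<phi>) \<in> atlas" "P \<in> U" using P by (rule chart_at)
  have "\<pi> P \<in> \<pi> ` E" using P by (rule imageI)
  then have "\<pi> P \<in> (\<Union>(V, \<psi>)\<in>curve_atlas a f. V)"
    using complex_atlas_curve unfolding complex_atlas_def topspace_curve cover_map_image by simp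
  then obtain V \<psi> where V: "(V, \<psi>) \<in> curve_atlas a f" "\<pi> P \<in> V" by blast
  have "zorder (\<lambda>z. \<psi> (\<pi> (inv_into U \<phi> z)) - \<psi> (\<pi> P)) (\<phi> P) = int m"
    using m U V by fast
  then show "m = card (stabilizer G act P)" using zorder_cover[OF U V] by simp
qed

lemma has_degree_cover: "has_degree surface atlas curve (curve_atlas a f) \<pi> (a 0 * a 1 * a 2)"
  unfolding has_degree_def topspace_surface topspace_curve
proof (intro ballI conjI finite_fibre)
  fix q assume "q \<in> wcurve a f"
  then obtain P where P: "P \<in> E" "q = \<pi> P" unfolding cover_map_image[symmetric] by blast
  have fib: "{Q \<in> E. \<pi> Q = q} = orbit G act P" unfolding P(2) by (rule fibre_eq_orbit[OF P(1)])
  have card: "card (orbit G act P) * card (stabilizer G act Q) = order G" if Q: "Q \<in> E" "\<pi> Q = \<pi> P" for Q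
  proof -
    have "orbit G act P = orbit G act Q"
      unfolding fibre_eq_orbit[OF P(1), symmetric] fibre_eq_orbit[OF Q(1), symmetric] Q(2) ..
    then show ?thesis using group_action.orbit_stabilizer_theorem[OF group_action_cover Q(1)] by simp
  qed
  have pos_order: "order G > 0" unfolding order_G using pos by simp
  \<comment> \<open>The points of a fibre form one orbit, so cancelling the orbit's size in the
    orbit-stabiliser theorem shows that their stabilisers have equal order; the sum over the fibre
    is then a product equal to the group order.\<close>
  have same: "card (stabilizer G act Q) = card (stabilizer G act P)" if Q: "Q \<in> E" "\<pi> Q = \<pi> P" for Q
    using card[OF Q] card[OF P(1) refl] pos_order by (metis mult_cancel1 mult_0 less_irrefl)
  have "(\<Sum>Q\<in>{Q \<in> E. \<pi> Q = q}. ramification_index atlas (curve_atlas a f) \<pi> Q) =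
      (\<Sum>Q\<in>{Q \<in> E. \<pi> Q = q}. card (stabilizer G act P))"
  proof (rule sum.cong[OF refl])
    fix Q assume "Q \<in> {Q \<in> E. \<pi> Q = q}"
    then have Q: "Q \<in> E" "\<pi> Q = \<pi> P" using P(2) by simp_all
    show "ramification_index atlas (curve_atlas a f) \<pi> Q = card (stabilizer G act P)"
      unfolding ramification_index_cover[OF Q(1)] by (rule same[OF Q])
  qed
  also have "\<dots> = order G" unfolding fib using card[OF P(1) refl] by simp
  finally show "(\<Sum>Q\<in>{Q \<in> E. \<pi> Q = q}. ramification_index atlas (curve_atlas a f) \<pi> Q) = a 0 * a 1 * a 2"
    unfolding order_G .
qed

end

theorem corollary5p2p10:
  fixes a :: "3 \<Rightarrow> nat" and f :: poly3 and d :: nat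
  assumes "\<And>i. a i > 0"
    and "\<And>i j. i \<noteq> j \<Longrightarrow> coprime (a i) (a j)"
    and "weighted_homogeneous a d f"
    and "squarefree f"
    and "nonsingular f"
    and "nonsingular (straight_cover_poly a f)"
  shows "compact_riemann_surface (cover_topology a f) (cover_atlas a f) \<and>
    compact_riemann_surface (curve_topology a f) (curve_atlas a f) \<and>
    cover_map a ` pcurve (straight_cover_poly a f) = wcurve a f \<and>
    holomorphic_map (cover_topology a f) (cover_atlas a f)
      (curve_topology a f) (curve_atlas a f) (cover_map a) \<and>
    has_degree (cover_topology a f) (cover_atlas a f)
      (curve_topology a f) (curve_atlas a f) (cover_map a) (a 0 * a 1 * a 2) \<and>
    (\<forall>y \<in> pcurve (straight_cover_poly a f).
      ramification_index (cover_atlas a f) (curve_atlas a f) (cover_map a) y =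
      card (stabilizer (mu_group a) (cover_act a f) y))"
proof -
  interpret straight_cover a f d
    by unfold_locales (rule assms; assumption)+
  show ?thesis
    unfolding cover_topology_eq cover_atlas_eq curve_def[symmetric]
    using compact_riemann_surface compact_riemann_surface_curve cover_map_image holomorphic_map_cover
      has_degree_cover ramification_index_cover by blast
qed

end
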